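(* Fix $d \in \mathbb{Z}_+$ (a positive integer) and $\epsilon \in (0,1)$. Let $n = \tilde{\Omega}_d\left((1/\epsilon)^{(d+3)/2}\right)$; that is, there are constants $C_d, c_d > 0$ depending only on $d$ such that the following holds for all integers $n \ge C_d\,(1/\epsilon)^{(d+3)/2}\,(\ln(e/\epsilon))^{c_d}$. For any $f_0 \in \mathcal{F}_d$, with probability at least $9/10$ over $n$ independent samples $X_1,\dots,X_n$ drawn from $f_0$, the log-concave maximum likelihood estimator $\hat{f}_n$ satisfies $h^2(\hat{f}_n, f_0) \le \epsilon$.
   Context: A probability density $f:\mathbb{R}^d \to [0,\infty)$ is log-concave if $f = e^{\phi}$ for some upper semi-continuous concave function $\phi:\mathbb{R}^d \to [-\infty,\infty)$. $\mathcal{F}_d$ denotes the set of upper semi-continuous log-concave probability densities with respect to Lebesgue measure on $\mathbb{R}^d$. Given iid samples $X_1,\dots,X_n$ from $f_0 \in \mathcal{F}_d$, the log-concave maximum likelihood estimator (MLE) $\hat{f}_n$ is the density in $\mathcal{F}_d$ which maximizes $\frac1n \sum_{i=1}^n \log f(X_i)$ over all $f \in \mathcal{F}_d$ (with $\log 0 = -\infty$); assertions about $\hat f_n$ refer to samples for which this maximizer exists. The squared Hellinger distance between densities $f,g$ on $\mathbb{R}^d$ is $h^2(f,g) = \frac12 \int_{\mathbb{R}^d} (\sqrt{f(x)} - \sqrt{g(x)})^2\,dx$. The tilde in $\tilde\Omega_d$ hides factors logarithmic in the argument and the subscript indicates that the implied constants depend on $d$. *)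

theory Defs
  imports "HOL-Probability.Probability"
begin

definition usc :: "('a::topological_space \<Rightarrow> ereal) \<Rightarrow> bool" where
  "usc \<phi> \<longleftrightarrow> (\<forall>x. Limsup (at x) \<phi> \<le> \<phi> x)"

(* Meant for functions that avoid \<infinity>, so that no sum \<infinity> + (-\<infinity>) occurs;
   for ereal, 0 * (-\<infinity>) = 0, so the endpoints t = 0 and t = 1 are harmless. *)
definition concave_ereal :: "('a::real_vector \<Rightarrow> ereal) \<Rightarrow> bool" where
  "concave_ereal \<phi> \<longleftrightarrow>
     (\<forall>x y. \<forall>t\<in>{0..1::real}.
        ereal (1 - t) * \<phi> x + ereal t * \<phi> y \<le> \<phi> ((1 - t) *\<^sub>R x + t *\<^sub>R y))"

(* exp on [-\<infinity>, \<infinity>) with exp (-\<infinity>) = 0; the value at \<infinity> is never used. *)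
definition exp_ext :: "ereal \<Rightarrow> real" where
  "exp_ext u = (if u = -\<infinity> then 0 else exp (real_of_ereal u))"

(* log on [0, \<infinity>) with log 0 = -\<infinity>; only applied to nonnegative arguments. *)
definition ln_ext :: "real \<Rightarrow> ereal" where
  "ln_ext r = (if r = 0 then -\<infinity> else ereal (ln r))"

definition probability_density :: "('a::euclidean_space \<Rightarrow> real) \<Rightarrow> bool" where
  "probability_density f \<longleftrightarrow>
     (\<forall>x. 0 \<le> f x) \<and> f \<in> borel_measurable borel \<and> (\<integral>\<^sup>+x. ennreal (f x) \<partial>lborel) = 1"

definition log_concave :: "('a::euclidean_space \<Rightarrow> real) \<Rightarrow> bool" where
  "log_concave f \<longleftrightarrow>
     (\<exists>\<phi>. (\<forall>x. \<phi> x \<noteq> \<infinity>) \<and> usc \<phi> \<and> concave_ereal \<phi> \<and> (\<forall>x. f x = exp_ext (\<phi> x)))"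

(* Upper semi-continuity of the density is inherited from that of its logarithm. *)
definition log_concave_densities :: "('a::euclidean_space \<Rightarrow> real) set" where
  "log_concave_densities = {f. probability_density f \<and> log_concave f}"

definition hellinger_sq :: "('a::euclidean_space \<Rightarrow> real) \<Rightarrow> ('a \<Rightarrow> real) \<Rightarrow> real" where
  "hellinger_sq f g = 1/2 * (\<integral>x. (sqrt (f x) - sqrt (g x))\<^sup>2 \<partial>lborel)"

(* A sample X_1, ..., X_n is indexed by {..<n}. *)
definition avg_log_lik :: "nat \<Rightarrow> (nat \<Rightarrow> 'a) \<Rightarrow> ('a \<Rightarrow> real) \<Rightarrow> ereal" where
  "avg_log_lik n X f = ereal (1 / real n) * (\<Sum>i<n. ln_ext (f (X i)))"

definition is_log_concave_mle ::
    "nat \<Rightarrow> (nat \<Rightarrow> 'a::euclidean_space) \<Rightarrow> ('a \<Rightarrow> real) \<Rightarrow> bool" where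
  "is_log_concave_mle n X f \<longleftrightarrow>
     f \<in> log_concave_densities \<and>
     (\<forall>g\<in>log_concave_densities. avg_log_lik n X g \<le> avg_log_lik n X f)"

definition iid_sample :: "nat \<Rightarrow> ('a::euclidean_space \<Rightarrow> real) \<Rightarrow> (nat \<Rightarrow> 'a) measure" where
  "iid_sample n f = (\<Pi>\<^sub>M i\<in>{..<n}. density lborel (\<lambda>x. ennreal (f x)))"

(* The event E contains a measurable event of probability at least p; for measurable E
   this says that E has probability at least p. *)
definition prob_at_least :: "'a measure \<Rightarrow> real \<Rightarrow> ('a \<Rightarrow> bool) \<Rightarrow> bool" where
  "prob_at_least M p E \<longleftrightarrow> (\<exists>A\<in>sets M. p \<le> measure M A \<and> (\<forall>\<omega>\<in>A. E \<omega>))"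

end

theory Submission
  imports Defs
begin

text \<open>
  Convex sets are the only sets that matter: the superlevel sets of every log-concave density are
  convex.  After an affine normalisation of \<open>f0\<close> (a simplex of maximal volume in a superlevel set
  becomes the standard one) its mass outside a box of side \<open>O(log (1/\<delta>))\<close> is at most \<open>\<delta>\<close>.  Dudley's
  approximation of convex bodies, with the closest points rounded to a grid, gives a finite family of
  log-cardinality \<open>\<delta> powr (- (d - 1) / 2)\<close> up to logarithms such that every closed convex set lies
  in a member whose \<open>f0\<close>-probability is larger by at most \<open>\<delta>\<close>.  Hoeffding's inequality and a union bound
  then show that for \<open>n\<close> of order \<open>\<delta> powr (- (d + 3) / 2)\<close> no closed convex set has an empirical
  frequency exceeding its probability by more than \<open>2 * \<delta>\<close>.

  On this event the convex hull of the sample has an interior, so the likelihood is coercive on tent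
  functions and a maximiser exists.  The same event bounds the maximum of an estimator \<open>g\<close> by a constant
  multiple of that of \<open>f0\<close>, since otherwise \<open>g\<close> would be tiny at half of the sample.  Hence \<open>ln g\<close>,
  cut off below at \<open>ln a\<close> with \<open>a\<close> of order \<open>\<epsilon>^2\<close>, has logarithmic range, and summing over its
  superlevel sets compares its empirical mean with its expectation.  Together with Chebyshev's
  inequality for \<open>ln f0\<close> this makes the expectation of \<open>ln (f0 / max g a)\<close> of order \<open>\<epsilon>\<close>, which
  dominates the squared Hellinger distance.
\<close>

section \<open>Log-concave densities\<close>

text \<open>For \<open>d \<ge> 2\<close> convex sets have infinite VC dimension, so the cover has to
  be adapted to \<open>f0\<close>, while its size must not depend on \<open>f0\<close>. Affine
  invariance reconciles the two: the determinant of the normalising map is never computed, because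
  volumes are weighed against the maximum \<open>M\<close> of the density, as in
  \<open>M * measure lborel S\<close>. Logarithms of densities are unbounded below, but only
  one-sided control is wanted: the empirical mean of \<open>ln (max g a)\<close> has to be bounded
  above and that of \<open>ln f0\<close> below. Hence covering from above suffices, and
  \<open>f0\<close>, being a single function, is settled by its second moment. The exponent
  \<open>(d + 3) / 2\<close> is \<open>(d - 1) / 2 + 2\<close>. The 2 comes from
  \<open>n * \<delta>^2\<close> in the exponential bound. The rest is entropy: up to accuracy
  \<open>\<delta>\<close> a body is determined by its closest points to a net of mesh about
  \<open>sqrt \<delta>\<close> on a surface of dimension \<open>d - 1\<close>, since the error made
  by supporting half-spaces is quadratic in the mesh.\<close>

lemma usc_closed_superlevel:
  fixes \<phi> :: "'a::topological_space \<Rightarrow> ereal"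
  assumes "usc \<phi>"
  shows "closed {x. c \<le> \<phi> x}"
proof -
  have "open {x. \<phi> x < c}"
  proof (subst open_subopen, intro ballI)
    fix x assume "x \<in> {x. \<phi> x < c}"
    hence x: "\<phi> x < c" by simp
    have "Limsup (at x) \<phi> < c" using assms x le_less_trans unfolding usc_def by blast
    hence "\<forall>\<^sub>F y in at x. \<phi> y < c" by (rule Limsup_lessD)
    then obtain S where "open S" "x \<in> S" "\<forall>y\<in>S. y \<noteq> x \<longrightarrow> \<phi> y < c"
      unfolding eventually_at_topological by auto
    thus "\<exists>T. open T \<and> x \<in> T \<and> T \<subseteq> {x. \<phi> x < c}" using x by (intro exI[of _ S]) auto
  qed
  moreover have "{x. \<phi> x < c} = - {x. c \<le> \<phi> x}" by auto
  ultimately show ?thesis by (simp add: closed_def)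
qed

lemma usc_of_closed_superlevel:
  fixes \<phi> :: "'a::topological_space \<Rightarrow> ereal"
  assumes "\<And>c. closed {x. ereal c \<le> \<phi> x}"
  shows "usc \<phi>"
  unfolding usc_def
proof
  fix x
  show "Limsup (at x) \<phi> \<le> \<phi> x"
  proof (rule ccontr)
    assume "\<not> Limsup (at x) \<phi> \<le> \<phi> x"
    hence "\<phi> x < Limsup (at x) \<phi>" by simp
    then obtain c :: real where c: "\<phi> x < ereal c" "ereal c < Limsup (at x) \<phi>"
      using ereal_dense2 by blast
    have "open (- {x. ereal c \<le> \<phi> x})" using assms by (simp add: open_Compl)
    moreover have "x \<in> - {x. ereal c \<le> \<phi> x}" using c by auto
    ultimately have "\<forall>\<^sub>F y in at x. \<phi> y \<le> ereal c"
      unfolding eventually_at_topological by (intro exI[of _ "- {x. ereal c \<le> \<phi> x}"]) auto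
    hence "Limsup (at x) \<phi> \<le> ereal c" by (rule Limsup_bounded)
    thus False using c by simp
  qed
qed

lemma ln_le_iff: "0 < a \<Longrightarrow> ln a \<le> r \<longleftrightarrow> a \<le> exp r" for a r :: real
  by (metis exp_gt_zero exp_le_cancel_iff exp_ln)

lemma ln_le_two_sqrt: "1 \<le> u \<Longrightarrow> ln u \<le> 2 * sqrt u" for u :: real
  using ln_bound[of "sqrt u"] by (simp add: ln_sqrt)

lemma exp_ext_ge_iff:
  assumes "u \<noteq> \<infinity>" "0 < a"
  shows "a \<le> exp_ext u \<longleftrightarrow> ereal (ln a) \<le> u"
  using assms by (cases u) (auto simp: exp_ext_def ln_le_iff)

lemma log_concave_closed_superlevel:
  assumes "log_concave f" "0 < a"
  shows "closed {x. a \<le> f x}"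
proof -
  from assms obtain \<phi> where \<phi>: "\<forall>x. \<phi> x \<noteq> \<infinity>" "usc \<phi>" "\<forall>x. f x = exp_ext (\<phi> x)"
    unfolding log_concave_def by auto
  have "{x. a \<le> f x} = {x. ereal (ln a) \<le> \<phi> x}"
    using exp_ext_ge_iff \<phi> assms by auto
  thus ?thesis using usc_closed_superlevel[OF \<phi>(2)] by simp
qed

lemma log_concave_ln_ge:
  assumes "log_concave f" "0 < f x" "0 < f y" "0 \<le> t" "t \<le> 1"
  shows "0 < f ((1 - t) *\<^sub>R x + t *\<^sub>R y)" (is "?A")
    and "(1 - t) * ln (f x) + t * ln (f y) \<le> ln (f ((1 - t) *\<^sub>R x + t *\<^sub>R y))" (is ?B)
proof -
  from assms obtain \<phi> where \<phi>: "\<forall>x. \<phi> x \<noteq> \<infinity>" "concave_ereal \<phi>" "\<forall>x. f x = exp_ext (\<phi> x)"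
    unfolding log_concave_def by auto
  have x: "\<phi> z = ereal (ln (f z))" if "0 < f z" for z
    using that \<phi>(1,3) by (cases "\<phi> z") (auto simp: exp_ext_def)
  have "ereal (1 - t) * \<phi> x + ereal t * \<phi> y \<le> \<phi> ((1 - t) *\<^sub>R x + t *\<^sub>R y)"
    using \<phi>(2) assms unfolding concave_ereal_def by auto
  hence 1: "ereal ((1 - t) * ln (f x) + t * ln (f y)) \<le> \<phi> ((1 - t) *\<^sub>R x + t *\<^sub>R y)"
    using x assms by simp
  hence "\<phi> ((1 - t) *\<^sub>R x + t *\<^sub>R y) \<noteq> -\<infinity>" by auto
  thus ?A using \<phi>(3) by (auto simp: exp_ext_def)
  thus ?B using 1 x by simp
qed

lemma log_concaveI:
  fixes f :: "'a::euclidean_space \<Rightarrow> real"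
  assumes "\<And>x. 0 \<le> f x" and "\<And>a. 0 < a \<Longrightarrow> closed {x. a \<le> f x}"
    and "\<And>x y t. 0 < f x \<Longrightarrow> 0 < f y \<Longrightarrow> 0 < t \<Longrightarrow> t < 1 \<Longrightarrow>
           0 < f ((1 - t) *\<^sub>R x + t *\<^sub>R y) \<and>
           (1 - t) * ln (f x) + t * ln (f y) \<le> ln (f ((1 - t) *\<^sub>R x + t *\<^sub>R y))"
  shows "log_concave f"
proof -
  let ?p = "\<lambda>x. ln_ext (f x)"
  have "usc ?p"
  proof (rule usc_of_closed_superlevel)
    fix c
    have "{x. ereal c \<le> ?p x} = {x. exp c \<le> f x}"
    proof (intro Collect_cong)
      fix x show "ereal c \<le> ?p x \<longleftrightarrow> exp c \<le> f x"
      proof (cases "f x = 0")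
        case True thus ?thesis by (simp add: ln_ext_def not_le)
      next
        case False
        hence "0 < f x" using assms(1)[of x] by linarith
        thus ?thesis by (simp add: ln_ext_def ln_ge_iff)
      qed
    qed
    thus "closed {x. ereal c \<le> ?p x}" using assms(2)[of "exp c"] by simp
  qed
  moreover have "concave_ereal ?p"
    unfolding concave_ereal_def
  proof (intro allI ballI)
    fix x y and t :: real assume t: "t \<in> {0..1}"
    show "ereal (1 - t) * ?p x + ereal t * ?p y \<le> ?p ((1 - t) *\<^sub>R x + t *\<^sub>R y)"
    \<comment> \<open>At the endpoints a value \<open>-\<infinity>\<close> gets weight 0 and drops
      out, since \<open>0 * (-\<infinity>) = 0\<close>; in the open interval it makes the left side
      \<open>-\<infinity>\<close>.\<close>
    proof (cases "t = 0 \<or> t = 1")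
      case True thus ?thesis by (auto simp: zero_ereal_def[symmetric])
    next
      case False
      hence t: "0 < t" "t < 1" using t by auto
      show ?thesis
      proof (cases "0 < f x \<and> 0 < f y")
        case True
        with assms(3)[of x y t] t show ?thesis by (auto simp: ln_ext_def)
      next
        case F: False
        hence "f x = 0 \<or> f y = 0" using assms(1)[of x] assms(1)[of y] by linarith
        thus ?thesis using t by (auto simp: ln_ext_def)
      qed
    qed
  qed
  moreover have "\<forall>x. ?p x \<noteq> \<infinity>" by (auto simp: ln_ext_def)
  moreover have "\<forall>x. f x = exp_ext (?p x)"
    using assms(1) by (auto simp: ln_ext_def exp_ext_def less_le)
  ultimately show ?thesis unfolding log_concave_def by (intro exI[of _ ?p]) simp
qed

lemma log_concave_convex_superlevel:
  assumes "log_concave f" "0 < a"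
  shows "convex {x. a \<le> f x}"
proof (rule convexI)
  fix x y and u v :: real
  assume xy: "x \<in> {x. a \<le> f x}" "y \<in> {x. a \<le> f x}" and uv: "0 \<le> u" "0 \<le> v" "u + v = 1"
  have u: "u = 1 - v" using uv by simp
  have pos: "0 < f x" "0 < f y" using xy assms by auto
  have "ln a = u * ln a + v * ln a" using uv by (metis distrib_right mult_1)
  also have "\<dots> \<le> u * ln (f x) + v * ln (f y)"
    using xy uv assms by (intro add_mono mult_left_mono) auto
  also have "\<dots> \<le> ln (f (u *\<^sub>R x + v *\<^sub>R y))"
    using log_concave_ln_ge(2)[OF assms(1) pos, of v] uv u by simp
  finally show "u *\<^sub>R x + v *\<^sub>R y \<in> {x. a \<le> f x}"
    using log_concave_ln_ge(1)[OF assms(1) pos, of v] uv u assms by simp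
qed

lemma density_integrable:
  assumes "probability_density f"
  shows "integrable lborel f" "(\<integral>x. f x \<partial>lborel) = 1"
proof -
  have 1: "f \<in> borel_measurable lborel" "AE x in lborel. 0 \<le> f x" "(\<integral>\<^sup>+x. ennreal (f x) \<partial>lborel) = 1"
    using assms by (auto simp: probability_density_def)
  show "integrable lborel f" using 1 by (intro integrableI_nonneg) auto
  show "(\<integral>x. f x \<partial>lborel) = 1" using 1 by (subst integral_eq_nn_integral) auto
qed

lemma log_concave_densitiesD:
  assumes "f \<in> log_concave_densities"
  shows "probability_density f" "log_concave f" "\<And>x. 0 \<le> f x" "f \<in> borel_measurable borel"
    "integrable lborel f" "(\<integral>x. f x \<partial>lborel) = 1"
  using assms density_integrable by (auto simp: log_concave_densities_def probability_density_def)

section \<open>Superlevel sets of a density: volume, boundedness and maximum\<close>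

lemma convex_closed_empty_interior_null:
  fixes S :: "'a::euclidean_space set"
  assumes "convex S" "closed S" "interior S = {}"
  shows "emeasure lborel S = 0"
proof -
  have "negligible S" using negligible_convex_interior assms by blast
  hence "S \<in> null_sets lebesgue" by (simp add: negligible_iff_null_sets)
  moreover have "S \<in> sets lborel" using assms by auto
  ultimately show ?thesis by (auto simp: null_sets_completion_iff null_sets_def)
qed

text \<open>A far point \<open>y\<close> of \<open>S\<close> forces a large volume: the hull of
  \<open>y\<close> and an inscribed ball of radius \<open>r\<close> contains disjoint balls of
  radius \<open>r / 2\<close>, centred at spacing \<open>r\<close> on the first half of the axis.
  Their number grows with the distance of \<open>y\<close>.\<close>

lemma convex_finite_measure_bounded:
  fixes S :: "'a::euclidean_space set"
  assumes "convex S" "closed S" "interior S \<noteq> {}" "emeasure lborel S < \<infinity>"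
  shows "bounded S"
proof -
  obtain x0 r where r: "0 < r" "ball x0 r \<subseteq> S"
    using assms(3) by (meson all_not_in_conv mem_interior)
  define v where "v = measure lborel (ball x0 (r/2))"
  have v: "measure lborel (ball c (r/2)) = v" for c :: 'a
    unfolding v_def using r
    content_ball_conv_unit_ball[of "r/2" c] content_ball_conv_unit_ball[of "r/2" x0] by simp
  have v0: "0 < v" using r by (simp add: v_def content_ball_pos)
  have Sm: "S \<in> fmeasurable lborel" using assms by (auto simp: fmeasurable_def)
  have far: "norm (y - x0) \<le> 2 * (measure lborel S / v + 1) * r" if y: "y \<in> S" for y
  proof (rule ccontr)
    assume C: "\<not> ?thesis"
    define D where "D = norm (y - x0)"
    define K where "K = nat \<lfloor>measure lborel S / v\<rfloor> + 1"
    have K: "measure lborel S / v < real K" "real K \<le> measure lborel S / v + 1"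
      using v0 unfolding K_def by (auto simp: less_floor_iff) linarith+
    have D: "2 * real K * r < D"
    proof -
      have "2 * real K * r \<le> 2 * (measure lborel S / v + 1) * r" using K r by auto
      thus ?thesis using C D_def by linarith
    qed
    have "0 \<le> 2 * real K * r" using r by simp
    hence D0: "0 < D" using D by linarith
    define c where "c k = x0 + (real k * r / D) *\<^sub>R (y - x0)" for k :: nat
    have sub: "ball (c k) (r/2) \<subseteq> S" if k: "k < K" for k
    proof
      fix z assume z: "z \<in> ball (c k) (r/2)"
      define l where "l = real k * r / D"
      have "real k * r \<le> real K * r" using k r by simp
      hence "2 * (real k * r) \<le> D" using D by (simp add: mult.assoc)
      hence l: "0 \<le> l" "l \<le> 1/2" unfolding l_def using D0 r by (auto simp: field_simps)
      \<comment> \<open>Chosen so that \<open>z\<close> is the mixture of \<open>w\<close> and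
        \<open>y\<close> with weights \<open>1 - l\<close> and \<open>l\<close>; as
        \<open>l \<le> 1/2\<close>, the enlarged offset stays below \<open>r\<close>.\<close>
      define w where "w = x0 + (1 / (1 - l)) *\<^sub>R (z - c k)"
      have "dist x0 w = norm (z - c k) / (1 - l)" unfolding w_def dist_norm using l by simp
      also have "\<dots> \<le> norm (z - c k) / (1/2)" using l by (intro divide_left_mono) auto
      also have "\<dots> < r" using z by (simp add: dist_norm norm_minus_commute)
      finally have "w \<in> S" using r by auto
      have "(1 - l) *\<^sub>R w = (1 - l) *\<^sub>R x0 + (z - c k)"
        unfolding w_def scaleR_right_distrib using l by simp
      hence "z = (1 - l) *\<^sub>R w + l *\<^sub>R y"
        unfolding c_def l_def[symmetric] by (simp add: algebra_simps)
      thus "z \<in> S" using convexD_alt[OF assms(1) \<open>w \<in> S\<close> y, of l] l by simp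
    qed
    have disj: "disjoint_family_on (\<lambda>k. ball (c k) (r/2)) {..<K}"
      unfolding disjoint_family_on_def
    proof (intro ballI impI)
      fix j k :: nat assume jk: "j \<noteq> k"
      have "c j - c k = ((real j - real k) * r / D) *\<^sub>R (y - x0)"
        unfolding c_def by (simp add: algebra_simps diff_divide_distrib)
      hence "dist (c j) (c k) = \<bar>real j - real k\<bar> * r"
        unfolding dist_norm using r D0 by (simp add: abs_mult D_def)
      moreover have "1 \<le> \<bar>real j - real k\<bar>" using jk by linarith
      ultimately have "dist (c j) (c k) \<ge> r/2 + r/2" using r by simp
      thus "ball (c j) (r/2) \<inter> ball (c k) (r/2) = {}" by (intro disjoint_ballI) auto
    qed
    have "real K * v = (\<Sum>k<K. measure lborel (ball (c k) (r/2)))" by (simp add: v)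
    also have "\<dots> = measure lborel (\<Union>k<K. ball (c k) (r/2))"
      using disj by (intro measure_finite_Union[symmetric]) (auto simp: less_top emeasure_lborel_ball_finite[unfolded infinity_ennreal_def])
    also have "\<dots> \<le> measure lborel S" using sub Sm by (intro measure_mono_fmeasurable) auto
    finally show False using K v0 by (simp add: field_simps)
  qed
  show ?thesis
    unfolding bounded_iff
  proof (intro exI ballI)
    fix y assume "y \<in> S"
    thus "norm y \<le> norm x0 + 2 * (measure lborel S / v + 1) * r"
      using far[of y] norm_triangle_sub[of y x0] by linarith
  qed
qed

lemma density_superlevel_measure:
  assumes "f \<in> log_concave_densities" "0 < a"
  shows "measure lborel {x. a \<le> f x} \<le> 1 / a" "emeasure lborel {x. a \<le> f x} < \<infinity>"
proof -
  note f = log_concave_densitiesD[OF assms(1)]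
  show "measure lborel {x. a \<le> f x} \<le> 1 / a"
    using integral_Markov_inequality_measure[of lborel f UNIV a] f assms by simp
  have "emeasure lborel {x \<in> space lborel. a \<le> f x} \<le> ennreal ((1 / a) * (\<integral>x. f x \<partial>lborel))"
    using f assms by (intro integral_Markov_inequality) auto
  also have "\<dots> < \<infinity>" by simp
  finally show "emeasure lborel {x. a \<le> f x} < \<infinity>" by simp
qed

text \<open>If all levels had empty interior they would be null, and \<open>f\<close> would vanish
  almost everywhere, against its integral 1.\<close>

lemma density_superlevel_interior:
  assumes "f \<in> log_concave_densities"
  obtains b where "0 < b" "interior {x. b \<le> f x} \<noteq> {}"
proof (rule ccontr)
  note f = log_concave_densitiesD[OF assms] and witness = that
  assume "\<not> thesis"
  hence e: "interior {x. b \<le> f x} = {}" if b: "0 < b" for b using witness[OF b] \<open>\<not> thesis\<close> by blast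
  have "emeasure lborel {x. 1 / real (Suc k) \<le> f x} = 0" for k
    using e f by (intro convex_closed_empty_interior_null log_concave_convex_superlevel
        log_concave_closed_superlevel) auto
  hence "(\<Union>k. {x. 1 / real (Suc k) \<le> f x}) \<in> null_sets lborel"
    using f by (intro null_sets_UN) (auto simp: null_sets_def)
  moreover have "{x. f x \<noteq> 0} \<subseteq> (\<Union>k. {x. 1 / real (Suc k) \<le> f x})"
  proof
    fix x assume "x \<in> {x. f x \<noteq> 0}"
    hence "0 < f x" using f(3)[of x] by simp
    then obtain k where "1 / real (Suc k) < f x" using nat_approx_posE by auto
    thus "x \<in> (\<Union>k. {x. 1 / real (Suc k) \<le> f x})" by (auto intro: less_imp_le)
  qed
  ultimately have "AE x in lborel. f x = 0" by (intro AE_I') auto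
  hence "(\<integral>x. f x \<partial>lborel) = (\<integral>x. 0 \<partial>(lborel::'a measure))" using f by (intro integral_cong_AE) auto
  thus False using f by simp
qed

text \<open>Finite volume bounds a convex set that has an interior, and a high level need not have
  one; so the level is lowered to \<open>min a b\<close>.\<close>

lemma density_superlevel_bounded:
  assumes "f \<in> log_concave_densities" "0 < a"
  shows "bounded {x. a \<le> f x}"
proof -
  note f = log_concave_densitiesD[OF assms(1)]
  obtain b where b: "0 < b" "interior {x. b \<le> f x} \<noteq> {}" 
    using density_superlevel_interior[OF assms(1)] .
  have "{x. b \<le> f x} \<subseteq> {x. min a b \<le> f x}" by auto
  hence "interior {x. min a b \<le> f x} \<noteq> {}" using b interior_mono by blast
  hence "bounded {x. min a b \<le> f x}"
    using f b assms density_superlevel_measure[OF assms(1), of "min a b"]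
    by (intro convex_finite_measure_bounded log_concave_convex_superlevel log_concave_closed_superlevel) auto
  thus ?thesis by (rule bounded_subset) auto
qed

lemma density_superlevel_compact:
  assumes "f \<in> log_concave_densities" "0 < a"
  shows "compact {x. a \<le> f x}"
  using density_superlevel_bounded[OF assms] log_concave_closed_superlevel[OF log_concave_densitiesD(2)[OF assms(1)] assms(2)]
  by (simp add: compact_eq_bounded_closed)

text \<open>Compactness of a superlevel set: without a maximiser the open sets
  \<open>{x. f x < f z}\<close> would cover it, yet the point \<open>z\<close> with the largest
  value in a finite subcover is not covered.\<close>

lemma density_attains_max:
  assumes "f \<in> log_concave_densities"
  obtains x0 where "0 < f x0" "\<And>x. f x \<le> f x0"
proof -
  note f = log_concave_densitiesD[OF assms(1)]
  obtain b where b: "0 < b" "interior {x. b \<le> f x} \<noteq> {}" 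
    using density_superlevel_interior[OF assms(1)] .
  let ?L = "{x. b \<le> f x}"
  have ne: "?L \<noteq> {}" using b interior_subset by fastforce
  have "\<exists>x0\<in>?L. \<forall>x. f x \<le> f x0"
  proof (rule ccontr)
    assume "\<not> ?thesis"
    hence no: "\<exists>z. f x < f z" if "b \<le> f x" for x using that by (force simp: not_le)
    let ?C = "(\<lambda>z. {x. f x < f z}) ` ?L"
    have "open c" if c: "c \<in> ?C" for c
    proof -
      from c obtain z where z: "b \<le> f z" "c = {x. f x < f z}" by auto
      have "closed {x. f z \<le> f x}" using z b f by (intro log_concave_closed_superlevel) auto
      moreover have "c = - {x. f z \<le> f x}" using z by auto
      ultimately show ?thesis by (simp add: open_Compl)
    qed
    moreover have "?L \<subseteq> \<Union>?C" using no by clarsimp (meson order_trans less_imp_le)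
    ultimately obtain T where T: "T \<subseteq> ?C" "finite T" "?L \<subseteq> \<Union>T"
      using density_superlevel_compact[OF assms b(1)] by (meson compactE)
    obtain Z where Z: "Z \<subseteq> ?L" "finite Z" "T = (\<lambda>z. {x. f x < f z}) ` Z"
      using finite_subset_image[OF T(2,1)] by blast
    have Zne: "Z \<noteq> {}" using ne T Z by auto
    hence "Max (f ` Z) \<in> f ` Z" using Z by (intro Max_in) auto
    then obtain m where m: "m \<in> Z" "f m = Max (f ` Z)" by auto
    have "m \<in> ?L" using m Z by auto
    hence "m \<in> \<Union>T" using T(3) by blast
    then obtain z where z: "z \<in> Z" "f m < f z" using Z by auto
    moreover have "f z \<le> f m" using m z Z by simp
    ultimately show False by simp
  qed
  then obtain z where "b \<le> f z" "\<And>x. f x \<le> f z" by auto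
  thus ?thesis using that[of z] b by auto
qed

text \<open>Going the fraction \<open>1/s\<close> of the way from \<open>x0\<close> to
  \<open>x\<close> costs at most the fraction \<open>1/s\<close> of the drop \<open>s\<close> of
  \<open>ln f\<close>. So the level at depth \<open>s\<close> lies in the \<open>s\<close>-fold
  dilate about \<open>x0\<close> of the level at depth 1, which controls its volume.\<close>

lemma superlevel_contraction:
  assumes "log_concave f" "0 < f x0" "1 \<le> s" "f x0 * exp (- s) \<le> f x"
  shows "f x0 * exp (- 1) \<le> f ((1 - 1/s) *\<^sub>R x0 + (1/s) *\<^sub>R x)"
proof -
  define y where "y = (1 - 1/s) *\<^sub>R x0 + (1/s) *\<^sub>R x"
  have pos: "0 < f x0 * exp (- s)" using assms(2) by simp
  hence fx: "0 < f x" using assms(4) by linarith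
  have s: "0 \<le> 1/s" "1/s \<le> 1" using assms by auto
  note lc = log_concave_ln_ge[OF assms(1,2) fx s, folded y_def]
  have "ln (f x0 * exp (- s)) \<le> ln (f x)" using assms(4) pos fx by (subst ln_le_cancel_iff) auto
  hence "ln (f x0) - s \<le> ln (f x)" using assms(2) by (simp add: ln_mult)
  hence "(1/s) * (ln (f x0) - s) \<le> (1/s) * ln (f x)" using s(1) by (rule mult_left_mono)
  hence "ln (f x0) - 1 \<le> ln (f y)" using lc(2) assms(3) by (simp add: algebra_simps)
  hence "exp (ln (f x0) - 1) \<le> f y" using lc(1) by (simp add: ln_ge_iff)
  thus ?thesis using assms(2) by (simp add: y_def exp_diff exp_minus field_simps)
qed

lemma superlevel_measure_scaling:
  fixes f :: "'a::euclidean_space \<Rightarrow> real"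
  assumes "f \<in> log_concave_densities" "0 < f x0" "\<And>x. f x \<le> f x0" "1 \<le> s"
  shows "measure lborel {x. f x0 * exp (- s) \<le> f x} \<le> s ^ DIM('a) * measure lborel {x. f x0 * exp (- 1) \<le> f x}"
proof -
  note f = log_concave_densitiesD[OF assms(1)]
  let ?T = "\<lambda>x. (x0 - s *\<^sub>R x0) + s *\<^sub>R x"
  let ?L = "{x. f x0 * exp (- 1) \<le> f x}"
  have pos: "0 < f x0 * exp (- s)" for s using assms by simp
  have comp: "compact {x. f x0 * exp (- s) \<le> f x}" for s
    using density_superlevel_compact[OF assms(1) pos] .
  have sub: "{x. f x0 * exp (- s) \<le> f x} \<subseteq> ?T ` ?L"
  proof
    fix x assume x: "x \<in> {x. f x0 * exp (- s) \<le> f x}"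
    define y where "y = (1 - 1/s) *\<^sub>R x0 + (1/s) *\<^sub>R x"
    have "y \<in> ?L" using superlevel_contraction[of f x0 s x] x assms f(2) by (simp add: y_def)
    moreover have "x = (x0 - s *\<^sub>R x0) + s *\<^sub>R y" unfolding y_def using assms by (simp add: algebra_simps)
    ultimately show "x \<in> ?T ` ?L" by blast
  qed
  have "compact (?T ` ?L)"
    using comp[of 1] by (intro compact_continuous_image continuous_intros) auto
  hence c2: "?T ` ?L \<in> sets borel" 
     "?T ` ?L \<in> fmeasurable lborel"
    by (auto simp: compact_imp_closed fmeasurable_compact)
  have "measure lborel {x. f x0 * exp (- s) \<le> f x} \<le> measure lborel (?T ` ?L)"
    using sub c2 compact_imp_closed[OF comp] by (intro measure_mono_fmeasurable) auto
  also have "\<dots> = measure lebesgue (?T ` ?L)" using c2 by simp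
  also have "\<dots> = measure lebesgue ((\<lambda>x. s *\<^sub>R x + (x0 - s *\<^sub>R x0)) ` ?L)" by (simp add: add.commute)
  also have "\<dots> = s ^ DIM('a) * measure lebesgue ?L"
    using measure_lebesgue_affine[of s "x0 - s *\<^sub>R x0" ?L] assms by (simp add: add.commute)
  also have "measure lebesgue ?L = measure lborel ?L" using compact_imp_closed[OF comp[of 1]] by simp
  finally show ?thesis .
qed

text \<open>Markov's inequality bounds the volume at depth 1 by \<open>exp 1 / f x0\<close>.
  Polynomial growth in \<open>s\<close>, set against the exponential decay of \<open>f\<close>, is
  behind the tail and moment bounds.\<close>

lemma superlevel_measure_growth:
  fixes f :: "'a::euclidean_space \<Rightarrow> real"
  assumes "f \<in> log_concave_densities" "0 < f x0" "\<And>x. f x \<le> f x0" "1 \<le> s"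
  shows "measure lborel {x. f x0 * exp (- s) \<le> f x} \<le> s ^ DIM('a) * exp 1 / f x0"
proof -
  have "measure lborel {x. f x0 * exp (- 1) \<le> f x} \<le> 1 / (f x0 * exp (-1))"
    using assms(2) by (intro density_superlevel_measure(1)[OF assms(1)]) simp
  also have "\<dots> = exp 1 / f x0" by (simp add: exp_minus field_simps)
  finally have "s ^ DIM('a) * measure lborel {x. f x0 * exp (- 1) \<le> f x} \<le> s ^ DIM('a) * (exp 1 / f x0)"
    using assms(4) by (intro mult_left_mono) auto
  thus ?thesis using superlevel_measure_scaling[OF assms] by simp
qed

text \<open>Arises from a sum over unit layers of \<open>ln f\<close>: \<open>fact d * 4 ^ d\<close>
  absorbs the volume factor \<open>s ^ d\<close> into \<open>exp (s / 4)\<close>, and the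
  denominator belongs to the geometric series of ratio \<open>exp (- 1/4)\<close>.\<close>

definition sqrt_bound :: "nat \<Rightarrow> real" where
  "sqrt_bound d = exp 2 * fact d * 4 ^ d / (1 - exp (- (1/4)))"

lemma sqrt_bound_ge_1: "1 \<le> sqrt_bound d"
proof -
  have "(1::real) * 1 * 1 \<le> exp 2 * fact d * 4 ^ d" by (intro mult_mono) (auto simp: fact_ge_1)
  moreover have "1 - exp (- (1/4::real)) \<le> 1" "0 < 1 - exp (- (1/4::real))" by auto
  ultimately have "1 - exp (- (1/4::real)) \<le> exp 2 * fact d * 4 ^ d" by linarith
  thus ?thesis unfolding sqrt_bound_def by (subst pos_le_divide_eq) auto
qed

lemma power_le_fact_exp: "0 \<le> x \<Longrightarrow> x ^ n \<le> fact n * exp (x::real)"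
proof -
  assume x: "0 \<le> x"
  have "x ^ n /\<^sub>R fact n = (\<Sum>k\<in>{n}. x ^ k /\<^sub>R fact k)" by simp
  also have "\<dots> \<le> (\<Sum>k. x ^ k /\<^sub>R fact k)"
    using x summable_exp_generic[of x] by (intro sum_le_suminf) auto
  also have "\<dots> = exp x" by (simp add: exp_def)
  finally show ?thesis by (simp add: field_simps)
qed

text \<open>The product of \<open>sqrt (f x0)\<close> and the integral is unchanged by affine
  changes of variable, so a bound by the dimension alone is possible. It serves three times: for the
  tail of \<open>f\<close>, for the moments of \<open>ln f\<close>, and for the cost of truncating
  the estimator.\<close>

lemma sqrt_density_integral:
  fixes f :: "'a::euclidean_space \<Rightarrow> real"
  assumes "f \<in> log_concave_densities" "0 < f x0" "\<And>x. f x \<le> f x0"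
  shows "integrable lborel (\<lambda>x. sqrt (f x))"
    and "sqrt (f x0) * (\<integral>x. sqrt (f x) \<partial>lborel) \<le> sqrt_bound DIM('a)"
proof -
  note f = log_concave_densitiesD[OF assms(1)]
  note [measurable] = f(4)
  define M d where "M = f x0" and "d = DIM('a)"
  have M: "0 < M" using assms M_def by simp
  let ?L = "\<lambda>k::nat. {x. M * exp (- real (Suc k)) \<le> f x}"
  define q where "q = exp (- (1/4) :: real)"
  have q: "0 < q" "q < 1" by (auto simp: q_def)
  define c where "c = exp 2 * fact d * 4 ^ d / sqrt M"
  have c: "0 \<le> c" using M by (simp add: c_def)
  have "(\<integral>\<^sup>+x. ennreal (sqrt (f x)) \<partial>lborel) \<le> (\<integral>\<^sup>+x. (\<Sum>k. ennreal (sqrt M * exp (- real k / 2)) * indicator (?L k) x) \<partial>lborel)"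
  proof (rule nn_integral_mono)
    fix x
    show "ennreal (sqrt (f x)) \<le> (\<Sum>k. ennreal (sqrt M * exp (- real k / 2)) * indicator (?L k) x)"
    proof (cases "f x = 0")
      case False
      hence fx: "0 < f x" using f(3)[of x] by simp
      have fM: "f x \<le> M" using assms M_def by simp
      \<comment> \<open>\<open>k\<close> numbers the layer of \<open>x\<close>: its term alone
        dominates \<open>sqrt (f x)\<close>, and the other terms are nonnegative.\<close>
      define k where "k = nat \<lfloor>ln (M / f x)\<rfloor>"
      have l0: "0 \<le> ln (M / f x)" using fx fM by simp
      have k: "real k \<le> ln (M / f x)" "ln (M / f x) \<le> real (Suc k)" unfolding k_def using l0 by linarith+
      have "exp (real k) \<le> M / f x" using k(1) fx M by (simp add: ln_ge_iff[symmetric])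
      hence "f x \<le> M * exp (- real k)" using fx by (simp add: exp_minus field_simps)
      hence "sqrt (f x) \<le> sqrt (M * exp (- real k))" by simp
      also have "\<dots> = sqrt M * exp (- real k / 2)"
      proof -
        have "exp (- real k) = (exp (- real k / 2))\<^sup>2" by (simp flip: exp_double)
        thus ?thesis by (simp add: real_sqrt_mult)
      qed
      finally have 1: "sqrt (f x) \<le> sqrt M * exp (- real k / 2)" .
      have "M / f x \<le> exp (real (Suc k))" using k(2) fx M ln_le_iff[of "M / f x"] by simp
      hence "M * exp (- real (Suc k)) \<le> f x" using fx by (simp add: exp_minus field_simps del: of_nat_Suc)
      hence x: "x \<in> ?L k" by simp
      have "ennreal (sqrt (f x)) \<le> (\<Sum>j\<in>{k}. ennreal (sqrt M * exp (- real j / 2)) * indicator (?L j) x)"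
        using 1 x by (simp add: ennreal_leI)
      also have "\<dots> \<le> (\<Sum>k. ennreal (sqrt M * exp (- real k / 2)) * indicator (?L k) x)"
        by (rule sum_le_suminf) auto
      finally show ?thesis .
    qed simp
  qed
  also have "\<dots> = (\<Sum>k. \<integral>\<^sup>+x. ennreal (sqrt M * exp (- real k / 2)) * indicator (?L k) x \<partial>lborel)"
    by (rule nn_integral_suminf) measurable
  also have "\<dots> = (\<Sum>k. ennreal (sqrt M * exp (- real k / 2)) * emeasure lborel (?L k))"
    by (subst nn_integral_cmult_indicator) auto
  also have "\<dots> \<le> (\<Sum>k. ennreal (c * q ^ k))"
  proof (rule suminf_le)
    fix k
    have "real (Suc k) ^ d = 4 ^ d * (real (Suc k) / 4) ^ d" by (simp add: power_divide)
    also have "\<dots> \<le> 4 ^ d * (fact d * exp (real (Suc k) / 4))"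
      by (intro mult_left_mono power_le_fact_exp) auto
    finally have 1: "real (Suc k) ^ d \<le> 4 ^ d * (fact d * exp (real (Suc k) / 4))" .
    have "measure lborel (?L k) \<le> real (Suc k) ^ d * exp 1 / M"
      using superlevel_measure_growth[OF assms, of "real (Suc k)"] by (simp add: M_def d_def)
    also have "\<dots> \<le> 4 ^ d * (fact d * exp (real (Suc k) / 4)) * exp 1 / M"
      using 1 M by (intro divide_right_mono mult_right_mono) auto
    finally have 2: "measure lborel (?L k) \<le> 4 ^ d * (fact d * exp (real (Suc k) / 4)) * exp 1 / M" .
    have "sqrt M * exp (- real k / 2) * measure lborel (?L k)
       \<le> sqrt M * exp (- real k / 2) * (4 ^ d * (fact d * exp (real (Suc k) / 4)) * exp 1 / M)"
      using M 2 by (intro mult_left_mono) auto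
    also have "\<dots> = (sqrt M / M) * (4 ^ d * fact d) * (exp (- real k / 2) * exp (real (Suc k) / 4) * exp 1)"
      by simp
    also have "sqrt M / M = 1 / sqrt M" using M by (simp add: field_simps)
    \<comment> \<open>The exponent is \<open>- k/2 + (k + 1)/4 + 1 = 5/4 - k/4\<close>; the 5/4 is
      then rounded up to 2.\<close>
    also have "exp (- real k / 2) * exp (real (Suc k) / 4) * exp 1 = exp (5/4) * q ^ k"
      unfolding q_def by (simp flip: exp_add exp_of_nat_mult add: field_simps)
    also have "(1 / sqrt M) * (4 ^ d * fact d) * (exp (5/4) * q ^ k) \<le> (1 / sqrt M) * (4 ^ d * fact d) * (exp 2 * q ^ k)"
      using q M by (intro mult_left_mono mult_right_mono) auto
    also have "\<dots> = c * q ^ k" by (simp add: c_def)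
    finally have 3: "sqrt M * exp (- real k / 2) * measure lborel (?L k) \<le> c * q ^ k" .
    have "emeasure lborel (?L k) = ennreal (measure lborel (?L k))"
      using density_superlevel_measure(2)[OF assms(1), of "M * exp (- real (Suc k))"] M
      by (intro emeasure_eq_ennreal_measure) (auto simp: less_top)
    thus "ennreal (sqrt M * exp (- real k / 2)) * emeasure lborel (?L k) \<le> ennreal (c * q ^ k)"
      using 3 M by (simp add: ennreal_mult[symmetric] ennreal_leI)
  qed auto
  also have "\<dots> = ennreal (c * (1 / (1 - q)))"
  proof -
    have "(\<lambda>k. q ^ k) sums (1 / (1 - q))" using q by (intro geometric_sums) simp
    hence "(\<lambda>k. c * q ^ k) sums (c * (1 / (1 - q)))" by (rule sums_mult)
    thus ?thesis using c q by (intro suminf_ennreal_eq) auto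
  qed
  finally have bd: "(\<integral>\<^sup>+x. ennreal (sqrt (f x)) \<partial>lborel) \<le> ennreal (c * (1 / (1 - q)))" .
  show int: "integrable lborel (\<lambda>x. sqrt (f x))"
    using f bd by (intro integrableI_nonneg) (auto intro: le_less_trans)
  have "ennreal (\<integral>x. sqrt (f x) \<partial>lborel) \<le> ennreal (c * (1 / (1 - q)))"
    using bd int f by (subst nn_integral_eq_integral[symmetric]) auto
  hence "(\<integral>x. sqrt (f x) \<partial>lborel) \<le> c * (1 / (1 - q))" using c q by (simp add: ennreal_le_iff)
  hence "sqrt M * (\<integral>x. sqrt (f x) \<partial>lborel) \<le> sqrt M * (c * (1 / (1 - q)))"
    using M by (intro mult_left_mono) auto
  also have "\<dots> = sqrt_bound d" using M by (simp add: sqrt_bound_def c_def q_def)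
  finally show "sqrt (f x0) * (\<integral>x. sqrt (f x) \<partial>lborel) \<le> sqrt_bound DIM('a)" by (simp add: M_def d_def)
qed

section \<open>A net for convex bodies\<close>

lemma norm_le_card_infnorm:
  fixes x :: "real^'d"
  shows "norm x \<le> real CARD('d) * infnorm x"
proof -
  have "norm x \<le> sqrt (real CARD('d)) * infnorm x" using norm_le_infnorm[of x] by simp
  also have "\<dots> \<le> real CARD('d) * infnorm x"
    by (intro mult_right_mono infnorm_pos_le real_le_lsqrt) (auto simp: power2_eq_square)
  finally show ?thesis .
qed

lemma norm_le_card_component:
  fixes x :: "real^'d"
  assumes "\<And>i. \<bar>x $ i\<bar> \<le> h"
  shows "norm x \<le> real CARD('d) * h"
proof -
  have "norm x \<le> (\<Sum>i\<in>UNIV. \<bar>x $ i\<bar>)" by (rule norm_le_l1_cart)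
  also have "\<dots> \<le> real CARD('d) * h" using sum_bounded_above[of UNIV "\<lambda>i. \<bar>x $ i\<bar>" h] assms by simp
  finally show ?thesis .
qed

lemma infnorm_le_cart: "infnorm (x::real^'d) \<le> r \<longleftrightarrow> (\<forall>i. \<bar>x $ i\<bar> \<le> r)"
proof
  assume "infnorm x \<le> r" thus "\<forall>i. \<bar>x $ i\<bar> \<le> r" using component_le_infnorm_cart order_trans by blast
next
  assume "\<forall>i. \<bar>x $ i\<bar> \<le> r"
  thus "infnorm x \<le> r" unfolding infnorm_cart by (intro cSup_least) auto
qed

lemma infnorm_attained: "\<exists>i. \<bar>(x::real^'d) $ i\<bar> = infnorm x"
proof -
  have "{\<bar>x $ i\<bar> |i. i \<in> UNIV} = range (\<lambda>i. \<bar>x $ i\<bar>)" by auto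
  hence "infnorm x = Max (range (\<lambda>i. \<bar>x $ i\<bar>))" unfolding infnorm_cart by (simp add: cSup_eq_Max)
  moreover have "Max (range (\<lambda>i. \<bar>x $ i\<bar>)) \<in> range (\<lambda>i. \<bar>x $ i\<bar>)" by (intro Max_in) auto
  ultimately show ?thesis by (metis rangeE)
qed

section \<open>Dudley's comparison of two convex bodies\<close>

lemma ray_hits_infnorm_sphere:
  fixes y u :: "'a::euclidean_space"
  assumes "infnorm y \<le> R" "u \<noteq> 0" "0 < R"
  obtains s where "0 \<le> s" "infnorm (y + s *\<^sub>R u) = 2 * R"
proof -
  have u: "0 < infnorm u" using assms by (simp add: infnorm_pos_lt)
  let ?b = "3 * R / infnorm u"
  have "infnorm (?b *\<^sub>R u) = 3 * R" using u assms by (simp add: infnorm_mul)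
  moreover have "infnorm (?b *\<^sub>R u) \<le> infnorm (y + ?b *\<^sub>R u) + infnorm y"
    using infnorm_triangle[of "y + ?b *\<^sub>R u" "- y"] by (simp add: infnorm_neg)
  ultimately have "2 * R \<le> infnorm (y + ?b *\<^sub>R u)" using assms by linarith
  moreover have "infnorm (y + 0 *\<^sub>R u) \<le> 2 * R" using assms by simp
  moreover have "continuous_on {0..?b} (\<lambda>s. infnorm (y + s *\<^sub>R u))" by (intro continuous_intros)
  moreover have "0 \<le> ?b" using u assms by simp
  ultimately show ?thesis using IVT'[of "\<lambda>s. infnorm (y + s *\<^sub>R u)" 0 "2 * R" ?b] that by blast
qed

text \<open>Dudley's argument: the supporting half-spaces of \<open>C\<close> at the closest points to a net \<open>N\<close> of a
  large sphere cut out a set within quadratically small distance of \<open>C\<close>; these half-spaces barely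
  change if \<open>C\<close> is replaced by a set \<open>C'\<close> with nearby closest points.\<close>

lemma closest_points_determine_convex:
  fixes C C' N :: "(real^'d) set"
  assumes C: "closed C" "convex C" "C \<noteq> {}" "\<And>x. x \<in> C \<Longrightarrow> infnorm x \<le> R"
    and C': "closed C'" "convex C'" "C' \<noteq> {}" "\<And>x. x \<in> C' \<Longrightarrow> infnorm x \<le> R"
    and N: "\<And>q. infnorm q = 2 * R \<Longrightarrow> \<exists>p\<in>N. dist p q \<le> \<eta>" "\<And>p. p \<in> N \<Longrightarrow> infnorm p \<le> 3 * R"
    and near: "\<And>p. p \<in> N \<Longrightarrow> dist (closest_point C p) (closest_point C' p) \<le> \<rho>"
    and R: "0 < R" "0 \<le> \<rho>" "\<rho> \<le> R" "0 \<le> \<eta>" "4 * \<eta> \<le> R"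
    and x: "x \<in> C'"
  shows "dist x (closest_point C x) \<le> 2 * (\<eta>\<^sup>2 + 7 * real CARD('d) * R * \<rho>) / R"
proof -
  define y where "y = closest_point C x"
  define T where "T = norm (x - y)"
  define d where "d = real CARD('d)"
  have d: "1 \<le> d" unfolding d_def by (simp add: Suc_leI)
  have yC: "y \<in> C" unfolding y_def using C by (intro closest_point_in_set)
  show ?thesis
  proof (cases "x = y")
    case True thus ?thesis using R d unfolding y_def[symmetric] d_def by simp
  next
    case False
    hence T: "0 < T" by (simp add: T_def)
    define u where "u = (1 / T) *\<^sub>R (x - y)"
    have u: "norm u = 1" "u \<noteq> 0" "x = y + T *\<^sub>R u" using T by (auto simp: u_def T_def)
    \<comment> \<open>Continuing from \<open>y\<close> through \<open>x\<close> to the large sphere,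
      \<open>y\<close> remains the closest point of \<open>C\<close> to the exit point
      \<open>q\<close>.\<close>
    obtain s where s: "0 \<le> s" "infnorm (y + s *\<^sub>R u) = 2 * R"
      using ray_hits_infnorm_sphere[OF C(4)[OF yC] u(2) R(1)] .
    define q where "q = y + s *\<^sub>R u"
    obtain p where p: "p \<in> N" "dist p q \<le> \<eta>" using N(1)[of q] s q_def by auto
    define z z' where "z = closest_point C p" and "z' = closest_point C' p"
    have zC: "z \<in> C" "z' \<in> C'" unfolding z_def z'_def using C C' by (auto intro: closest_point_in_set)
    have 1: "(p - z') \<bullet> (x - z') \<le> 0" unfolding z'_def using C' x by (intro closest_point_dot)
    have "(x - y) \<bullet> (z - y) \<le> 0" unfolding y_def using C zC by (intro closest_point_dot)
    hence "(T *\<^sub>R u) \<bullet> (z - y) \<le> 0" using u(3) by simp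
    hence "u \<bullet> (z - y) \<le> 0" using T by (simp add: mult_le_0_iff)
    hence 2: "(q - y) \<bullet> (z - y) \<le> 0" unfolding q_def using s by (simp add: mult_nonneg_nonpos)
    have 3: "(p - z) \<bullet> (y - z) \<le> 0" unfolding z_def using C yC by (intro closest_point_dot)
    \<comment> \<open>Closest-point maps are 1-Lipschitz; here for \<open>p\<close> and
      \<open>q\<close>, whose closest points are \<open>z\<close> and \<open>y\<close>.\<close>
    have nz: "(norm (z - y))\<^sup>2 \<le> (p - q) \<bullet> (z - y)"
      using 2 3 unfolding power2_norm_eq_inner by (simp add: inner_simps inner_commute)
    also have "\<dots> \<le> norm (p - q) * norm (z - y)" by (rule norm_cauchy_schwarz)
    finally have "norm (z - y) \<le> norm (p - q)"
      by (cases "z = y") (auto simp: power2_eq_square)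
    hence zy: "norm (z - y) \<le> \<eta>" using p by (simp add: dist_norm)
    \<comment> \<open>\<open>x\<close> lies in the supporting half-space of \<open>C'\<close> at
      \<open>z'\<close>. Moving this half-space to \<open>z\<close> costs \<open>\<rho>\<close>
      times at most \<open>2 * d * R + 4 * d * R + R\<close>, which is at most
      \<open>7 * d * R\<close>.\<close>
    have 4: "(p - z) \<bullet> (x - z) \<le> 7 * d * R * \<rho>"
    proof -
      define e where "e = z' - z"
      have e: "norm e \<le> \<rho>" unfolding e_def using near[OF p(1)]
        by (simp add: z_def z'_def dist_norm norm_minus_commute)
      have "infnorm (x - z') \<le> 2 * R"
        using infnorm_triangle[of x "- z'"] C'(4)[OF x] C'(4)[OF zC(2)] by (simp add: infnorm_neg)
      hence "d * infnorm (x - z') \<le> d * (2 * R)" using d by (intro mult_left_mono) auto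
      hence n1: "norm (x - z') \<le> 2 * d * R" using norm_le_card_infnorm[of "x - z'"]
        unfolding d_def[symmetric] by (simp add: mult.left_commute mult.assoc)
      have "infnorm (p - z') \<le> 4 * R"
        using infnorm_triangle[of p "- z'"] N(2)[OF p(1)] C'(4)[OF zC(2)] by (simp add: infnorm_neg)
      hence "d * infnorm (p - z') \<le> d * (4 * R)" using d by (intro mult_left_mono) auto
      hence n2: "norm (p - z') \<le> 4 * d * R" using norm_le_card_infnorm[of "p - z'"]
        unfolding d_def[symmetric] by (simp add: mult.left_commute mult.assoc)
      have dR: "R \<le> d * R" using d R by simp
      have "(p - z) \<bullet> (x - z) = (p - z') \<bullet> (x - z') + e \<bullet> ((x - z') + (p - z') + e)"
        unfolding e_def by (simp add: inner_simps inner_commute)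
      also have "\<dots> \<le> e \<bullet> ((x - z') + (p - z') + e)" using 1 by simp
      also have "\<dots> \<le> norm e * norm ((x - z') + (p - z') + e)" by (rule norm_cauchy_schwarz)
      also have "\<dots> \<le> \<rho> * (7 * d * R)"
      proof (intro mult_mono e)
        have "norm ((x - z') + (p - z') + e) \<le> norm (x - z') + norm (p - z') + norm e"
          by (intro norm_triangle_le add_mono norm_triangle_ineq order_refl)
        thus "norm ((x - z') + (p - z') + e) \<le> 7 * d * R" using n1 n2 e dR R by linarith
      qed (use R in auto)
      finally show ?thesis by (simp add: mult.commute)
    qed
    have "(p - z) \<bullet> (x - z) = (p - z) \<bullet> (y - z) + T * ((p - z) \<bullet> u)"
      unfolding u(3) by (simp add: inner_simps algebra_simps)
    hence 5: "T * ((p - z) \<bullet> u) \<le> 7 * d * R * \<rho> + (p - z) \<bullet> (z - y)"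
      using 4 by (simp add: inner_simps)
    \<comment> \<open>The gain of the argument: \<open>p - q\<close> and \<open>z - y\<close> are
      both of size at most \<open>\<eta>\<close>, so the error is quadratic in the mesh.\<close>
    have "(p - z) \<bullet> (z - y) = (p - q) \<bullet> (z - y) + (q - y) \<bullet> (z - y) - (norm (z - y))\<^sup>2"
      unfolding power2_norm_eq_inner by (simp add: inner_simps inner_commute)
    also have "\<dots> \<le> (p - q) \<bullet> (z - y)" using 2 zero_le_power2[of "norm (z - y)"] by linarith
    also have "\<dots> \<le> norm (p - q) * norm (z - y)" by (rule norm_cauchy_schwarz)
    also have "\<dots> \<le> \<eta> * \<eta>" using p zy R by (intro mult_mono) (auto simp: dist_norm)
    finally have 6: "T * ((p - z) \<bullet> u) \<le> 7 * d * R * \<rho> + \<eta>\<^sup>2" using 5 by (simp add: power2_eq_square)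
    have "infnorm q \<le> infnorm (q - y) + infnorm y" using infnorm_triangle[of "q - y" y] by simp
    hence "R \<le> infnorm (q - y)" using s(2) C(4)[OF yC] q_def by simp
    also have "\<dots> \<le> norm (q - y)" by (rule infnorm_le_norm)
    also have "\<dots> = s" unfolding q_def using s u by simp
    finally have sR: "R \<le> s" .
    have "(p - z) \<bullet> u = (q - y) \<bullet> u + ((p - q) - (z - y)) \<bullet> u" by (simp add: inner_simps)
    moreover have "(q - y) \<bullet> u = s" unfolding q_def using u(1) by (simp add: dot_square_norm)
    moreover have "\<bar>((p - q) - (z - y)) \<bullet> u\<bar> \<le> norm ((p - q) - (z - y)) * norm u"
      by (rule Cauchy_Schwarz_ineq2)
    moreover have "norm ((p - q) - (z - y)) \<le> 2 * \<eta>"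
      using norm_triangle_ineq4[of "p - q" "z - y"] zy p by (simp add: dist_norm)
    \<comment> \<open>\<open>p - z\<close> points roughly along \<open>u\<close>: its component is
      \<open>s \<ge> R\<close> up to an error of at most
      \<open>2 * \<eta> \<le> R / 2\<close>.\<close>
    ultimately have "R / 2 \<le> (p - z) \<bullet> u" using sR u R by simp
    hence "T * (R / 2) \<le> T * ((p - z) \<bullet> u)" using T by (intro mult_left_mono) auto
    hence "T * (R / 2) \<le> 7 * d * R * \<rho> + \<eta>\<^sup>2" using 6 by linarith
    hence "T \<le> 2 * (\<eta>\<^sup>2 + 7 * d * R * \<rho>) / R" using R by (simp add: field_simps)
    thus ?thesis by (simp add: T_def y_def d_def dist_norm)
  qed
qed

text \<open>The sphere of \<open>infnorm\<close> is the boundary of a cube, so a net can be written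
  down facet by facet: one coordinate is pinned and the others run over a grid. The
  \<open>d - 1\<close> free coordinates are the source of the exponent of the entropy; preferring
  the sup norm to the Euclidean one costs only powers of \<open>d\<close>.\<close>

definition sphere_net :: "real \<Rightarrow> real \<Rightarrow> (real^'d) set" where
  "sphere_net r h = (\<Union>i. \<Union>\<sigma>\<in>{r, -r}. (\<lambda>g. \<chi> j. if j = i then \<sigma> else h * of_int (g j)) `
      (PiE (UNIV - {i}) (\<lambda>_. {\<lfloor>- r / h\<rfloor>..\<lfloor>r / h\<rfloor>})))"

lemma card_int_grid:
  assumes "0 \<le> r" "0 < h"
  shows "real (card {\<lfloor>- r / h\<rfloor>..\<lfloor>r / h\<rfloor>}) \<le> 2 * r / h + 2"
proof -
  have "- r / h \<le> r / h" using assms by (simp add: field_simps)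
  hence "\<lfloor>- r / h\<rfloor> \<le> \<lfloor>r / h\<rfloor>" by (rule floor_mono)
  hence "real (card {\<lfloor>- r / h\<rfloor>..\<lfloor>r / h\<rfloor>}) = of_int (\<lfloor>r / h\<rfloor> - \<lfloor>- r / h\<rfloor> + 1)" by simp
  also have "\<dots> \<le> r / h - (- r / h - 1) + 1"
    using of_int_floor_le[of "r / h"] real_of_int_floor_gt_diff_one[of "- r / h"]
    unfolding of_int_add of_int_diff of_int_1 by linarith
  also have "\<dots> = 2 * r / h + 2" by simp
  finally show ?thesis .
qed

lemma floor_in_grid:
  assumes "\<bar>v\<bar> \<le> r" "0 < h"
  shows "\<lfloor>v / h\<rfloor> \<in> {\<lfloor>- r / h\<rfloor>..\<lfloor>r / h\<rfloor>}" "\<bar>v - h * of_int \<lfloor>v / h\<rfloor>\<bar> \<le> h"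
proof -
  have "- r / h \<le> v / h" "v / h \<le> r / h"
    using assms divide_right_mono[of "- r" v h] divide_right_mono[of v r h] by auto
  thus "\<lfloor>v / h\<rfloor> \<in> {\<lfloor>- r / h\<rfloor>..\<lfloor>r / h\<rfloor>}" using floor_mono by auto
  have "of_int \<lfloor>v / h\<rfloor> \<le> v / h" "v / h - 1 \<le> of_int \<lfloor>v / h\<rfloor>" by linarith+
  from this[THEN mult_left_mono, of h] assms
  have "h * of_int \<lfloor>v / h\<rfloor> \<le> h * (v / h)" "h * (v / h - 1) \<le> h * of_int \<lfloor>v / h\<rfloor>" by linarith+
  thus "\<bar>v - h * of_int \<lfloor>v / h\<rfloor>\<bar> \<le> h" using assms by (simp add: right_diff_distrib)
qed

lemma sphere_net:
  fixes r h :: real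
  assumes "0 < r" "0 < h"
  defines "N \<equiv> sphere_net r h :: (real^'d) set"
  shows "finite N"
    and "real (card N) \<le> 2 * real CARD('d) * (2 * r / h + 2) ^ (CARD('d) - 1)"
    and "\<And>q. infnorm q = r \<Longrightarrow> \<exists>p\<in>N. dist p q \<le> real CARD('d) * h"
    and "\<And>p. p \<in> N \<Longrightarrow> infnorm p \<le> r + h"
proof -
  let ?K = "{\<lfloor>- r / h\<rfloor>..\<lfloor>r / h\<rfloor>}"
  let ?P = "\<lambda>i::'d. PiE (UNIV - {i}) (\<lambda>_. ?K)"
  let ?f = "\<lambda>i \<sigma> (g::'d \<Rightarrow> int). (\<chi> j. if j = i then \<sigma> else h * of_int (g j)) :: real^'d"
  have fin: "finite (?P i)" for i by (intro finite_PiE) auto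
  thus "finite N" unfolding N_def sphere_net_def by (intro finite_UN_I finite_imageI) simp_all
  have PK: "card (?P i) = card ?K ^ (CARD('d) - 1)" for i
    using card_PiE[of "UNIV - {i}" "\<lambda>_. ?K"] by (simp del: card_atLeastAtMost_int)
  have 0: "card (?f i \<sigma> ` ?P i) \<le> card ?K ^ (CARD('d) - 1)" for i \<sigma>
    using card_image_le[OF fin, of "?f i \<sigma>" i] unfolding PK .
  have 1: "card (\<Union>\<sigma>\<in>{r,-r}. ?f i \<sigma> ` ?P i) \<le> (\<Sum>\<sigma>\<in>{r,-r}. card ?K ^ (CARD('d) - 1))" for i
    by (rule order_trans[OF card_UN_le sum_mono]) (simp, rule 0)
  have "card N \<le> (\<Sum>i\<in>(UNIV::'d set). \<Sum>\<sigma>\<in>{r,-r}. card ?K ^ (CARD('d) - 1))"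
    unfolding N_def sphere_net_def by (rule order_trans[OF card_UN_le sum_mono]) (simp, rule 1)
  also have "\<dots> = CARD('d) * (2 * card ?K ^ (CARD('d) - 1))"
    using assms(1) by (simp del: card_atLeastAtMost_int)
  finally have "real (card N) \<le> real (CARD('d) * (2 * card ?K ^ (CARD('d) - 1)))" by (simp only: of_nat_le_iff)
  also have "\<dots> = 2 * real CARD('d) * real (card ?K) ^ (CARD('d) - 1)"
    by (simp del: card_atLeastAtMost_int)
  also have "\<dots> \<le> 2 * real CARD('d) * (2 * r / h + 2) ^ (CARD('d) - 1)"
    using card_int_grid[of r h] assms(1,2) by (intro mult_left_mono power_mono) (simp_all del: card_atLeastAtMost_int)
  finally show "real (card N) \<le> 2 * real CARD('d) * (2 * r / h + 2) ^ (CARD('d) - 1)" .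
  show "\<exists>p\<in>N. dist p q \<le> real CARD('d) * h" if q: "infnorm q = r" for q
  proof -
    obtain i where i: "\<bar>q $ i\<bar> = r" using infnorm_attained[of q] q by auto
    have qj: "\<bar>q $ j\<bar> \<le> r" for j using q component_le_infnorm_cart[of q j] by simp
    define p where "p = ?f i (q $ i) (restrict (\<lambda>j. \<lfloor>q $ j / h\<rfloor>) (UNIV - {i}))"
    have "q $ i \<in> {r, -r}" using i by auto
    moreover have "restrict (\<lambda>j. \<lfloor>q $ j / h\<rfloor>) (UNIV - {i}) \<in> ?P i"
      using floor_in_grid(1)[OF qj assms(2)] by (simp del: atLeastAtMost_iff)
    ultimately have "p \<in> N" unfolding N_def sphere_net_def p_def
      by (intro UN_I[of i] UN_I[of "q $ i"] imageI UNIV_I)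
    moreover have "dist p q \<le> real CARD('d) * h"
      unfolding dist_norm
    proof (rule norm_le_card_component)
      fix j show "\<bar>(p - q) $ j\<bar> \<le> h"
        using floor_in_grid(2)[OF qj assms(2), of j] assms by (simp add: p_def abs_minus_commute)
    qed
    ultimately show ?thesis by blast
  qed
  show "infnorm p \<le> r + h" if p: "p \<in> N" for p
  proof -
    obtain i \<sigma> g where g: "\<sigma> \<in> {r, -r}" "g \<in> ?P i" "p = ?f i \<sigma> g"
      using p unfolding N_def sphere_net_def by (elim UN_E imageE) (rule that)
    have "\<bar>p $ j\<bar> \<le> r + h" for j
    proof (cases "j = i")
      case True thus ?thesis using g(1,3) assms(1,2) by auto
    next
      case False
      hence "g j \<in> ?K" using g(2) by (intro PiE_mem[OF g(2)]) auto
      hence gj: "\<lfloor>- r / h\<rfloor> \<le> g j" "g j \<le> \<lfloor>r / h\<rfloor>" by auto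
      have a: "of_int (g j) \<le> r / h" using gj(2) by (simp add: le_floor_iff)
      \<comment> \<open>Rounding down may leave the cube by up to one mesh width, hence the bound
        \<open>r + h\<close>.\<close>
      have "- r / h - 1 \<le> of_int \<lfloor>- r / h\<rfloor>" using real_of_int_floor_gt_diff_one[of "- r / h"] by linarith
      hence b: "- r / h - 1 \<le> of_int (g j)" using gj(1) by linarith
      from a b have "h * of_int (g j) \<le> h * (r / h)" "h * (- r / h - 1) \<le> h * of_int (g j)"
        using assms(2) by (simp_all only: mult_le_cancel_left_pos)
      thus ?thesis using g(3) False assms(1,2) by (simp add: right_diff_distrib abs_le_iff)
    qed
    thus ?thesis by (simp add: infnorm_le_cart)
  qed
qed

definition good_body :: "real \<Rightarrow> (real^'d) set \<Rightarrow> bool" where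
  "good_body R C \<longleftrightarrow> closed C \<and> convex C \<and> C \<noteq> {} \<and> (\<forall>x\<in>C. infnorm x \<le> R)"

text \<open>Bounds the logarithm of the number of codes in \<open>convex_body_net\<close>:
  \<open>d\<close> coordinates are stored per point of the net, and each takes at most
  \<open>74 * d^2 * R / t\<close> values. The accuracy \<open>t\<close> enters the size of the net
  only through \<open>sqrt (R / t)\<close>.\<close>

definition net_entropy :: "nat \<Rightarrow> real \<Rightarrow> real \<Rightarrow> real" where
  "net_entropy d R t = 2 * real d ^ 2 * (18 * real d) ^ (d - 1) * sqrt (R / t) ^ (d - 1) * ln (74 * real d ^ 2 * R / t)"

text \<open>A body is coded by the grid cells of its closest points to a net on a cube surface.
  Bodies with equal codes have nearby closest points, and
  \<open>closest_points_determine_convex\<close>, applied in both directions, makes them close in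
  the Hausdorff sense; one body per code is kept.\<close>

lemma convex_body_net:
  fixes R t :: real
  assumes R: "0 < R" "0 < t" "t \<le> R"
  defines "d \<equiv> CARD('d::finite)"
  obtains F :: "(real^'d) set set" where "finite F"
    "real (card F) \<le> exp (net_entropy d R t)"
    "\<And>C. C \<in> F \<Longrightarrow> good_body R C"
    "\<And>C. good_body R C \<Longrightarrow> \<exists>D\<in>F. (\<forall>x\<in>C. \<exists>y\<in>D. dist x y \<le> t) \<and> (\<forall>x\<in>D. \<exists>y\<in>C. dist x y \<le> t)"
proof -
  have d: "1 \<le> real d" unfolding d_def by (simp add: Suc_leI)
  \<comment> \<open>With this \<open>\<eta>\<close> and the \<open>\<rho>\<close> below, the two
    error terms of \<open>closest_points_determine_convex\<close> become \<open>t / 8\<close> and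
    \<open>t / 2\<close>.\<close>
  define \<eta> where "\<eta> = sqrt (t * R) / 4"
  have eta: "0 < \<eta>" "\<eta>\<^sup>2 = t * R / 16" using R by (auto simp: \<eta>_def power_divide)
  have "sqrt (t * R) \<le> R" using R by (intro real_le_lsqrt) (auto simp: power2_eq_square)
  hence eta4: "4 * \<eta> \<le> R" by (simp add: \<eta>_def)
  define \<rho> where "\<rho> = t / (28 * real d)"
  \<comment> \<open>Dividing by \<open>d\<close>, here and for \<open>h\<close> below, turns a
    coordinatewise error into a Euclidean one.\<close>
  define h2 where "h2 = \<rho> / real d"
  have rho: "0 < \<rho>" "0 < h2" using R d by (auto simp: \<rho>_def h2_def)
  have "\<rho> \<le> t" unfolding \<rho>_def using d R by (simp add: field_simps)
  hence rhoR: "\<rho> \<le> R" using R by simp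
  define h where "h = \<eta> / real d"
  have h: "0 < h" "h \<le> R" "real d * h = \<eta>"
  proof -
    show "0 < h" "real d * h = \<eta>" using eta d by (auto simp: h_def)
    have "h \<le> \<eta>" unfolding h_def using d eta by (simp add: field_simps)
    thus "h \<le> R" using eta4 eta by linarith
  qed
  define N :: "(real^'d) set" where "N = sphere_net (2 * R) h"
  have R2: "0 < 2 * R" using R by simp
  note N = sphere_net[where 'd='d, OF R2 h(1), folded N_def d_def]
  let ?K = "{\<lfloor>- R / h2\<rfloor>..\<lfloor>R / h2\<rfloor>}"
  define code :: "(real^'d) set \<Rightarrow> real^'d \<Rightarrow> 'd \<Rightarrow> int" where
    "code C = restrict (\<lambda>p i. \<lfloor>closest_point C p $ i / h2\<rfloor>) N" for C
  define W where "W = PiE N (\<lambda>_. PiE (UNIV::'d set) (\<lambda>_. ?K))"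
  have finW: "finite W" unfolding W_def using N(1) by (intro finite_PiE) auto
  have cardW: "real (card W) = real (card ?K) ^ (d * card N)"
    unfolding W_def using N(1) by (simp add: card_PiE d_def power_mult)
  have codeW: "code C \<in> W" if C: "good_body R C" for C
  proof -
    have "closest_point C p \<in> C" for p using C by (intro closest_point_in_set) (auto simp: good_body_def)
    hence "\<bar>closest_point C p $ i\<bar> \<le> R" for p i
      using C component_le_infnorm_cart order_trans unfolding good_body_def by blast
    thus ?thesis unfolding code_def W_def using floor_in_grid(1)[OF _ rho(2)]
      by (intro restrict_PiE_iff[THEN iffD2] ballI PiE_I) auto
  qed
  define F where "F = (\<lambda>w. SOME C. good_body R C \<and> code C = w) ` (code ` {C. good_body R C})"
  have sub: "code ` {C. good_body R C} \<subseteq> W" using codeW by auto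
  have finc: "finite (code ` {C. good_body R C})" using finite_subset[OF sub finW] .
  have some: "good_body R (SOME D. good_body R D \<and> code D = code C) \<and> code (SOME D. good_body R D \<and> code D = code C) = code C"
    if "good_body R C" for C
    by (rule someI[of "\<lambda>D. good_body R D \<and> code D = code C" C]) (use that in simp)
  have close: "\<exists>y\<in>C. dist x y \<le> t" if C: "good_body R C" "good_body R D" "code C = code D" "x \<in> D" for C D x
  proof -
    have near: "dist (closest_point C p) (closest_point D p) \<le> \<rho>" if p: "p \<in> N" for p
    proof -
      have "\<bar>(closest_point C p - closest_point D p) $ i\<bar> \<le> h2" for i
      proof -
        define a b where "a = closest_point C p $ i" and "b = closest_point D p $ i"
        have eq: "\<lfloor>a / h2\<rfloor> = \<lfloor>b / h2\<rfloor>"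
          using arg_cong[OF C(3), of "\<lambda>g. g p i"] p by (simp add: code_def a_def b_def)
        have "\<bar>a / h2 - b / h2\<bar> \<le> 1" using eq by linarith
        hence "\<bar>a - b\<bar> / h2 \<le> 1" using rho by (simp add: diff_divide_distrib[symmetric])
        thus ?thesis using rho by (simp add: a_def b_def)
      qed
      hence "norm (closest_point C p - closest_point D p) \<le> real CARD('d) * h2" by (rule norm_le_card_component)
      thus ?thesis using d by (simp add: h2_def d_def dist_norm)
    qed
    have "dist x (closest_point C x) \<le> 2 * (\<eta>\<^sup>2 + 7 * real CARD('d) * R * \<rho>) / R"
    proof (rule closest_points_determine_convex[where N=N and C'=D and x=x])
      show "\<exists>p\<in>N. dist p q \<le> \<eta>" if "infnorm q = 2 * R" for q using N(3)[OF that] h by simp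
      show "infnorm p \<le> 3 * R" if "p \<in> N" for p using N(4)[OF that] h by simp
    qed (use near C R rho rhoR eta eta4 in \<open>simp_all add: good_body_def\<close>)
    also have "\<dots> = t / 8 + t / 2"
      unfolding eta \<rho>_def using R d by (simp add: field_simps d_def)
    also have "\<dots> \<le> t" using R by simp
    finally show ?thesis using C(1) closest_point_in_set unfolding good_body_def by blast
  qed
  show ?thesis
  proof (rule that[of F])
    show "finite F" unfolding F_def using finc by simp
    show "good_body R C" if "C \<in> F" for C using that some unfolding F_def by auto
    show "\<exists>D\<in>F. (\<forall>x\<in>C. \<exists>y\<in>D. dist x y \<le> t) \<and> (\<forall>x\<in>D. \<exists>y\<in>C. dist x y \<le> t)" if C: "good_body R C" for C
    proof (intro bexI[of _ "SOME D. good_body R D \<and> code D = code C"] conjI ballI)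
      let ?D = "SOME D. good_body R D \<and> code D = code C"
      show "?D \<in> F" unfolding F_def using C by blast
      show "\<exists>y\<in>?D. dist x y \<le> t" if "x \<in> C" for x using close[of ?D C x] some[OF C] C that by simp
      show "\<exists>y\<in>C. dist x y \<le> t" if "x \<in> ?D" for x using close[of C ?D x] some[OF C] C that by simp
    qed
    have Rt: "1 \<le> R / t" using R by simp
    have dd: "1 \<le> real d ^ 2" using d by simp
    have K: "real (card ?K) \<le> 74 * real d ^ 2 * R / t"
    proof -
      have "real (card ?K) \<le> 2 * R / h2 + 2" using R rho by (intro card_int_grid) auto
      also have "2 * R / h2 = 56 * real d ^ 2 * (R / t)"
        unfolding h2_def \<rho>_def using R d by (simp add: field_simps power2_eq_square)
      also have "2 \<le> 2 * (real d ^ 2 * (R / t))"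
        using mult_mono[OF dd Rt] by simp
      finally have "real (card ?K) \<le> 58 * (real d ^ 2 * (R / t))" by (simp add: mult_ac del: card_atLeastAtMost_int)
      also have "\<dots> \<le> 74 * (real d ^ 2 * (R / t))" using R by (intro mult_right_mono) auto
      finally show ?thesis by (simp add: mult_ac del: card_atLeastAtMost_int)
    qed
    have 74: "1 \<le> 74 * real d ^ 2 * R / t"
      using mult_mono[OF dd Rt] by simp
    have Nc: "real (card N) \<le> 2 * real d * ((18 * real d) ^ (d - 1) * sqrt (R / t) ^ (d - 1))"
    proof -
      have "R / \<eta> = 4 * sqrt (R / t)"
      proof -
        have "sqrt (R / t) * sqrt (t * R) = R" using R by (simp flip: real_sqrt_mult)
        thus ?thesis unfolding \<eta>_def using R by (simp add: field_simps)
      qed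
      hence "2 * (2 * R) / h + 2 = 16 * real d * sqrt (R / t) + 2"
      proof -
        assume e: "R / \<eta> = 4 * sqrt (R / t)"
        have "2 * (2 * R) / h = 4 * real d * (R / \<eta>)" unfolding h_def by simp
        thus ?thesis unfolding e by simp
      qed
      also have "\<dots> \<le> 16 * real d * sqrt (R / t) + 2 * (real d * sqrt (R / t))"
        using mult_mono[OF d, of 1 "sqrt (R / t)"] real_sqrt_le_mono[OF Rt] by simp
      also have "\<dots> = 18 * real d * sqrt (R / t)" by simp
      finally have "(2 * (2 * R) / h + 2) ^ (d - 1) \<le> (18 * real d * sqrt (R / t)) ^ (d - 1)"
        using R h by (intro power_mono) auto
      thus ?thesis using order_trans[OF N(2)] d by (simp add: power_mult_distrib mult_left_mono)
    qed
    have "card F \<le> card W" unfolding F_def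
      using card_image_le[OF finc] card_mono[OF finW sub] order_trans by blast
    hence "real (card F) \<le> real (card ?K) ^ (d * card N)" using cardW by simp
    also have "\<dots> \<le> (74 * real d ^ 2 * R / t) ^ (d * card N)" using K by (intro power_mono) auto
    also have "\<dots> = exp (real (d * card N) * ln (74 * real d ^ 2 * R / t))"
      using 74 by (subst exp_of_nat_mult) auto
    also have "\<dots> \<le> exp (real d * (2 * real d * ((18 * real d) ^ (d - 1) * sqrt (R / t) ^ (d - 1))) * ln (74 * real d ^ 2 * R / t))"
      using Nc d 74 unfolding of_nat_mult exp_le_cancel_iff
      by (intro mult_right_mono mult_left_mono) auto
    finally show "real (card F) \<le> exp (net_entropy d R t)"
      by (simp add: net_entropy_def power2_eq_square algebra_simps)
  qed
qed

section \<open>Normalisation\<close>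

lemma 
  fixes A :: "real^'n^'n"
  assumes "invertible A"
  shows matrix_inv_right: "A ** matrix_inv A = mat 1" and matrix_inv_left: "matrix_inv A ** A = mat 1"
proof -
  have "\<exists>B. A ** B = mat 1 \<and> B ** A = mat 1" using assms by (simp add: invertible_def)
  from someI_ex[OF this] show "A ** matrix_inv A = mat 1" "matrix_inv A ** A = mat 1"
    unfolding matrix_inv_def by blast+
qed

text \<open>The vertex \<open>v0\<close> is fixed and the other \<open>d\<close> points of
  \<open>L\<close> maximise the volume of the simplex. By Cramer's rule, replacing the
  \<open>k\<close>-th of them by \<open>x\<close> multiplies the determinant by the
  \<open>k\<close>-th coordinate of \<open>x\<close>, which therefore has absolute value at most
  1.\<close>

lemma max_det_frame:
  fixes L :: "(real^'d) set"
  assumes "compact L" "interior L \<noteq> {}"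
  obtains v0 and A :: "real^'d^'d" where "v0 \<in> L" "invertible A" "\<And>i. v0 + A *v axis i 1 \<in> L"
    "\<And>x. x \<in> L \<Longrightarrow> \<exists>c. x = v0 + A *v c \<and> infnorm c \<le> 1"
proof -
  obtain v0 r where v0: "0 < r" "ball v0 r \<subseteq> L" using assms(2) by (meson all_not_in_conv mem_interior)
  have v0L: "v0 \<in> L" using v0 by auto
  define K where "K = {V :: real^'d^'d. \<forall>i. V $ i \<in> L}"
  define Mx where "Mx V = (\<chi> i j. V $ j $ i - v0 $ i)" for V :: "real^'d^'d"
  have "closed K"
  proof -
    have "K = (\<Inter>i. (\<lambda>V. V $ i) -` L)" by (auto simp: K_def)
    thus ?thesis using compact_imp_closed[OF assms(1)]
      by (auto intro!: closed_INT closed_vimage continuous_intros)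
  qed
  moreover have "bounded K"
  proof -
    obtain b where b: "\<And>x. x \<in> L \<Longrightarrow> norm x \<le> b"
      using compact_imp_bounded[OF assms(1)] by (auto simp: bounded_iff)
    have "norm V \<le> real CARD('d) * b" if "V \<in> K" for V
    proof -
      have "norm V \<le> (\<Sum>i\<in>UNIV. norm (V $ i))" unfolding norm_vec_def by (intro L2_set_le_sum) auto
      also have "\<dots> \<le> real CARD('d) * b"
        using sum_bounded_above[of UNIV "\<lambda>i. norm (V $ i)" b] that b by (simp add: K_def)
      finally show ?thesis .
    qed
    thus ?thesis by (auto simp: bounded_iff)
  qed
  ultimately have K: "compact K" by (simp add: compact_eq_bounded_closed)
  have "(\<chi> i. v0) \<in> K" using v0L by (simp add: K_def)
  moreover have "continuous_on K (\<lambda>V. \<bar>det (Mx V)\<bar>)"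
    unfolding det_def Mx_def by (intro continuous_intros)
  ultimately obtain V where V: "V \<in> K" "\<And>W. W \<in> K \<Longrightarrow> \<bar>det (Mx W)\<bar> \<le> \<bar>det (Mx V)\<bar>"
    using continuous_attains_sup[OF K] by (metis empty_iff)
  let ?A = "Mx V"
  have "det ?A \<noteq> 0"
  proof -
    \<comment> \<open>A small simplex inside the ball around \<open>v0\<close> keeps the maximal
      determinant away from 0.\<close>
    define W :: "real^'d^'d" where "W = (\<chi> i. v0 + axis i (r / 2))"
    have "v0 + axis i (r / 2) \<in> L" for i
      using v0 by (intro subsetD[OF v0(2)]) (simp add: dist_norm norm_eq_sqrt_inner inner_axis_axis real_sqrt_divide)
    hence "W \<in> K" by (simp add: K_def W_def)
    moreover have "det (Mx W) = (r / 2) ^ CARD('d)"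
    proof -
      have "det (Mx W) = (\<Prod>i\<in>UNIV. Mx W $ i $ i)"
        by (intro det_diagonal) (auto simp: Mx_def W_def axis_def)
      thus ?thesis by (simp add: Mx_def W_def)
    qed
    ultimately have "(r / 2) ^ CARD('d) \<le> \<bar>det ?A\<bar>" using V(2)[of W] v0 by simp
    moreover have "0 < (r / 2) ^ CARD('d)" using v0 by simp
    ultimately show ?thesis by linarith
  qed
  hence inv: "invertible ?A" by (simp add: invertible_det_nz)
  have ax: "v0 + ?A *v axis i 1 = V $ i" for i
    by (simp add: vec_eq_iff Mx_def matrix_vector_mul_component inner_axis' matrix_vector_mult_basis column_def)
  show ?thesis
  proof (rule that[OF v0L inv])
    show "v0 + ?A *v axis i 1 \<in> L" for i using V(1) ax by (simp add: K_def)
    show "\<exists>c. x = v0 + ?A *v c \<and> infnorm c \<le> 1" if x: "x \<in> L" for x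
    proof -
      define c where "c = matrix_inv ?A *v (x - v0)"
      have Ac: "?A *v c = x - v0" unfolding c_def using inv
        by (simp add: matrix_vector_mul_assoc matrix_inv_right)
      have "\<bar>c $ k\<bar> \<le> 1" for k
      proof -
        define W :: "real^'d^'d" where "W = (\<chi> i. if i = k then x else V $ i)"
        have "W \<in> K" using V(1) x by (simp add: K_def W_def)
        moreover have "Mx W = (\<chi> i j. if j = k then (?A *v c) $ i else ?A $ i $ j)"
          unfolding Ac by (simp add: vec_eq_iff Mx_def W_def)
        hence "det (Mx W) = c $ k * det ?A" using cramer_lemma[of k ?A c] by simp
        ultimately have "\<bar>c $ k\<bar> * \<bar>det ?A\<bar> \<le> 1 * \<bar>det ?A\<bar>" using V(2)[of W] by (simp add: abs_mult)
        thus ?thesis using \<open>det ?A \<noteq> 0\<close> by (simp add: mult_le_cancel_right)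
      qed
      hence "infnorm c \<le> 1" by (simp add: infnorm_le_cart)
      moreover have "x = v0 + ?A *v c" using Ac by simp
      ultimately show ?thesis by blast
    qed
  qed
qed

text \<open>\<open>c\<close> is the average of the \<open>CARD('d)\<close> vectors with the single
  coordinate \<open>CARD('d) * c $ i\<close>, each of which lies on an edge of the simplex at
  \<open>v0\<close>; this is why the cube has side \<open>1 / CARD('d)\<close>.\<close>

lemma frame_cube_subset:
  fixes A :: "real^'d^'d"
  assumes L: "convex L" "v0 \<in> L" "\<And>i. v0 + A *v axis i 1 \<in> L"
    and c: "\<And>i. 0 \<le> c $ i" "\<And>i. c $ i \<le> 1 / real CARD('d)"
  shows "v0 + A *v c \<in> L"
proof -
  let ?d = "real CARD('d)"
  define p where "p i = (1 - ?d * c $ i) *\<^sub>R v0 + (?d * c $ i) *\<^sub>R (v0 + A *v axis i 1)" for i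
  have pL: "p i \<in> L" for i unfolding p_def using c[of i] L by (intro convexD_alt) (auto simp: field_simps)
  have "(\<Sum>i\<in>UNIV. (1 / ?d) *\<^sub>R p i) \<in> L" using pL L(1) by (intro convex_sum) auto
  moreover have "(1 / ?d) *\<^sub>R p i = (1 / ?d) *\<^sub>R v0 + c $ i *\<^sub>R (A *v axis i 1)" for i
    unfolding p_def by (simp add: algebra_simps)
  hence "(\<Sum>i\<in>UNIV. (1 / ?d) *\<^sub>R p i) = v0 + (\<Sum>i\<in>UNIV. c $ i *\<^sub>R (A *v axis i 1))"
    by (simp add: sum.distrib sum_constant_scaleR del: sum_constant)
  moreover have "(\<Sum>i\<in>UNIV. c $ i *\<^sub>R (A *v axis i 1)) = A *v (\<Sum>i\<in>UNIV. c $ i *\<^sub>R axis i 1)"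
    by (simp add: matrix_vector_mult_scaleR vec.sum linear_sum[OF matrix_vector_mul_linear])
  moreover have "(\<Sum>i\<in>UNIV. c $ i *\<^sub>R axis i 1) = c"
    using basis_expansion[of c] by (simp add: scalar_mult_eq_scaleR)
  ultimately show ?thesis by simp
qed

text \<open>Some coordinate of the outer normal \<open>u\<close> at the closest point carries at
  least the share \<open>1 / CARD('d)\<close> of its length, so a step along that axis moves far
  enough away from \<open>C\<close>. Thus \<open>2 * CARD('d)\<close> fixed steps serve all outside
  points of all convex sets.\<close>

lemma outer_shell_step:
  fixes C :: "(real^'d) set"
  assumes C: "closed C" "convex C" "C \<noteq> {}" "x \<notin> C" and s: "2 * t * real CARD('d) \<le> s" "0 \<le> t" "0 < s"
  obtains i \<sigma> where "\<sigma> \<in> {1, -1}" "\<And>c. c \<in> C \<Longrightarrow> 2 * t < dist (x + axis i (s * \<sigma>)) c"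
proof -
  define y where "y = closest_point C x"
  have yC: "y \<in> C" unfolding y_def using C by (intro closest_point_in_set)
  define u where "u = x - y"
  have u: "0 < norm u" using yC C by (auto simp: u_def)
  have dot: "u \<bullet> (c - y) \<le> 0" if "c \<in> C" for c unfolding u_def y_def using C that by (intro closest_point_dot)
  obtain i where i: "\<bar>u $ i\<bar> = infnorm u" using infnorm_attained by blast
  define \<sigma> :: real where "\<sigma> = (if 0 \<le> u $ i then 1 else -1)"
  have su: "u \<bullet> axis i (s * \<sigma>) = s * infnorm u" unfolding i[symmetric] \<sigma>_def by (simp add: inner_axis)
  show ?thesis
  proof (rule that[of \<sigma> i])
    show "\<sigma> \<in> {1, -1}" by (simp add: \<sigma>_def)
    fix c assume c: "c \<in> C"
    define z where "z = x + axis i (s * \<sigma>)"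
    have "2 * t * norm u \<le> 2 * t * (real CARD('d) * infnorm u)"
      using norm_le_card_infnorm[of u] s by (intro mult_left_mono) auto
    also have "\<dots> \<le> s * infnorm u" using s mult_right_mono[OF s(1), of "infnorm u"] infnorm_pos_le[of u]
      by (simp add: mult.assoc)
    also have "\<dots> < s * infnorm u + u \<bullet> u - u \<bullet> (c - y)" using dot[OF c] inner_gt_zero_iff[of u] u by (auto intro: le_less_trans)
    also have "\<dots> = u \<bullet> (u + axis i (s * \<sigma>) - (c - y))" by (simp add: inner_diff_right inner_add_right su)
    also have "\<dots> = u \<bullet> (z - c)" by (simp add: z_def u_def algebra_simps)
    also have "\<dots> \<le> norm u * norm (z - c)" by (rule norm_cauchy_schwarz)
    finally show "2 * t < dist (x + axis i (s * \<sigma>)) c" using u by (simp add: z_def dist_norm mult.commute)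
  qed
qed

text \<open>For \<open>j < k\<close> the point \<open>x'\<close> would be
  \<open>x + m *\<^sub>R w\<close> with \<open>m \<ge> 1\<close>, so that \<open>x + w\<close> would
  lie on the segment from \<open>x\<close> to \<open>x'\<close> and hence in
  \<open>E\<close>.\<close>

lemma convex_exit_translates_disjoint:
  fixes w :: "'a::real_vector"
  assumes "convex E" "x \<in> E" "x + w \<notin> E" "x' \<in> E" "x' + w \<notin> E" "x + real k *\<^sub>R w = x' + real j *\<^sub>R w"
  shows "j = k"
proof -
  have *: False if "j < k" "y \<in> E" "y + w \<notin> E" "y' \<in> E" "y + real k *\<^sub>R w = y' + real j *\<^sub>R w" for j k y y'
  proof -
    define m where "m = real k - real j"
    have m: "1 \<le> m" using that by (simp add: m_def)
    have y': "y' = y + m *\<^sub>R w" using that(5) unfolding m_def scaleR_diff_left by (simp add: algebra_simps)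
    have "(1 - 1 / m) *\<^sub>R y + (1 / m) *\<^sub>R y' = y + w"
      unfolding y' using m by (simp add: algebra_simps)
    moreover have "(1 - 1 / m) *\<^sub>R y + (1 / m) *\<^sub>R y' \<in> E"
      using m that by (intro convexD_alt[OF assms(1)]) auto
    ultimately show False using that by simp
  qed
  show ?thesis
    using *[of j k x x'] *[of k j x' x] assms by (metis linorder_neqE_nat)
qed

section \<open>Probabilities under a log-concave density\<close>

lemma density_prob_le:
  assumes "f \<in> log_concave_densities" "\<And>x. f x \<le> M" "S \<in> fmeasurable lborel"
  shows "measure (density lborel (\<lambda>x. ennreal (f x))) S \<le> M * measure lborel S"
proof -
  note f = log_concave_densitiesD[OF assms(1)]
  have M: "0 \<le> M" using f(3) assms(2) order_trans by blast
  have "emeasure (density lborel (\<lambda>x. ennreal (f x))) S = (\<integral>\<^sup>+x. ennreal (f x) * indicator S x \<partial>lborel)"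
    using f assms by (intro emeasure_density) auto
  also have "\<dots> \<le> (\<integral>\<^sup>+x. ennreal M * indicator S x \<partial>lborel)"
    using assms by (intro nn_integral_mono) (auto split: split_indicator intro: ennreal_leI)
  also have "\<dots> = ennreal M * emeasure lborel S"
    using assms by (intro nn_integral_cmult_indicator) auto
  also have "emeasure lborel S = ennreal (measure lborel S)" using assms(3) by (rule emeasure_eq_measure2)
  finally show ?thesis using M
    by (simp add: measure_def enn2real_leI ennreal_mult[symmetric])
qed

lemma density_prob_space:
  "f \<in> log_concave_densities \<Longrightarrow> prob_space (density lborel (\<lambda>x. ennreal (f x)))"
  by (intro prob_spaceI) (auto simp: emeasure_density log_concave_densities_def probability_density_def cong: nn_integral_cong)

lemma density_measure_integral:
  assumes "f \<in> log_concave_densities" "S \<in> sets borel"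
  shows "measure (density lborel (\<lambda>x. ennreal (f x))) S = (\<integral>x. f x * indicator S x \<partial>lborel)"
proof -
  note f = log_concave_densitiesD[OF assms(1)]
  have "measure (density lborel (\<lambda>x. ennreal (f x))) S = (\<integral>x. indicator S x \<partial>density lborel (\<lambda>x. ennreal (f x)))"
    using assms by simp
  also have "\<dots> = (\<integral>x. f x *\<^sub>R indicator S x \<partial>lborel)"
    using f assms by (intro integral_density) auto
  finally show ?thesis by simp
qed

text \<open>On this set \<open>f x\<close> is at most \<open>sqrt (f x)\<close> times the root of
  the threshold, so the integral of \<open>sqrt f\<close> controls the mass.\<close>

lemma density_tail:
  fixes f :: "'a::euclidean_space \<Rightarrow> real"
  assumes "f \<in> log_concave_densities" "0 < f x0" "\<And>x. f x \<le> f x0"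
  shows "measure (density lborel (\<lambda>x. ennreal (f x))) {x. f x < f x0 * exp (- s)} \<le> exp (- s / 2) * sqrt_bound DIM('a)"
proof -
  note f = log_concave_densitiesD[OF assms(1)] and sq = sqrt_density_integral[OF assms]
  note [measurable] = f(4)
  let ?S = "{x. f x < f x0 * exp (- s)}"
  have S: "?S \<in> sets borel" by measurable
  have "measure (density lborel (\<lambda>x. ennreal (f x))) ?S = (\<integral>x. f x * indicator ?S x \<partial>lborel)"
    using density_measure_integral[OF assms(1) S] .
  also have "\<dots> \<le> (\<integral>x. (sqrt (f x0) * exp (- s / 2)) * sqrt (f x) \<partial>lborel)"
  proof (rule integral_mono)
    show "integrable lborel (\<lambda>x. f x * indicator ?S x)"
      using f(5) S by (intro integrable_real_mult_indicator) auto
    show "integrable lborel (\<lambda>x. (sqrt (f x0) * exp (- s / 2)) * sqrt (f x))" using sq(1) by simp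
    fix x
    show "f x * indicator ?S x \<le> (sqrt (f x0) * exp (- s / 2)) * sqrt (f x)"
    proof (cases "x \<in> ?S")
      case True
      have "exp (- s) = (exp (- s / 2))\<^sup>2" by (simp flip: exp_double)
      hence "sqrt (f x0 * exp (- s)) = sqrt (f x0) * exp (- s / 2)" by (simp add: real_sqrt_mult)
      moreover have "sqrt (f x) \<le> sqrt (f x0 * exp (- s))" using True by (intro real_sqrt_le_mono) auto
      ultimately have "sqrt (f x) * sqrt (f x) \<le> (sqrt (f x0) * exp (- s / 2)) * sqrt (f x)"
        using f(3) by (intro mult_right_mono) auto
      thus ?thesis using True f(3)[of x] by simp
    qed (use f(3) assms in auto)
  qed
  also have "\<dots> = exp (- s / 2) * (sqrt (f x0) * (\<integral>x. sqrt (f x) \<partial>lborel))" by simp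
  also have "\<dots> \<le> exp (- s / 2) * sqrt_bound DIM('a)" using sq(2) by (intro mult_left_mono) auto
  finally show ?thesis .
qed

lemma measure_translate_image:
  fixes S :: "'a::euclidean_space set"
  assumes "S \<in> sets borel"
  shows "(\<lambda>x. x + a) ` S \<in> sets borel" "measure lborel ((\<lambda>x. x + a) ` S) = measure lborel S"
proof -
  have eq: "(\<lambda>x. x + a) ` S = (\<lambda>x. x - a) -` S"
  proof (intro set_eqI iffI)
    fix y assume "y \<in> (\<lambda>x. x - a) -` S"
    thus "y \<in> (\<lambda>x. x + a) ` S" by (intro image_eqI[of _ _ "y - a"]) auto
  qed auto
  have "(\<lambda>x. x - a) -` S \<inter> space borel \<in> sets borel" using assms by (intro measurable_sets[where A=borel]) auto
  thus 1: "(\<lambda>x. x + a) ` S \<in> sets borel" using eq by simp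
  have "measure lebesgue ((+) a ` S) = measure lebesgue S" by (rule measure_translation)
  moreover have "(+) a ` S = (\<lambda>x. x + a) ` S" by (auto simp: add.commute)
  ultimately show "measure lborel ((\<lambda>x. x + a) ` S) = measure lborel S" using 1 assms by simp
qed

text \<open>All that is kept of the maximal simplex, in the coordinates \<open>c\<close> of
  \<open>v0 + A *v c\<close>: a cube of high density, which bounds volumes by multiples of
  \<open>1 / M\<close>, and boxes around the superlevel sets, which bound the tail. The density
  itself is not transported; sets are.\<close>

locale normalised_density =
  fixes f :: "real^'d \<Rightarrow> real" and x0 :: "real^'d" and v0 :: "real^'d" and A :: "real^'d^'d" and M :: real
  assumes f: "f \<in> log_concave_densities"
    and M: "0 < M" "f x0 = M" "\<And>x. f x \<le> M"
    and A: "invertible A"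
    and cube: "\<And>c. (\<And>i. 0 \<le> c $ i) \<Longrightarrow> (\<And>i. c $ i \<le> 1 / real CARD('d)) \<Longrightarrow> M * exp (- 1) \<le> f (v0 + A *v c)"
    and box: "\<And>x s. 1 \<le> s \<Longrightarrow> M * exp (- s) \<le> f x \<Longrightarrow> \<exists>c. x = v0 + A *v c \<and> infnorm c \<le> 3 * s"

lemma normalised_density_exists:
  fixes f :: "real^'d \<Rightarrow> real"
  assumes "f \<in> log_concave_densities"
  obtains x0 v0 A M where "normalised_density f x0 v0 A M"
proof -
  note f = log_concave_densitiesD[OF assms(1)]
  obtain x0 where x0: "0 < f x0" "\<And>x. f x \<le> f x0" using density_attains_max[OF assms] by blast
  define L where "L = {x. f x0 * exp (- 1) \<le> f x}"
  have pos: "0 < f x0 * exp (- s)" for s using x0 by simp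
  have Lc: "compact L" "convex L" unfolding L_def
    using density_superlevel_compact[OF assms pos] log_concave_convex_superlevel[OF f(2) pos] by auto
  \<comment> \<open>Some lower level contains a ball, so by
    \<open>superlevel_measure_scaling\<close> the level at depth 1 cannot be null.\<close>
  have Lne: "interior L \<noteq> {}"
  proof
    assume e: "interior L = {}"
    hence L0: "emeasure lborel L = 0" using Lc by (intro convex_closed_empty_interior_null compact_imp_closed)
    obtain b where b: "0 < b" "interior {x. b \<le> f x} \<noteq> {}" using density_superlevel_interior[OF assms] .
    define s where "s = max 1 (ln (f x0 / b))"
    have s: "1 \<le> s" by (simp add: s_def)
    have sub: "{x. b \<le> f x} \<subseteq> {x. f x0 * exp (- s) \<le> f x}"
    proof -
      have "f x0 / b \<le> exp s" using x0 b ln_le_iff[of "f x0 / b" s] by (simp add: s_def)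
      hence "f x0 * exp (- s) \<le> b" using b by (simp add: exp_minus field_simps)
      thus ?thesis by auto
    qed
    obtain z r where z: "0 < r" "ball z r \<subseteq> {x. b \<le> f x}" using b(2) by (meson all_not_in_conv mem_interior)
    have "measure lborel (ball z r) \<le> measure lborel {x. f x0 * exp (- s) \<le> f x}"
      using z(2) sub fmeasurable_compact[OF density_superlevel_compact[OF assms pos[of s]]]
      by (intro measure_mono_fmeasurable) auto
    also have "\<dots> \<le> s ^ DIM(real^'d) * measure lborel L"
      using superlevel_measure_scaling[OF assms x0 s] by (simp add: L_def)
    also have "measure lborel L = 0" using L0 by (simp add: measure_def)
    finally show False using content_ball_pos[OF z(1), of z] by simp
  qed
  obtain v0 and A :: "real^'d^'d" where F: "v0 \<in> L" "invertible A" "\<And>i. v0 + A *v axis i 1 \<in> L"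
    "\<And>x. x \<in> L \<Longrightarrow> \<exists>c. x = v0 + A *v c \<and> infnorm c \<le> 1"
    by (rule max_det_frame[OF Lc(1) Lne]) (rule that)
  have x0L: "x0 \<in> L" using x0 by (simp add: L_def)
  then obtain c0 where c0: "x0 = v0 + A *v c0" "infnorm c0 \<le> 1" using F(4) by blast
  have "normalised_density f x0 v0 A (f x0)"
  proof
    show "f x0 * exp (- 1) \<le> f (v0 + A *v c)" if "\<And>i. 0 \<le> c $ i" "\<And>i. c $ i \<le> 1 / real CARD('d)" for c
      using frame_cube_subset[OF Lc(2) F(1,3) that] by (simp add: L_def)
    show "\<exists>c. x = v0 + A *v c \<and> infnorm c \<le> 3 * s" if s: "1 \<le> s" and fx: "f x0 * exp (- s) \<le> f x" for x s
    proof -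
      define y where "y = (1 - 1/s) *\<^sub>R x0 + (1/s) *\<^sub>R x"
      have "y \<in> L" using superlevel_contraction[OF f(2) x0(1) s fx] by (simp add: L_def y_def)
      then obtain c1 where c1: "y = v0 + A *v c1" "infnorm c1 \<le> 1" using F(4) by blast
      have "s *\<^sub>R y = (s - 1) *\<^sub>R x0 + x" unfolding y_def using s by (simp add: algebra_simps)
      hence "x = s *\<^sub>R y - (s - 1) *\<^sub>R x0" by simp
      also have "\<dots> = v0 + A *v (s *\<^sub>R c1 - (s - 1) *\<^sub>R c0)"
        unfolding c0(1) c1(1) by (simp add: matrix_vector_mult_diff_distrib matrix_vector_mult_scaleR algebra_simps)
      finally have x: "x = v0 + A *v (s *\<^sub>R c1 - (s - 1) *\<^sub>R c0)" .
      have "infnorm (s *\<^sub>R c1 - (s - 1) *\<^sub>R c0) \<le> s * infnorm c1 + (s - 1) * infnorm c0"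
        using infnorm_triangle[of "s *\<^sub>R c1" "- ((s - 1) *\<^sub>R c0)"] s by (simp add: infnorm_neg infnorm_mul)
      \<comment> \<open>\<open>x\<close> is recovered from its contraction \<open>y\<close> and from
        \<open>x0\<close>, both with coordinates at most 1; the total \<open>2 * s - 1\<close> is
        rounded up to \<open>3 * s\<close>.\<close>
      also have "\<dots> \<le> s * 1 + (s - 1) * 1" using c0 c1 s by (intro add_mono mult_left_mono) auto
      also have "\<dots> \<le> 3 * s" using s by simp
      finally show ?thesis using x by blast
    qed
  qed (use assms x0 F in auto)
  thus ?thesis using that by blast
qed

context normalised_density
begin

section \<open>The normalising chart and its boxes\<close>

definition T :: "real^'d \<Rightarrow> real^'d" where "T x = matrix_inv A *v (x - v0)"

lemma T_inverse: "T (v0 + A *v c) = c" "v0 + A *v T x = x"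
  using A by (simp_all add: T_def matrix_vector_mul_assoc matrix_inv_left matrix_inv_right)

lemma T_translate: "T (x + A *v c) = T x + c"
  using A by (simp add: T_def matrix_vector_mul_assoc matrix_inv_left matrix_vector_mult_diff_distrib
     matrix_vector_right_distrib)

lemma T_combination:
  assumes "u + v = 1"
  shows "T (u *\<^sub>R x + v *\<^sub>R y) = u *\<^sub>R T x + v *\<^sub>R T y"
proof -
  have "v0 = u *\<^sub>R v0 + v *\<^sub>R v0" using scaleR_add_left[of u v v0] assms by simp
  hence "u *\<^sub>R x + v *\<^sub>R y - v0 = u *\<^sub>R x + v *\<^sub>R y - (u *\<^sub>R v0 + v *\<^sub>R v0)" by simp
  also have "\<dots> = u *\<^sub>R (x - v0) + v *\<^sub>R (y - v0)" by (simp add: algebra_simps)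
  finally have "u *\<^sub>R x + v *\<^sub>R y - v0 = u *\<^sub>R (x - v0) + v *\<^sub>R (y - v0)" .
  thus ?thesis by (simp add: T_def matrix_vector_right_distrib matrix_vector_mult_scaleR)
qed

lemma continuous_T: "continuous_on S T"
  unfolding T_def by (intro continuous_intros linear_continuous_on_compose[OF _ matrix_vector_mul_linear])

lemma T_vimage_borel: "S \<in> sets borel \<Longrightarrow> T -` S \<in> sets borel"
  using measurable_sets[OF borel_measurable_continuous_onI[OF continuous_T], of S] by simp

lemma T_image: "T ` S = (\<lambda>c. v0 + A *v c) -` S"
proof (intro set_eqI iffI)
  fix c assume "c \<in> (\<lambda>c. v0 + A *v c) -` S"
  thus "c \<in> T ` S" using T_inverse(1)[of c] by (intro image_eqI[of _ _ "v0 + A *v c"]) auto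
qed (auto simp: T_inverse)

lemma T_image_closed: "closed S \<Longrightarrow> closed (T ` S)"
  unfolding T_image by (intro closed_vimage)
    (auto intro!: continuous_intros linear_continuous_on_compose[OF _ matrix_vector_mul_linear])

lemma T_image_convex:
  assumes "convex S"
  shows "convex (T ` S)"
proof (rule convexI)
  fix a b and u v :: real assume "a \<in> T ` S" "b \<in> T ` S" "0 \<le> u" "0 \<le> v" "u + v = 1"
  then obtain x y where xy: "x \<in> S" "a = T x" "y \<in> S" "b = T y" by auto
  have "u *\<^sub>R x + v *\<^sub>R y \<in> S" using assms xy \<open>0 \<le> u\<close> \<open>0 \<le> v\<close> \<open>u + v = 1\<close> by (auto simp: convex_def)
  thus "u *\<^sub>R a + v *\<^sub>R b \<in> T ` S" unfolding xy T_combination[OF \<open>u + v = 1\<close>, symmetric] by (rule imageI)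
qed

abbreviation "P \<equiv> density lborel (\<lambda>x. ennreal (f x))"
abbreviation "Box r \<equiv> {x. infnorm (T x) \<le> r}"

lemma Box_borel: "Box r \<in> sets borel"
proof -
  have "closed {c::real^'d. infnorm c \<le> r}" by (intro closed_Collect_le continuous_intros)
  thus ?thesis using T_vimage_borel[of "{c. infnorm c \<le> r}"] by (simp add: vimage_def)
qed

lemma Box_measure:
  assumes "0 < r"
  shows "Box r \<in> fmeasurable lborel" "M * measure lborel (Box r) \<le> (2 * r * real CARD('d)) ^ CARD('d) * exp 1"
proof -
  let ?L = "{x. M * exp (- 1) \<le> f x}"
  define m where "m = 2 * r * real CARD('d)"
  define w where "w = (v0 - r *\<^sub>R (A *v 1)) - m *\<^sub>R v0"
  have m: "0 < m" unfolding m_def using assms by simp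
  have pos: "0 < M * exp (- 1)" using M by simp
  have Lcomp: "compact ?L" using density_superlevel_compact[OF f pos] .
  have Icomp: "compact ((\<lambda>x. m *\<^sub>R x + w) ` ?L)"
    by (intro compact_continuous_image Lcomp continuous_intros)
  have sub: "Box r \<subseteq> (\<lambda>x. m *\<^sub>R x + w) ` ?L"
  proof
    fix x assume x: "x \<in> Box r"
    define c where "c = (1 / m) *\<^sub>R (T x + r *\<^sub>R 1)"
    have c: "0 \<le> c $ i" "c $ i \<le> 1 / real CARD('d)" for i
    proof -
      have "\<bar>T x $ i\<bar> \<le> r" using x by (auto simp: infnorm_le_cart)
      hence "0 \<le> T x $ i + r" "T x $ i + r \<le> 2 * r" by auto
      thus "0 \<le> c $ i" "c $ i \<le> 1 / real CARD('d)"
        unfolding c_def m_def using assms by (auto simp: field_simps)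
    qed
    have "v0 + A *v c \<in> ?L" using cube[OF c] by simp
    moreover have "m *\<^sub>R (v0 + A *v c) + w = v0 + A *v (m *\<^sub>R c) - r *\<^sub>R (A *v 1)"
      unfolding w_def by (simp add: algebra_simps matrix_vector_mult_scaleR)
    moreover have "m *\<^sub>R c = T x + r *\<^sub>R 1" unfolding c_def using m by simp
    ultimately show "x \<in> (\<lambda>x. m *\<^sub>R x + w) ` ?L"
      using T_inverse(2)[of x]
      by (intro image_eqI[of _ _ "v0 + A *v c"]) (auto simp: matrix_vector_right_distrib matrix_vector_mult_scaleR)
  qed
  have "bounded (Box r)" using bounded_subset[OF compact_imp_bounded[OF Icomp] sub] .
  thus fm: "Box r \<in> fmeasurable lborel" using Box_borel 
    by (auto intro!: fmeasurableI emeasure_bounded_finite)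
  have "measure lborel (Box r) \<le> measure lborel ((\<lambda>x. m *\<^sub>R x + w) ` ?L)"
    using sub Box_borel fmeasurable_compact[OF Icomp] by (intro measure_mono_fmeasurable) auto
  also have "\<dots> = measure lebesgue ((\<lambda>x. m *\<^sub>R x + w) ` ?L)" using compact_imp_closed[OF Icomp] by simp
  also have "\<dots> = m ^ CARD('d) * measure lebesgue ?L"
    using measure_lebesgue_affine[of m w ?L] m by (simp add: add.commute)
  also have "measure lebesgue ?L = measure lborel ?L" using compact_imp_closed[OF Lcomp] by simp
  also have "m ^ CARD('d) * measure lborel ?L \<le> m ^ CARD('d) * (1 / (M * exp (- 1)))"
    using density_superlevel_measure(1)[OF f pos] m by (intro mult_left_mono) auto
  finally show "M * measure lborel (Box r) \<le> (2 * r * real CARD('d)) ^ CARD('d) * exp 1"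
    unfolding m_def[symmetric] using M by (simp add: exp_minus field_simps)
qed

lemma Box_prob:
  assumes "3 \<le> R"
  shows "measure P (- Box R) \<le> exp (- R / 6) * sqrt_bound CARD('d)"
proof -
  interpret P: prob_space P using density_prob_space[OF f] .
  note [measurable] = log_concave_densitiesD(4)[OF f]
  have "- Box R \<subseteq> {x. f x < f x0 * exp (- (R / 3))}"
  proof (rule subsetI, rule ccontr)
    fix x assume x: "x \<in> - Box R" "x \<notin> {x. f x < f x0 * exp (- (R / 3))}"
    hence "M * exp (- (R / 3)) \<le> f x" using M by simp
    then obtain c where "x = v0 + A *v c" "infnorm c \<le> 3 * (R / 3)" using box[of "R / 3" x] assms by auto
    thus False using x T_inverse(1) by auto
  qed
  hence "measure P (- Box R) \<le> measure P {x. f x < f x0 * exp (- (R / 3))}"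
    by (intro P.finite_measure_mono) auto
  also have "\<dots> \<le> exp (- (R / 3) / 2) * sqrt_bound DIM(real^'d)"
    using M by (intro density_tail[OF f]) auto
  finally show ?thesis by simp
qed

text \<open>The translates of the set of points that leave the convex set \<open>E\<close> by the step \<open>w\<close> along
  multiples of \<open>w\<close> are disjoint, so its volume is at most a small fraction of that of a box.\<close>

lemma exit_set_measure:
  fixes E :: "(real^'d) set"
  assumes E: "closed E" "convex E" "\<And>x. x \<in> E \<Longrightarrow> infnorm x \<le> 2 * R" and R: "0 < R"
    and w: "real K * infnorm w \<le> R" "0 < K"
  defines "D \<equiv> {x. T x \<in> E \<and> T x + w \<notin> E}"
  shows "D \<in> fmeasurable lborel" "M * measure lborel D \<le> (6 * R * real CARD('d)) ^ CARD('d) * exp 1 / real K"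
proof -
  have R3: "0 < 3 * R" using R by simp
  have "closed ((\<lambda>c. c + w) -` E)" using E(1) by (intro closed_vimage) (auto intro!: continuous_intros)
  hence "E - (\<lambda>c. c + w) -` E \<in> sets borel" using E(1) by auto
  moreover have "D = T -` (E - (\<lambda>c. c + w) -` E)" by (auto simp: D_def)
  ultimately have Db: "D \<in> sets borel" using T_vimage_borel by simp
  define S where "S k = (\<lambda>x. x + real k *\<^sub>R (A *v w)) ` D" for k
  have S: "S k \<in> sets borel" "measure lborel (S k) = measure lborel D" for k
    unfolding S_def using measure_translate_image[OF Db] by auto
  have Tk: "T (x + real k *\<^sub>R (A *v w)) = T x + real k *\<^sub>R w" for x k
    using T_translate[of x "real k *\<^sub>R w"] by (simp add: matrix_vector_mult_scaleR)
  \<comment> \<open>Fewer than \<open>K\<close> steps move a point of \<open>E\<close> by at most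
    \<open>R\<close>, from the box of radius \<open>2 * R\<close> into that of radius
    \<open>3 * R\<close>.\<close>
  have sub: "S k \<subseteq> Box (3 * R)" if k: "k < K" for k
  proof
    fix y assume "y \<in> S k"
    then obtain x where x: "x \<in> D" "y = x + real k *\<^sub>R (A *v w)" by (auto simp: S_def)
    have "infnorm (T y) \<le> infnorm (T x) + real k * infnorm w"
      using infnorm_triangle[of "T x" "real k *\<^sub>R w"] unfolding x Tk by (simp add: infnorm_mul)
    also have "real k * infnorm w \<le> real K * infnorm w" using k infnorm_pos_le by (intro mult_right_mono) auto
    finally show "y \<in> Box (3 * R)" using w E(3)[of "T x"] x(1) unfolding D_def by auto
  qed
  have "D = S 0" by (simp add: S_def)
  hence D_sub: "D \<subseteq> Box (3 * R)" using sub[of 0] w by auto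
  show "D \<in> fmeasurable lborel" using fmeasurableI2[OF Box_measure(1)[OF R3] D_sub] Db by simp
  have Sfm: "S k \<in> fmeasurable lborel" if "k < K" for k
    using fmeasurableI2[OF Box_measure(1)[OF R3] sub[OF that]] S(1) by simp
  have disj: "disjoint_family_on S {..<K}"
    unfolding disjoint_family_on_def
  proof (intro ballI impI)
    fix j k assume jk: "j \<in> {..<K}" "k \<in> {..<K}" "j \<noteq> k"
    show "S j \<inter> S k = {}"
    proof (rule ccontr)
      assume "S j \<inter> S k \<noteq> {}"
      then obtain x x' where x: "x \<in> D" "x' \<in> D" "x + real k *\<^sub>R (A *v w) = x' + real j *\<^sub>R (A *v w)"
        by (auto simp: S_def) metis
      hence "T x + real k *\<^sub>R w = T x' + real j *\<^sub>R w" using Tk by metis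
      thus False using convex_exit_translates_disjoint[OF E(2), of "T x" w "T x'" k j] x jk by (auto simp: D_def)
    qed
  qed
  have "real K * measure lborel D = (\<Sum>k<K. measure lborel (S k))" by (simp add: S)
  also have "\<dots> = measure lborel (\<Union>k<K. S k)"
    using disj S Sfm by (intro measure_finite_Union[symmetric]) (auto dest!: fmeasurableD2)
  also have "\<dots> \<le> measure lborel (Box (3 * R))"
    using sub S Box_measure(1)[OF R3] by (intro measure_mono_fmeasurable) auto
  finally have "real K * measure lborel D \<le> measure lborel (Box (3 * R))" .
  hence "M * (real K * measure lborel D) \<le> M * measure lborel (Box (3 * R))" using M by simp
  also have "\<dots> \<le> (6 * R * real CARD('d)) ^ CARD('d) * exp 1" using Box_measure(2)[OF R3] by simp
  finally show "M * measure lborel D \<le> (6 * R * real CARD('d)) ^ CARD('d) * exp 1 / real K"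
    using w by (simp add: field_simps)
qed

end

text \<open>The form of a Minkowski sum lets compactness and convexity pass from \<open>C\<close> by
  the rules for sums of sets.\<close>

definition nbhd :: "'a::euclidean_space set \<Rightarrow> real \<Rightarrow> 'a set" where
  "nbhd C t = {x + y |x y. x \<in> C \<and> y \<in> cball 0 t}"

lemma nbhd_iff: "z \<in> nbhd C t \<longleftrightarrow> (\<exists>c\<in>C. dist z c \<le> t)"
proof
  assume "z \<in> nbhd C t"
  then obtain x y where "z = x + y" "x \<in> C" "norm y \<le> t" by (auto simp: nbhd_def)
  thus "\<exists>c\<in>C. dist z c \<le> t" by (intro bexI[of _ x]) (auto simp: dist_norm)
next
  assume "\<exists>c\<in>C. dist z c \<le> t"
  then obtain c where "c \<in> C" "dist z c \<le> t" by auto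
  hence "z = c + (z - c)" "z - c \<in> cball 0 t" by (auto simp: dist_norm norm_minus_commute)
  thus "z \<in> nbhd C t" using \<open>c \<in> C\<close> unfolding nbhd_def by blast
qed

lemma nbhd_compact: "compact C \<Longrightarrow> compact (nbhd C t)"
  unfolding nbhd_def by (intro compact_sums) auto

lemma nbhd_convex: "convex C \<Longrightarrow> convex (nbhd C t)"
proof -
  assume "convex C"
  hence "convex (\<Union>x\<in>C. \<Union>y\<in>cball 0 t. {x + y})" by (intro convex_sums convex_cball)
  moreover have "(\<Union>x\<in>C. \<Union>y\<in>cball 0 t. {x + y}) = nbhd C t" unfolding nbhd_def by blast
  ultimately show ?thesis by simp
qed

lemma infnorm_axis_le: "\<bar>a\<bar> \<le> s \<Longrightarrow> infnorm (axis i a :: real^'d) \<le> s"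
  by (auto simp: infnorm_le_cart axis_def)

lemma good_body_compact: "good_body R C \<Longrightarrow> compact C"
proof -
  assume C: "good_body R C"
  have "norm x \<le> real CARD('a) * R" if "x \<in> C" for x
  proof -
    have "real CARD('a) * infnorm x \<le> real CARD('a) * R"
      using C that by (intro mult_left_mono) (auto simp: good_body_def)
    thus ?thesis using norm_le_card_infnorm[of x] by linarith
  qed
  hence "bounded C" by (auto simp: bounded_iff)
  thus ?thesis using C by (simp add: good_body_def compact_eq_bounded_closed)
qed

text \<open>Solves \<open>exp (- R / 6) * sqrt_bound d = \<delta> / 2\<close> for \<open>R\<close>:
  the tail bound of \<open>Box_prob\<close> is given half of \<open>\<delta>\<close>.\<close>

definition box_radius :: "nat \<Rightarrow> real \<Rightarrow> real" where
  "box_radius d \<delta> = 6 * ln (2 * sqrt_bound d / \<delta>)"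

text \<open>Makes the bound of \<open>shell_prob\<close> equal to \<open>\<delta> / (2 * R)\<close>
  for \<open>R = box_radius d \<delta>\<close>, hence at most the other half of
  \<open>\<delta>\<close> once \<open>R \<ge> 1\<close>.\<close>

definition net_scale :: "nat \<Rightarrow> real \<Rightarrow> real" where
  "net_scale d \<delta> = \<delta> / (16 * exp 1 * real d ^ 2 * (6 * box_radius d \<delta> * real d) ^ d)"

definition cover_entropy :: "nat \<Rightarrow> real \<Rightarrow> real" where
  "cover_entropy d \<delta> = net_entropy d (box_radius d \<delta>) (net_scale d \<delta>)"

context normalised_density
begin

text \<open>Each point of the shell leaves the neighbourhood by one of the \<open>2 * d\<close> axis
  steps of length \<open>s\<close>, so \<open>2 * d\<close> exit sets cover the shell. The volume of
  each is of order \<open>s / R\<close> times the bound for a box, whatever the shape of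
  \<open>C\<close>.\<close>

lemma shell_prob:
  assumes C: "good_body R C" and t: "0 < t" "4 * t * real CARD('d) \<le> R"
  shows "measure P (T -` (nbhd C (2 * t) - C)) \<le> 8 * exp 1 * real CARD('d) ^ 2 * (6 * R * real CARD('d)) ^ CARD('d) * t / R"
proof -
  define d where "d = real CARD('d)"
  have d: "1 \<le> d" unfolding d_def by (simp add: Suc_leI)
  define s where "s = 2 * t * d"
  have s: "0 < s" using t d by (simp add: s_def)
  have R: "0 < R" "2 * s \<le> R" using t d 
  proof -
    have "2 * s \<le> R" using t by (simp add: s_def d_def)
    thus "0 < R" "2 * s \<le> R" using s by linarith+
  qed
  have "t \<le> t * d" using t d by simp
  hence tR: "2 * t \<le> R" using t unfolding d_def[symmetric] by linarith
  let ?E = "nbhd C (2 * t)"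
  note Cp = good_body_compact[OF C]
  have E: "closed ?E" "convex ?E" using nbhd_compact[OF Cp] nbhd_convex C by (auto simp: good_body_def compact_imp_closed)
  have EB: "infnorm x \<le> 2 * R" if "x \<in> ?E" for x
  proof -
    obtain c where c: "c \<in> C" "dist x c \<le> 2 * t" using \<open>x \<in> ?E\<close> nbhd_iff by blast
    have "infnorm x \<le> infnorm (x - c) + infnorm c" using infnorm_triangle[of "x - c" c] by simp
    also have "\<dots> \<le> 2 * t + R" using c C infnorm_le_norm[of "x - c"] by (intro add_mono) (auto simp: dist_norm good_body_def)
    finally show ?thesis using tR by simp
  qed
  \<comment> \<open>The largest number of steps with \<open>K * s \<le> R\<close>; as
    \<open>R / s \<ge> 2\<close>, rounding down costs at most a factor 2.\<close>
  define K where "K = nat \<lfloor>R / s\<rfloor>"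
  have Rs: "2 \<le> R / s" using R s by (simp add: field_simps)
  have "real K = of_int \<lfloor>R / s\<rfloor>" unfolding K_def using Rs by simp
  hence K1: "real K \<le> R / s" "R / s - 1 \<le> real K" by linarith+
  hence K: "0 < K" "real K * s \<le> R" "R / (2 * s) \<le> real K"
    using Rs s by (auto simp: field_simps intro: Nat.gr0I)
  define W where "W = (\<lambda>(i, \<sigma>). axis i (s * \<sigma>)) ` ((UNIV :: 'd set) \<times> {1, -1 :: real})"
  have finW: "finite W" unfolding W_def by auto
  have cardW: "real (card W) \<le> 2 * d"
  proof -
    have "card W \<le> card ((UNIV :: 'd set) \<times> {1, -1 :: real})" unfolding W_def by (intro card_image_le) auto
    also have "\<dots> = CARD('d) * 2" by (simp add: card_cartesian_product)
    finally show ?thesis by (simp add: d_def)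
  qed
  define D where "D w = {x. T x \<in> ?E \<and> T x + w \<notin> ?E}" for w
  define b where "b = (6 * R * d) ^ CARD('d) * exp 1 / real K"
  have b0: "0 \<le> b" using R d by (simp add: b_def)
  have DW: "D w \<in> fmeasurable lborel" "M * measure lborel (D w) \<le> b" if w: "w \<in> W" for w
  proof -
    have "infnorm w \<le> s" using w s unfolding W_def by (auto intro!: infnorm_axis_le simp: abs_mult)
    hence "real K * infnorm w \<le> real K * s" by (intro mult_left_mono) auto
    hence "real K * infnorm w \<le> R" using K by linarith
    note ex = exit_set_measure[OF E EB R(1) this K(1)]
    show "D w \<in> fmeasurable lborel" "M * measure lborel (D w) \<le> b"
      using ex unfolding D_def b_def d_def by simp_all
  qed
  have sub: "T -` (?E - C) \<subseteq> (\<Union>w\<in>W. D w)"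
  proof
    fix x assume x: "x \<in> T -` (?E - C)"
    have "closed C" "convex C" "C \<noteq> {}" "T x \<notin> C" using x C by (auto simp: good_body_def)
    then obtain i \<sigma> where i: "\<sigma> \<in> {1, -1}" "\<And>c. c \<in> C \<Longrightarrow> 2 * t < dist (T x + axis i (s * \<sigma>)) c"
      by (rule outer_shell_step[of C "T x" t s]) (use s t in \<open>auto simp: s_def d_def\<close>)
    have "axis i (s * \<sigma>) \<in> W" unfolding W_def using i(1) by (intro image_eqI[of _ _ "(i, \<sigma>)"]) auto
    moreover have "T x + axis i (s * \<sigma>) \<notin> ?E" using i(2) by (force simp: nbhd_iff not_le)
    ultimately show "x \<in> (\<Union>w\<in>W. D w)" using x unfolding D_def by blast
  qed
  have UD: "(\<Union>w\<in>W. D w) \<in> fmeasurable lborel" using DW finW by (intro fmeasurable.finite_UN) auto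
  have Sb: "T -` (?E - C) \<in> sets borel" using E C by (intro T_vimage_borel) (auto simp: good_body_def)
  have "measure P (T -` (?E - C)) \<le> M * measure lborel (T -` (?E - C))"
    using Sb fmeasurableI2[OF UD sub] by (intro density_prob_le[OF f M(3)]) auto
  also have "\<dots> \<le> M * measure lborel (\<Union>w\<in>W. D w)"
    using M sub UD Sb by (intro mult_left_mono measure_mono_fmeasurable) auto
  also have "\<dots> \<le> M * (\<Sum>w\<in>W. measure lborel (D w))"
    using M finW fmeasurableD[OF DW(1)] by (intro mult_left_mono measure_UNION_le) auto
  also have "\<dots> = (\<Sum>w\<in>W. M * measure lborel (D w))" by (simp add: sum_distrib_left)
  also have "\<dots> \<le> real (card W) * b" using sum_bounded_above[of W "\<lambda>w. M * measure lborel (D w)" b] DW(2) by simp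
  also have "\<dots> \<le> 2 * d * b" using cardW b0 by (intro mult_right_mono) auto
  also have "\<dots> \<le> 2 * d * ((6 * R * d) ^ CARD('d) * exp 1 / (R / (2 * s)))"
    unfolding b_def using K R d s by (intro mult_left_mono divide_left_mono) auto
  also have "\<dots> = 8 * exp 1 * d ^ 2 * (6 * R * d) ^ CARD('d) * t / R"
    unfolding s_def using R t d by (simp add: field_simps power2_eq_square)
  finally show ?thesis by (simp add: d_def)
qed

text \<open>The excess of a member over \<open>C\<close> lies outside the box or in the
  \<open>2 * t\<close> shell of the part of \<open>C\<close> inside it: one \<open>t\<close> from
  \<open>C\<close> to the net, one from the enlargement. The exterior of the box belongs to every
  member because \<open>C\<close> may be unbounded; on its own it serves the sets that miss the box,
  hence the 1 in the cardinality.\<close>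

lemma convex_upper_cover:
  fixes \<delta> :: real
  assumes "0 < \<delta>" "\<delta> \<le> 1"
  obtains \<A> where "finite \<A>" "\<A> \<subseteq> sets borel" "real (card \<A>) \<le> 1 + exp (cover_entropy CARD('d) \<delta>)"
    "\<And>C. closed C \<Longrightarrow> convex C \<Longrightarrow> \<exists>S\<in>\<A>. C \<subseteq> S \<and> measure P S \<le> measure P C + \<delta>"
proof -
  interpret P: prob_space P using density_prob_space[OF f] .
  define R t where "R = box_radius CARD('d) \<delta>" and "t = net_scale CARD('d) \<delta>"
  define d where "d = real CARD('d)"
  have d: "1 \<le> d" unfolding d_def by (simp add: Suc_leI)
  define B where "B = sqrt_bound CARD('d)"
  have B: "1 \<le> B" unfolding B_def by (rule sqrt_bound_ge_1)
  have "2 \<le> 2 * B / \<delta>" using B assms(1,2) by (simp add: field_simps)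
  hence "ln 2 \<le> ln (2 * B / \<delta>)" by (subst ln_le_cancel_iff) auto
  hence R: "3 \<le> R" unfolding R_def box_radius_def B_def using ln2_ge_two_thirds by simp
  define Q where "Q = 16 * exp 1 * d ^ 2 * (6 * R * d) ^ CARD('d)"
  have "1 \<le> 6 * R * d" using mult_mono[of 1 "6 * R" 1 d] R d by simp
  hence pw: "1 \<le> (6 * R * d) ^ CARD('d)" by (rule one_le_power)
  have d2: "d \<le> d ^ 2" using d by (simp add: power2_eq_square)
  have "16 * 1 * d * 1 \<le> Q" unfolding Q_def using d d2 pw by (intro mult_mono) auto
  hence Q: "16 * d \<le> Q" "1 \<le> Q" "0 < Q" using d by auto
  have tQ: "t = \<delta> / Q" by (simp add: t_def net_scale_def R_def Q_def d_def)
  have t: "0 < t" "4 * t * d \<le> 1"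
  proof -
    show "0 < t" using tQ Q assms(1,2) by simp
    have "4 * \<delta> * d \<le> 4 * 1 * d" using assms(1,2) d by (intro mult_right_mono mult_left_mono) auto
    hence "4 * \<delta> * d \<le> Q" using Q d by linarith
    hence "4 * \<delta> * d / Q \<le> 1" using Q by simp
    thus "4 * t * d \<le> 1" unfolding tQ by simp
  qed
  have "t \<le> 4 * t * d" using t d by simp
  hence tR: "t \<le> R" "4 * t * d \<le> R" "0 < R" using t R by linarith+
  obtain F where F: "finite F" "real (card F) \<le> exp (net_entropy CARD('d) R t)"
    "\<And>C. C \<in> F \<Longrightarrow> good_body R C"
    "\<And>C. good_body R C \<Longrightarrow> \<exists>D\<in>F. (\<forall>x\<in>C. \<exists>y\<in>D. dist x y \<le> t) \<and> (\<forall>x\<in>D. \<exists>y\<in>(C::(real^'d) set). dist x y \<le> t)"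
    by (rule convex_body_net[where 'd='d, OF tR(3) t(1) tR(1)]) (rule that)
  define \<A> where "\<A> = insert (- Box R) ((\<lambda>D. T -` nbhd D t \<union> - Box R) ` F)"
  have Bx: "- Box R \<in> sets borel" using Box_borel by auto
  have nb: "T -` nbhd D t \<in> sets borel" if "D \<in> F" for D
    using F(3)[OF that] by (intro T_vimage_borel) (intro borel_closed compact_imp_closed nbhd_compact good_body_compact)
  have out: "measure P (- Box R) \<le> \<delta> / 2"
  proof -
    have "exp (- R / 6) = \<delta> / (2 * B)" unfolding R_def box_radius_def B_def[symmetric] using B assms(1,2) by (simp add: exp_minus)
    thus ?thesis using Box_prob[OF R] B unfolding B_def by simp
  qed
  show ?thesis
  proof (rule that[of \<A>])
    show "finite \<A>" using F by (simp add: \<A>_def)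
    show "\<A> \<subseteq> sets borel" using Bx nb by (auto simp: \<A>_def)
    have "card \<A> \<le> Suc (card ((\<lambda>D. T -` nbhd D t \<union> - Box R) ` F))" unfolding \<A>_def by (rule card_insert_le_m1) auto
    also have "\<dots> \<le> Suc (card F)" using F(1) by (simp add: card_image_le)
    finally show "real (card \<A>) \<le> 1 + exp (cover_entropy CARD('d) \<delta>)"
      using F(2) unfolding cover_entropy_def R_def t_def by linarith
    fix C :: "(real^'d) set" assume C: "closed C" "convex C"
    define C1 where "C1 = T ` C \<inter> {c. infnorm c \<le> R}"
    have cb: "closed {c::real^'d. infnorm c \<le> R}" by (intro closed_Collect_le continuous_intros)
    have vb: "convex {c::real^'d. infnorm c \<le> R}"
    proof (rule convexI)
      fix x y :: "real^'d" and u v :: real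
      assume *: "x \<in> {c. infnorm c \<le> R}" "y \<in> {c. infnorm c \<le> R}" "0 \<le> u" "0 \<le> v" "u + v = 1"
      have "infnorm (u *\<^sub>R x + v *\<^sub>R y) \<le> u * infnorm x + v * infnorm y"
        using infnorm_triangle[of "u *\<^sub>R x" "v *\<^sub>R y"] * by (simp add: infnorm_mul)
      also have "\<dots> \<le> u * R + v * R" using * by (intro add_mono mult_left_mono) auto
      also have "\<dots> = R" using *(5) by (simp flip: distrib_right)
      finally show "u *\<^sub>R x + v *\<^sub>R y \<in> {c. infnorm c \<le> R}" by simp
    qed
    have C1: "closed C1" "convex C1" "\<And>x. x \<in> C1 \<Longrightarrow> infnorm x \<le> R"
      unfolding C1_def using C cb vb by (auto intro!: closed_Int convex_Int T_image_closed T_image_convex)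
    show "\<exists>S\<in>\<A>. C \<subseteq> S \<and> measure P S \<le> measure P C + \<delta>"
    proof (cases "C1 = {}")
      case True
      hence "C \<subseteq> - Box R" unfolding C1_def by blast
      moreover have "measure P (- Box R) \<le> measure P C + \<delta>" using out measure_nonneg[of P C] assms(1) by linarith
      ultimately show ?thesis unfolding \<A>_def by blast
    next
      case False
      hence gC: "good_body R C1" using C1 by (auto simp: good_body_def)
      then obtain D where D: "D \<in> F" "\<forall>x\<in>C1. \<exists>y\<in>D. dist x y \<le> t" "\<forall>x\<in>D. \<exists>y\<in>C1. dist x y \<le> t"
        using F(4) by blast
      let ?S = "T -` nbhd D t \<union> - Box R"
      have "C \<subseteq> ?S"
      proof
        fix x assume "x \<in> C"
        hence "T x \<in> C1" if "infnorm (T x) \<le> R" using that by (simp add: C1_def)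
        thus "x \<in> ?S" using D(2) nbhd_iff[of "T x" D t] by (cases "infnorm (T x) \<le> R") auto
      qed
      moreover have "measure P ?S \<le> measure P C + \<delta>"
      proof -
        let ?E = "T -` (nbhd C1 (2 * t) - C1)"
        have Eb: "?E \<in> sets borel" using nbhd_compact[OF good_body_compact[OF gC], of "2 * t"] C1
          by (intro T_vimage_borel sets.Diff borel_closed) (auto simp: compact_imp_closed)
        have "?S \<subseteq> (C \<union> ?E) \<union> - Box R"
        proof
          fix x assume x: "x \<in> ?S"
          show "x \<in> (C \<union> ?E) \<union> - Box R"
          proof (cases "x \<in> Box R")
            case True
            then obtain y where y: "y \<in> D" "dist (T x) y \<le> t" using x nbhd_iff[of "T x" D t] by blast
            then obtain c where c: "c \<in> C1" "dist y c \<le> t" using D(3) by blast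
            have "dist (T x) c \<le> 2 * t" using y c dist_triangle[of "T x" c y] by linarith
            hence "T x \<in> nbhd C1 (2 * t)" using c nbhd_iff by blast
            moreover have "x \<in> C" if "T x \<in> C1"
            proof -
              from that obtain z where "z \<in> C" "T x = T z" by (auto simp: C1_def)
              thus ?thesis by (metis T_inverse(2))
            qed
            ultimately show ?thesis by blast
          qed blast
        qed
        hence "measure P ?S \<le> measure P ((C \<union> ?E) \<union> - Box R)"
          using C Eb Bx by (intro P.finite_measure_mono) auto
        also have "\<dots> \<le> measure P (C \<union> ?E) + measure P (- Box R)"
          using C Eb Bx by (intro measure_Un_le) auto
        also have "measure P (C \<union> ?E) \<le> measure P C + measure P ?E"
          using C Eb by (intro measure_Un_le) auto
        also have "measure P ?E \<le> 8 * exp 1 * d ^ 2 * (6 * R * d) ^ CARD('d) * t / R"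
          using shell_prob[OF gC t(1)] tR by (simp add: d_def)
        also have "\<dots> = Q * t / 2 / R" by (simp add: Q_def)
        also have "\<dots> = \<delta> / 2 / R" using tQ Q by simp
        also have "\<dots> \<le> \<delta> / 2" using R assms(1,2) by (simp add: field_simps)
        finally show ?thesis using out by simp
      qed
      ultimately show ?thesis using D(1) unfolding \<A>_def by blast
    qed
  qed
qed

end

section \<open>Independent samples\<close>

locale iid = prob_space P for P :: "'a::euclidean_space measure" +
  fixes n :: nat
  assumes sets_P [measurable_cong]: "sets P = sets borel"
begin

definition S :: "(nat \<Rightarrow> 'a) measure" where "S = (\<Pi>\<^sub>M i\<in>{..<n}. P)"

lemma prob_space_S: "prob_space S"
  unfolding S_def by (intro prob_space_PiM) (rule prob_space_axioms)

lemma distr_component: "i < n \<Longrightarrow> distr S P (\<lambda>X. X i) = P"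
  unfolding S_def by (intro distr_PiM_component) (rule prob_space_axioms, simp)

lemma component_measurable: "i < n \<Longrightarrow> (\<lambda>X. X i) \<in> measurable S P"
  unfolding S_def by (intro measurable_component_singleton) auto

lemma measurable_P: "g \<in> measurable borel N \<Longrightarrow> g \<in> measurable P N"
  by (subst measurable_cong_sets[OF sets_P refl])

lemma component_measurable_compose:
  "i < n \<Longrightarrow> g \<in> borel_measurable borel \<Longrightarrow> (\<lambda>X. g (X i)) \<in> borel_measurable S"
  by (rule measurable_compose[OF component_measurable measurable_P])

lemma component_integral:
  fixes g :: "'a \<Rightarrow> real"
  assumes "i < n" "g \<in> borel_measurable borel"
  shows "(\<integral>X. g (X i) \<partial>S) = (\<integral>x. g x \<partial>P)"
    "integrable S (\<lambda>X. g (X i)) \<longleftrightarrow> integrable P g"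
proof -
  have g: "g \<in> borel_measurable P" using measurable_P assms by blast
  show "(\<integral>X. g (X i) \<partial>S) = (\<integral>x. g x \<partial>P)"
    using integral_distr[OF component_measurable[OF assms(1)] g] distr_component[OF assms(1)] by simp
  show "integrable S (\<lambda>X. g (X i)) \<longleftrightarrow> integrable P g"
    using integrable_distr_eq[OF component_measurable[OF assms(1)] g] distr_component[OF assms(1)] by simp
qed

lemma indep_components:
  assumes "0 < n"
  shows "prob_space.indep_vars S (\<lambda>_. P) (\<lambda>i X. X i) {..<n}"
proof -
  interpret S: prob_space S by (rule prob_space_S)
  have "distr S (\<Pi>\<^sub>M i\<in>{..<n}. P) (\<lambda>X. \<lambda>i\<in>{..<n}. X i) = distr S S (\<lambda>X. X)"
    by (intro distr_cong) (auto simp: S_def space_PiM PiE_def extensional_restrict)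
  also have "\<dots> = (\<Pi>\<^sub>M i\<in>{..<n}. P)" by (simp add: distr_id S_def)
  also have "\<dots> = (\<Pi>\<^sub>M i\<in>{..<n}. distr S P (\<lambda>X. X i))"
    by (intro PiM_cong) (simp_all add: distr_component)
  finally show ?thesis
    using assms by (subst S.indep_vars_iff_distr_eq_PiM') (auto intro: component_measurable)
qed

lemma indep_compose:
  assumes "0 < n" "g \<in> borel_measurable borel"
  shows "prob_space.indep_vars S (\<lambda>_. borel) (\<lambda>i X. g (X i)) {..<n}"
proof -
  interpret S: prob_space S by (rule prob_space_S)
  show ?thesis
    using measurable_P[OF assms(2)] by (intro S.indep_vars_compose2[OF indep_components[OF assms(1)]])
qed

lemma hoeffding_event:
  assumes n: "0 < n" and A: "A \<in> sets borel" and \<delta>: "0 \<le> \<delta>"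
  shows "measure S {X \<in> space S. real n * measure P A + real n * \<delta> \<le> (\<Sum>i<n. indicator A (X i))} \<le> exp (- 2 * real n * \<delta>\<^sup>2)"
proof -
  interpret S: prob_space S by (rule prob_space_S)
  have A': "(indicator A :: 'a \<Rightarrow> real) \<in> borel_measurable borel" using A by simp
  interpret Hoeffding_ineq S "{..<n}" "\<lambda>i X. indicator A (X i)" "\<lambda>_. 0" "\<lambda>_. 1"
    "\<Sum>i<n. S.expectation (\<lambda>X. indicator A (X i))"
    by unfold_locales (use indep_compose[OF n A'] in \<open>auto simp: indicator_def\<close>)
  have "(\<integral>x. indicator A x \<partial>P) = measure P A" using A sets_P by simp
  hence "(\<Sum>i<n. S.expectation (\<lambda>X. indicator A (X i))) = real n * measure P A"
    by (simp add: component_integral(1)[OF _ A'])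
  moreover have "- 2 * (real n * \<delta>)\<^sup>2 / real n = - 2 * real n * \<delta>\<^sup>2"
    using n by (simp add: power2_eq_square)
  ultimately show ?thesis using Hoeffding_ineq_ge[of "real n * \<delta>"] n \<delta> by simp
qed

text \<open>The intended function is \<open>ln (M / f0)\<close>, which may be unbounded, so
  Hoeffding's inequality does not apply to it; for a single function at constant probability a
  second moment is enough.\<close>

lemma chebyshev_event:
  fixes g :: "'a \<Rightarrow> real"
  assumes n: "0 < n" and g: "g \<in> borel_measurable borel" "integrable P (\<lambda>x. (g x)\<^sup>2)"
    and v: "(\<integral>x. (g x)\<^sup>2 \<partial>P) \<le> v" and \<epsilon>: "0 < \<epsilon>"
  defines "m \<equiv> (\<integral>x. g x \<partial>P)"
  shows "measure S {X \<in> space S. real n * m + real n * \<epsilon> \<le> (\<Sum>i<n. g (X i))} \<le> v / (real n * \<epsilon>\<^sup>2)"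
proof -
  interpret S: prob_space S by (rule prob_space_S)
  have gP: "g \<in> borel_measurable P" using measurable_P g by blast
  have gi: "integrable P g" using g(2) gP square_integrable_imp_integrable by blast
  define h where "h x = g x - m" for x
  have h_eq: "h = (\<lambda>x. g x - m)" by (simp add: h_def fun_eq_iff)
  have h: "h \<in> borel_measurable borel" using g(1) by (simp add: h_eq)
  have hi: "integrable P h" "(\<integral>x. h x \<partial>P) = 0" using gi by (auto simp: h_eq m_def prob_space)
  have h2: "(\<lambda>x. (h x)\<^sup>2) = (\<lambda>x. (g x)\<^sup>2 - 2 * m * g x + m\<^sup>2)" by (auto simp: h_def power2_eq_square algebra_simps)
  have h2i: "integrable P (\<lambda>x. (h x)\<^sup>2)" unfolding h2 using gi g(2) by simp
  have "(\<integral>x. (h x)\<^sup>2 \<partial>P) = (\<integral>x. (g x)\<^sup>2 \<partial>P) - m\<^sup>2"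
    unfolding h2 using gi g(2) by (simp add: m_def prob_space power2_eq_square)
  hence h2v: "(\<integral>x. (h x)\<^sup>2 \<partial>P) \<le> v" using v zero_le_power2[of m] by linarith
  have cross: "integrable S (\<lambda>X. h (X i) * h (X j)) \<and> (\<integral>X. h (X i) * h (X j) \<partial>S) = 0" if "i < n" "j < n" "i \<noteq> j" for i j
  proof -
    have iv: "S.indep_vars (\<lambda>_. borel) (\<lambda>i X. h (X i)) {i, j}"
      using S.indep_vars_subset[OF indep_compose[OF n h], of "{i, j}"] that by simp
    have it: "integrable S (\<lambda>X. h (X k))" if "k \<in> {i, j}" for k
      using component_integral(2)[OF _ h] hi that \<open>i < n\<close> \<open>j < n\<close> by auto
    show ?thesis
      using S.indep_vars_integrable[OF _ iv it] S.indep_vars_lebesgue_integral[OF _ iv it]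
        component_integral(1)[OF that(1) h] hi(2) that(3) by simp
  qed
  have diag: "integrable S (\<lambda>X. h (X i) * h (X i))" "(\<integral>X. h (X i) * h (X i) \<partial>S) \<le> v" if "i < n" for i
    using component_integral[OF that, of "\<lambda>x. h x * h x"] h h2i h2v by (simp_all add: power2_eq_square)
  have int: "integrable S (\<lambda>X. h (X i) * h (X j))" if "i < n" "j < n" for i j
    using cross diag that by (cases "i = j") auto
  have sq: "(\<lambda>X. (\<Sum>i<n. h (X i))\<^sup>2) = (\<lambda>X. \<Sum>i<n. \<Sum>j<n. h (X i) * h (X j))"
    by (simp add: power2_eq_square sum_product)
  have I: "integrable S (\<lambda>X. (\<Sum>i<n. h (X i))\<^sup>2)" unfolding sq using int by (intro Bochner_Integration.integrable_sum) auto
  have "(\<integral>X. (\<Sum>i<n. h (X i))\<^sup>2 \<partial>S) = (\<Sum>i<n. \<integral>X. (\<Sum>j<n. h (X i) * h (X j)) \<partial>S)"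
    unfolding sq using int by (intro Bochner_Integration.integral_sum Bochner_Integration.integrable_sum) auto
  also have "\<dots> = (\<Sum>i<n. \<Sum>j<n. \<integral>X. h (X i) * h (X j) \<partial>S)"
    using int by (intro sum.cong Bochner_Integration.integral_sum) auto
  also have "\<dots> \<le> (\<Sum>i<n. \<Sum>j<n. if i = j then v else 0)"
    using cross diag by (intro sum_mono) auto
  also have "\<dots> = real n * v" by simp
  finally have bd: "(\<integral>X. (\<Sum>i<n. h (X i))\<^sup>2 \<partial>S) \<le> real n * v" .
  have ne: "0 < (real n * \<epsilon>)\<^sup>2" using n \<epsilon> by simp
  have meas: "{X \<in> space S. (real n * \<epsilon>)\<^sup>2 \<le> (\<Sum>i<n. h (X i))\<^sup>2} \<in> sets S"
    using I by measurable
  have "measure S {X \<in> space S. real n * m + real n * \<epsilon> \<le> (\<Sum>i<n. g (X i))} \<le> measure S {X \<in> space S. (real n * \<epsilon>)\<^sup>2 \<le> (\<Sum>i<n. h (X i))\<^sup>2}"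
  proof (intro S.finite_measure_mono meas subsetI)
    fix X assume X: "X \<in> {X \<in> space S. real n * m + real n * \<epsilon> \<le> (\<Sum>i<n. g (X i))}"
    have "(\<Sum>i<n. h (X i)) = (\<Sum>i<n. g (X i)) - real n * m" by (simp add: h_def sum_subtractf)
    hence "real n * \<epsilon> \<le> (\<Sum>i<n. h (X i))" using X by simp
    hence "(real n * \<epsilon>)\<^sup>2 \<le> (\<Sum>i<n. h (X i))\<^sup>2" using \<epsilon> by (intro power_mono) auto
    thus "X \<in> {X \<in> space S. (real n * \<epsilon>)\<^sup>2 \<le> (\<Sum>i<n. h (X i))\<^sup>2}" using X by simp
  qed
  also have "\<dots> \<le> (\<integral>X. (\<Sum>i<n. h (X i))\<^sup>2 \<partial>S) / (real n * \<epsilon>)\<^sup>2"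
    using integral_Markov_inequality_measure[OF I sets.top _ ne] by simp
  also have "\<dots> \<le> real n * v / (real n * \<epsilon>)\<^sup>2" using bd by (intro divide_right_mono) auto
  also have "\<dots> = v / (real n * \<epsilon>\<^sup>2)" using n by (simp add: power2_eq_square)
  finally show ?thesis .
qed

lemma null_event:
  assumes "N \<in> sets borel" "measure P N = 0" "i < n"
  shows "{X \<in> space S. X i \<in> N} \<in> sets S" "measure S {X \<in> space S. X i \<in> N} = 0"
proof -
  have eq: "{X \<in> space S. X i \<in> N} = (\<lambda>X. X i) -` N \<inter> space S" by auto
  show "{X \<in> space S. X i \<in> N} \<in> sets S"
    unfolding eq using assms sets_P by (intro measurable_sets[OF component_measurable]) auto
  have "measure P N = measure (distr S P (\<lambda>X. X i)) N" using distr_component[OF assms(3)] by simp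
  also have "\<dots> = measure S {X \<in> space S. X i \<in> N}"
    unfolding eq using assms sets_P by (intro measure_distr component_measurable) auto
  finally show "measure S {X \<in> space S. X i \<in> N} = 0" using assms by simp
qed

text \<open>The failure probability 1/10 is shared out: 1/20 for the frequencies of the cover, 1/20
  for the mean of \<open>g\<close>, and 0 for hitting \<open>N\<close>, which will be the zero set
  of \<open>f0\<close>.\<close>

lemma sample_event:
  fixes g :: "'a \<Rightarrow> real"
  assumes n: "0 < n" and \<A>: "finite \<A>" "\<A> \<subseteq> sets borel" "real (card \<A>) * exp (- 2 * real n * \<delta>\<^sup>2) \<le> 1 / 20" "0 \<le> \<delta>"
    and g: "g \<in> borel_measurable borel" "integrable P (\<lambda>x. (g x)\<^sup>2)"
      "(\<integral>x. (g x)\<^sup>2 \<partial>P) \<le> v" "0 < \<epsilon>" "v / (real n * \<epsilon>\<^sup>2) \<le> 1 / 20"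
    and N: "N \<in> sets borel" "measure P N = 0"
  obtains E where "E \<in> sets S" "9 / 10 \<le> measure S E"
    "\<And>X A. X \<in> E \<Longrightarrow> A \<in> \<A> \<Longrightarrow> (\<Sum>i<n. indicator A (X i)) \<le> real n * (measure P A + \<delta>)"
    "\<And>X. X \<in> E \<Longrightarrow> (\<Sum>i<n. g (X i)) \<le> real n * ((\<integral>x. g x \<partial>P) + \<epsilon>)"
    "\<And>X i. X \<in> E \<Longrightarrow> i < n \<Longrightarrow> X i \<notin> N"
proof -
  interpret S: prob_space S by (rule prob_space_S)
  define H where "H A = {X \<in> space S. real n * measure P A + real n * \<delta> \<le> (\<Sum>i<n. indicator A (X i))}" for A
  define G where "G = {X \<in> space S. real n * (\<integral>x. g x \<partial>P) + real n * \<epsilon> \<le> (\<Sum>i<n. g (X i))}"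
  define Z where "Z i = {X \<in> space S. X i \<in> N}" for i
  have Hm: "H A \<in> sets S" if "A \<in> \<A>" for A
  proof -
    have "(\<lambda>X. \<Sum>i<n. indicator A (X i) :: real) \<in> borel_measurable S"
      using \<A> that by (intro borel_measurable_sum component_measurable_compose) auto
    thus ?thesis unfolding H_def by measurable
  qed
  have "(\<lambda>X. \<Sum>i<n. g (X i)) \<in> borel_measurable S"
    using g by (intro borel_measurable_sum component_measurable_compose) auto
  hence Gm: "G \<in> sets S" unfolding G_def by measurable
  have Zm: "Z i \<in> sets S" "measure S (Z i) = 0" if "i < n" for i
    unfolding Z_def using null_event[OF N that] by auto
  define B where "B = (\<Union>A\<in>\<A>. H A) \<union> G \<union> (\<Union>i<n. Z i)"
  have UH: "(\<Union>A\<in>\<A>. H A) \<in> sets S" using Hm \<A> by auto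
  have UZ: "(\<Union>i<n. Z i) \<in> sets S" using Zm by auto
  have Bm: "B \<in> sets S" unfolding B_def using UH Gm UZ by auto
  have "measure S (\<Union>A\<in>\<A>. H A) \<le> (\<Sum>A\<in>\<A>. measure S (H A))"
    using \<A> Hm by (intro measure_UNION_le) auto
  also have "\<dots> \<le> real (card \<A>) * exp (- 2 * real n * \<delta>\<^sup>2)"
    using \<A> hoeffding_event[OF n _ \<A>(4)] unfolding H_def by (intro sum_bounded_above) auto
  finally have 1: "measure S (\<Union>A\<in>\<A>. H A) \<le> 1 / 20" using \<A> by linarith
  have 2: "measure S G \<le> 1 / 20"
    using chebyshev_event[OF n g(1-4)] g(5) unfolding G_def by linarith
  have "measure S (\<Union>i<n. Z i) \<le> (\<Sum>i<n. measure S (Z i))" using Zm by (intro measure_UNION_le) auto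
  hence 3: "measure S (\<Union>i<n. Z i) \<le> 0" using Zm by simp
  have "measure S B \<le> measure S ((\<Union>A\<in>\<A>. H A) \<union> G) + measure S (\<Union>i<n. Z i)"
    unfolding B_def using UH Gm UZ by (intro measure_Un_le) auto
  also have "measure S ((\<Union>A\<in>\<A>. H A) \<union> G) \<le> measure S (\<Union>A\<in>\<A>. H A) + measure S G"
    using UH Gm by (intro measure_Un_le) auto
  finally have B: "measure S B \<le> 1 / 10" using 1 2 3 by linarith
  show ?thesis
  proof (rule that[of "space S - B"])
    show "space S - B \<in> sets S" using Bm by auto
    show "9 / 10 \<le> measure S (space S - B)" using S.prob_compl[OF Bm] B by simp
    fix X assume X: "X \<in> space S - B"
    show "(\<Sum>i<n. indicator A (X i)) \<le> real n * (measure P A + \<delta>)" if "A \<in> \<A>" for A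
      using X that unfolding B_def H_def by (auto simp: not_le distrib_left intro: less_imp_le)
    show "(\<Sum>i<n. g (X i)) \<le> real n * ((\<integral>x. g x \<partial>P) + \<epsilon>)"
      using X unfolding B_def G_def by (auto simp: not_le distrib_left intro: less_imp_le)
    show "X i \<notin> N" if "i < n" for i using X that unfolding B_def Z_def by auto
  qed
qed

end

section \<open>Existence of the maximum likelihood estimator\<close>

locale tent_heights =
  fixes X :: "nat \<Rightarrow> 'a::euclidean_space" and n :: nat
  assumes n: "0 < n" and hull_interior: "interior (convex hull (X ` {..<n})) \<noteq> {}"
begin

definition H :: "'a set" where "H = convex hull (X ` {..<n})"

definition hypo :: "(nat \<Rightarrow> real) \<Rightarrow> ('a \<times> real) set" where
  "hypo y = convex hull ((\<lambda>i. (X i, y i)) ` {..<n})"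

text \<open>Upper hull of the lifted points \<open>(X i, y i)\<close>, that is, the least concave
  function on \<open>H\<close> above the heights \<open>y\<close>. Its value at \<open>X i\<close>
  may exceed \<open>y i\<close>.\<close>

definition tent :: "(nat \<Rightarrow> real) \<Rightarrow> 'a \<Rightarrow> real" where
  "tent y x = Sup {s. (x, s) \<in> hypo y}"

definition etent :: "(nat \<Rightarrow> real) \<Rightarrow> 'a \<Rightarrow> real" where
  "etent y x = (if x \<in> H then exp (tent y x) else 0)"

definition Z :: "(nat \<Rightarrow> real) \<Rightarrow> real" where
  "Z y = (\<integral>x. etent y x \<partial>lborel)"

text \<open>Average log-likelihood of the normalised tent if it had exactly the heights
  \<open>y\<close> at the sample. The true value is at least as large, so it suffices to maximise
  over the heights, a problem in finitely many variables; adding a constant to all heights changes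
  nothing.\<close>

definition \<sigma> :: "(nat \<Rightarrow> real) \<Rightarrow> real" where
  "\<sigma> y = (\<Sum>i<n. y i) / real n - ln (Z y)"

lemma H: "compact H" "convex H" "closed H" "X i \<in> H \<or> \<not> i < n"
  unfolding H_def by (auto intro!: finite_imp_compact_convex_hull compact_imp_closed hull_inc)

lemma hypo: "compact (hypo y)" "convex (hypo y)" "i < n \<Longrightarrow> (X i, y i) \<in> hypo y"
  unfolding hypo_def by (auto intro!: finite_imp_compact_convex_hull hull_inc)

lemma hypo_minimal:
  assumes "convex Q" "\<And>i. i < n \<Longrightarrow> (X i, y i) \<in> Q"
  shows "hypo y \<subseteq> Q"
  unfolding hypo_def using assms by (intro hull_minimal) auto

lemma fst_hypo: "fst ` hypo y = H"
  unfolding hypo_def H_def by (subst convex_hull_linear_image[OF linear_fst]) (simp add: image_image)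

lemma tent_max:
  assumes "x \<in> H"
  shows "(x, tent y x) \<in> hypo y" "\<And>s. (x, s) \<in> hypo y \<Longrightarrow> s \<le> tent y x"
proof -
  let ?A = "{s. (x, s) \<in> hypo y}"
  obtain p where p: "p \<in> hypo y" "fst p = x" using assms fst_hypo[of y] by (metis imageE)
  have ne: "?A \<noteq> {}" using p by (cases p) auto
  have "closed {p::'a \<times> real. fst p = x}" by (intro closed_Collect_eq continuous_intros)
  hence "compact (snd ` (hypo y \<inter> {p. fst p = x}))"
    using hypo(1) by (intro compact_continuous_image continuous_intros compact_Int_closed)
  moreover have "snd ` (hypo y \<inter> {p. fst p = x}) = ?A" by force
  ultimately have "compact ?A" by simp
  then obtain s where s: "s \<in> ?A" "\<forall>t\<in>?A. t \<le> s" using compact_attains_sup ne by blast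
  hence "tent y x = s" unfolding tent_def by (intro cSup_eq_maximum) auto
  thus "(x, tent y x) \<in> hypo y" "\<And>s. (x, s) \<in> hypo y \<Longrightarrow> s \<le> tent y x" using s by auto
qed

lemma hypo_bounds:
  assumes "(x, s) \<in> hypo y"
  shows "x \<in> H" "(\<And>i. i < n \<Longrightarrow> y i \<le> u) \<Longrightarrow> s \<le> u" "(\<And>i. i < n \<Longrightarrow> l \<le> y i) \<Longrightarrow> l \<le> s"
proof -
  show "x \<in> H" using assms fst_hypo[of y] by force
  show "s \<le> u" if "\<And>i. i < n \<Longrightarrow> y i \<le> u"
  proof -
    have "convex (UNIV \<times> {..u} :: ('a \<times> real) set)" by (intro convex_Times) auto
    from subsetD[OF hypo_minimal[OF this] assms] that show ?thesis by auto
  qed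
  show "l \<le> s" if "\<And>i. i < n \<Longrightarrow> l \<le> y i"
  proof -
    have "convex (UNIV \<times> {l..} :: ('a \<times> real) set)" by (intro convex_Times) auto
    from subsetD[OF hypo_minimal[OF this] assms] that show ?thesis by auto
  qed
qed

lemma tent_concave:
  assumes "a \<in> H" "b \<in> H" "0 \<le> t" "t \<le> 1"
  shows "(1 - t) * tent y a + t * tent y b \<le> tent y ((1 - t) *\<^sub>R a + t *\<^sub>R b)"
proof -
  have "(1 - t) *\<^sub>R (a, tent y a) + t *\<^sub>R (b, tent y b) \<in> hypo y"
    using assms by (intro convexD_alt[OF hypo(2)] tent_max(1)) auto
  hence "((1 - t) *\<^sub>R a + t *\<^sub>R b, (1 - t) * tent y a + t * tent y b) \<in> hypo y" by simp
  thus ?thesis using tent_max(2)[OF hypo_bounds(1)] by blast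
qed

lemma tent_ge: "i < n \<Longrightarrow> y i \<le> tent y (X i)"
  using tent_max(2)[OF hypo_bounds(1)[OF hypo(3)] hypo(3)] by blast

lemma tent_superlevel_closed: "closed {x \<in> H. c \<le> tent y x}"
proof -
  have "closed {p::'a \<times> real. c \<le> snd p}" by (intro closed_Collect_le continuous_intros)
  hence "compact (fst ` (hypo y \<inter> {p. c \<le> snd p}))"
    using hypo(1) by (intro compact_continuous_image continuous_intros compact_Int_closed)
  moreover have "fst ` (hypo y \<inter> {p. c \<le> snd p}) = {x \<in> H. c \<le> tent y x}"
  proof (intro set_eqI iffI)
    fix x assume "x \<in> fst ` (hypo y \<inter> {p. c \<le> snd p})"
    then obtain s where s: "(x, s) \<in> hypo y" "c \<le> s" by auto
    have "x \<in> H" using hypo_bounds(1)[OF s(1)] .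
    moreover have "s \<le> tent y x" using tent_max(2)[OF \<open>x \<in> H\<close> s(1)] .
    ultimately show "x \<in> {x \<in> H. c \<le> tent y x}" using s by simp
  next
    fix x assume x: "x \<in> {x \<in> H. c \<le> tent y x}"
    thus "x \<in> fst ` (hypo y \<inter> {p. c \<le> snd p})"
      using tent_max(1)[of x y] by (intro image_eqI[of _ _ "(x, tent y x)"]) auto
  qed
  ultimately show ?thesis by (simp add: compact_imp_closed)
qed

lemma etent_superlevel_closed: "0 < a \<Longrightarrow> closed {x. a \<le> etent y x}"
proof -
  assume a: "0 < a"
  have "{x. a \<le> etent y x} = {x \<in> H. ln a \<le> tent y x}"
    using a by (auto simp: etent_def ln_le_iff)
  thus ?thesis using tent_superlevel_closed by simp
qed

lemma etent_nonneg: "0 \<le> etent y x"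
  by (simp add: etent_def)

lemma etent_measurable [measurable]: "etent y \<in> borel_measurable borel"
proof (rule borel_measurable_iff_ge[THEN iffD2], intro allI)
  fix a
  show "{w \<in> space borel. a \<le> etent y w} \<in> sets borel"
  proof (cases "0 < a")
    case True thus ?thesis using etent_superlevel_closed[of a y] by simp
  next
    case False
    hence "a \<le> etent y w" for w using etent_nonneg[of y w] by linarith
    hence "{w \<in> space borel. a \<le> etent y w} = UNIV" by simp
    thus ?thesis by simp
  qed
qed

section \<open>The normaliser of a tent\<close>

lemma H_measure: "H \<in> fmeasurable lborel" "0 < measure lborel H"
proof -
  show 1: "H \<in> fmeasurable lborel" using H(1) by (rule fmeasurable_compact)
  obtain c r where "0 < r" "ball c r \<subseteq> H" using hull_interior unfolding H_def[symmetric]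
    by (meson all_not_in_conv mem_interior)
  hence "measure lborel (ball c r) \<le> measure lborel H" using 1 by (intro measure_mono_fmeasurable) auto
  thus "0 < measure lborel H" using content_ball_pos[OF \<open>0 < r\<close>, of c] by linarith
qed

lemma etent_integrable: "integrable lborel (etent y)"
proof (rule Bochner_Integration.integrable_bound[where f="\<lambda>x. exp (Max (y ` {..<n})) * indicator H x"])
  show "integrable lborel (\<lambda>x. exp (Max (y ` {..<n})) * indicator H x)"
    using H_measure by (auto simp: fmeasurable_def)
  have "tent y x \<le> Max (y ` {..<n})" if "x \<in> H" for x
    using hypo_bounds(2)[OF tent_max(1)[OF that]] by simp
  thus "AE x in lborel. norm (etent y x) \<le> norm (exp (Max (y ` {..<n})) * indicator H x)"
    by (auto simp: etent_def indicator_def)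
qed simp

lemma Z_pos: "0 < Z y"
proof -
  have "exp (Min (y ` {..<n})) * measure lborel H = (\<integral>x. exp (Min (y ` {..<n})) * indicator H x \<partial>lborel)"
    using H_measure by simp
  also have "\<dots> \<le> Z y" unfolding Z_def
  proof (rule integral_mono[OF _ etent_integrable])
    show "integrable lborel (\<lambda>x. exp (Min (y ` {..<n})) * indicator H x)"
      using H_measure by (auto simp: fmeasurable_def)
    have "Min (y ` {..<n}) \<le> tent y x" if "x \<in> H" for x
      using hypo_bounds(3)[OF tent_max(1)[OF that]] by simp
    thus "exp (Min (y ` {..<n})) * indicator H x \<le> etent y x" for x
      by (auto simp: etent_def indicator_def)
  qed
  finally show ?thesis using H_measure(2) by (meson exp_gt_zero less_le_trans mult_pos_pos)
qed

lemma normalised_etent: "(\<lambda>x. etent y x / Z y) \<in> log_concave_densities"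
proof -
  have "log_concave (\<lambda>x. etent y x / Z y)"
  proof (rule log_concaveI)
    show "0 \<le> etent y x / Z y" for x using etent_nonneg Z_pos by (simp add: less_imp_le)
    show "closed {x. a \<le> etent y x / Z y}" if "0 < a" for a
      using etent_superlevel_closed[of "a * Z y" y] that Z_pos[of y] by (simp add: pos_le_divide_eq)
    fix a b and t :: real assume ab: "0 < etent y a / Z y" "0 < etent y b / Z y" "0 < t" "t < 1"
    hence aH: "a \<in> H" "b \<in> H" by (auto simp: etent_def split: if_splits)
    let ?c = "(1 - t) *\<^sub>R a + t *\<^sub>R b"
    have cH: "?c \<in> H" using aH ab by (intro convexD_alt[OF H(2)]) auto
    have l: "ln (etent y x / Z y) = tent y x - ln (Z y)" if "x \<in> H" for x
      using that Z_pos[of y] by (simp add: etent_def ln_div)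
    have "0 < etent y ?c / Z y" using cH Z_pos[of y] by (simp add: etent_def)
    moreover have "(1 - t) * (tent y a - ln (Z y)) + t * (tent y b - ln (Z y)) = (1 - t) * tent y a + t * tent y b - ln (Z y)"
      by (simp add: algebra_simps)
    ultimately show "0 < etent y ?c / Z y \<and> (1 - t) * ln (etent y a / Z y) + t * ln (etent y b / Z y) \<le> ln (etent y ?c / Z y)"
      using tent_concave[OF aH, of t y] ab unfolding l[OF aH(1)] l[OF aH(2)] l[OF cH] by simp
  qed
  moreover have "(\<integral>\<^sup>+x. ennreal (etent y x / Z y) \<partial>lborel) = ennreal (\<integral>x. etent y x / Z y \<partial>lborel)"
    using etent_integrable etent_nonneg Z_pos[of y] by (intro nn_integral_eq_integral) auto
  moreover have "(\<integral>x. etent y x / Z y \<partial>lborel) = 1" using Z_pos[of y] by (simp add: Z_def)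
  ultimately show ?thesis
    using etent_nonneg Z_pos[of y] by (auto simp: log_concave_densities_def probability_density_def)
qed

text \<open>The region below \<open>ln g\<close> is convex and contains the lifted points, hence
  their hull: the tent on the heights \<open>ln (g (X i))\<close> lies below \<open>ln g\<close>.
  Passing from a competitor to its normalised tent therefore loses no likelihood.\<close>

lemma Z_le_1:
  assumes g: "g \<in> log_concave_densities" "\<And>i. i < n \<Longrightarrow> 0 < g (X i)"
  shows "Z (\<lambda>i. ln (g (X i))) \<le> 1"
proof -
  note g' = log_concave_densitiesD[OF g(1)]
  let ?y = "\<lambda>i. ln (g (X i))"
  let ?Q = "{p::'a \<times> real. 0 < g (fst p) \<and> snd p \<le> ln (g (fst p))}"
  have "convex ?Q"
  proof (rule convexI)
    fix p q and u v :: real assume pq: "p \<in> ?Q" "q \<in> ?Q" and uv: "0 \<le> u" "0 \<le> v" "u + v = 1"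
    have u: "u = 1 - v" "v \<le> 1" using uv by auto
    have pos: "0 < g (fst p)" "0 < g (fst q)" using pq by auto
    note lc = log_concave_ln_ge[OF g'(2) pos uv(2) u(2), folded u(1)]
    have "u * snd p + v * snd q \<le> u * ln (g (fst p)) + v * ln (g (fst q))"
      using pq uv by (intro add_mono mult_left_mono) auto
    thus "u *\<^sub>R p + v *\<^sub>R q \<in> ?Q" using lc by simp
  qed
  hence sub: "hypo ?y \<subseteq> ?Q" using g(2) by (intro hypo_minimal) auto
  have "Z ?y \<le> (\<integral>x. g x \<partial>lborel)" unfolding Z_def
  proof (rule integral_mono[OF etent_integrable g'(5)])
    fix x show "etent ?y x \<le> g x"
    proof (cases "x \<in> H")
      case True
      hence "0 < g x" "tent ?y x \<le> ln (g x)" using subsetD[OF sub tent_max(1)] by auto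
      thus ?thesis using True by (simp add: etent_def ln_ge_iff)
    qed (simp add: etent_def g'(3))
  qed
  thus ?thesis using g' by simp
qed

text \<open>As in \<open>Z_le_1\<close>, with the tent of \<open>y'\<close> raised by
  \<open>c\<close> in place of \<open>ln g\<close>. Shift invariance and continuity of
  \<open>\<sigma>\<close> both rest on this.\<close>

lemma Z_mono:
  assumes "\<And>i. i < n \<Longrightarrow> y i \<le> y' i + c"
  shows "Z y \<le> exp c * Z y'"
proof -
  let ?Q = "{p::'a \<times> real. fst p \<in> H \<and> snd p \<le> tent y' (fst p) + c}"
  have "convex ?Q"
  proof (rule convexI)
    fix p q and u v :: real assume pq: "p \<in> ?Q" "q \<in> ?Q" and uv: "0 \<le> u" "0 \<le> v" "u + v = 1"
    have u: "u = 1 - v" "v \<le> 1" using uv by auto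
    have pos: "fst p \<in> H" "fst q \<in> H" using pq by auto
    note tc = tent_concave[OF pos uv(2) u(2), of y', folded u(1)]
    have "u * snd p + v * snd q \<le> u * (tent y' (fst p) + c) + v * (tent y' (fst q) + c)"
      using pq uv by (intro add_mono mult_left_mono) auto
    also have "\<dots> = u * tent y' (fst p) + v * tent y' (fst q) + (u + v) * c" by (simp add: algebra_simps)
    finally have "u * snd p + v * snd q \<le> tent y' (u *\<^sub>R fst p + v *\<^sub>R fst q) + c" using tc uv by simp
    moreover have "u *\<^sub>R fst p + v *\<^sub>R fst q \<in> H" using H(2) pos uv by (auto simp: convex_def)
    ultimately show "u *\<^sub>R p + v *\<^sub>R q \<in> ?Q" by simp
  qed
  moreover have "(X i, y i) \<in> ?Q" if "i < n" for i
    using that assms[OF that] tent_ge[OF that, of y'] H(4)[of i] by simp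
  ultimately have sub: "hypo y \<subseteq> ?Q" by (intro hypo_minimal)
  have "Z y \<le> (\<integral>x. exp c * etent y' x \<partial>lborel)" unfolding Z_def
  proof (rule integral_mono[OF etent_integrable])
    show "integrable lborel (\<lambda>x. exp c * etent y' x)" using etent_integrable by simp
    fix x show "etent y x \<le> exp c * etent y' x"
      using subsetD[OF sub tent_max(1), of x] by (auto simp: etent_def add.commute simp flip: exp_add)
  qed
  thus ?thesis by (simp add: Z_def)
qed

lemma ln_Z_mono:
  assumes "\<And>i. i < n \<Longrightarrow> y i \<le> y' i + c"
  shows "ln (Z y) \<le> c + ln (Z y')"
proof -
  have "ln (Z y) \<le> ln (exp c * Z y')" using Z_mono[OF assms] Z_pos by (subst ln_le_cancel_iff) auto
  thus ?thesis using Z_pos[of y'] by (simp add: ln_mult)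
qed

lemma \<sigma>_shift:
  assumes "\<And>i. i < n \<Longrightarrow> y' i = y i + c"
  shows "\<sigma> y' = \<sigma> y"
proof -
  have "ln (Z y') \<le> c + ln (Z y)" by (rule ln_Z_mono) (simp add: assms)
  moreover have "ln (Z y) \<le> - c + ln (Z y')" by (rule ln_Z_mono) (simp add: assms)
  moreover have "(\<Sum>i<n. y' i) = (\<Sum>i<n. y i) + real n * c" using assms by (simp add: sum.distrib)
  ultimately show ?thesis using n by (simp add: \<sigma>_def add_divide_distrib)
qed

lemma \<sigma>_lipschitz: "\<sigma> y - \<sigma> y' \<le> 2 * (\<Sum>i<n. \<bar>y i - y' i\<bar>)"
proof -
  let ?c = "\<Sum>i<n. \<bar>y i - y' i\<bar>"
  have c0: "0 \<le> ?c" by (intro sum_nonneg) auto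
  have "\<bar>y i - y' i\<bar> \<le> ?c" if "i < n" for i using that by (intro member_le_sum) auto
  hence "y' i \<le> y i + ?c" if "i < n" for i using that by (smt (verit))
  hence 1: "ln (Z y') \<le> ?c + ln (Z y)" by (intro ln_Z_mono)
  have "(\<Sum>i<n. y i) - (\<Sum>i<n. y' i) \<le> ?c" unfolding sum_subtractf[symmetric] by (intro sum_mono) auto
  hence "((\<Sum>i<n. y i) - (\<Sum>i<n. y' i)) / real n \<le> ?c / real n" by (intro divide_right_mono) auto
  also have "\<dots> \<le> ?c / 1" using n c0 by (intro divide_left_mono) auto
  finally show ?thesis using 1 by (simp add: \<sigma>_def diff_divide_distrib)
qed

lemma \<sigma>_continuous: "continuous_on K \<sigma>"
  unfolding continuous_on_def
proof
  fix y assume "y \<in> K"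
  let ?g = "\<lambda>y'. 2 * (\<Sum>i<n. \<bar>y' i - y i\<bar>)"
  have "continuous_on K ?g"
    by (intro continuous_intros continuous_on_subset[OF continuous_on_product_coordinates]) auto
  hence "(?g \<longlongrightarrow> ?g y) (at y within K)" using \<open>y \<in> K\<close> unfolding continuous_on_def by blast
  hence g: "(?g \<longlongrightarrow> 0) (at y within K)" by simp
  have "norm (\<sigma> y' - \<sigma> y) \<le> ?g y'" for y'
    using \<sigma>_lipschitz[of y' y] \<sigma>_lipschitz[of y y'] by (simp add: abs_minus_commute abs_le_iff)
  hence "((\<lambda>y'. \<sigma> y' - \<sigma> y) \<longlongrightarrow> 0) (at y within K)" by (intro Lim_null_comparison[OF _ g]) auto
  thus "(\<sigma> \<longlongrightarrow> \<sigma> y) (at y within K)" by (simp add: LIM_zero_iff)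
qed

text \<open>Contracting \<open>H\<close> by the factor \<open>1 / m\<close> towards a sample point
  of height 0 gives a set on which the tent is at least -1. So a small normaliser can raise
  \<open>\<sigma>\<close> only by a multiple of \<open>ln m\<close>, while the lowest height pulls
  the mean down by \<open>m / n\<close>.\<close>

lemma \<sigma>_coercive:
  assumes y: "\<And>i. i < n \<Longrightarrow> - m \<le> y i" "\<And>i. i < n \<Longrightarrow> y i \<le> 0" "j < n" "y j = 0" "k < n" "y k = - m" and m: "1 \<le> m"
  shows "\<sigma> y \<le> - m / real n + 1 + real DIM('a) * ln m - ln (measure lborel H)"
proof -
  let ?V = "measure lborel H"
  let ?T = "\<lambda>x. (1 / m) *\<^sub>R x + (X j - (1 / m) *\<^sub>R X j)"
  have jH: "X j \<in> H" using H(4) y(3) by blast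
  have "compact (?T ` H)" using H(1) by (intro compact_continuous_image continuous_intros)
  hence TH: "?T ` H \<in> fmeasurable lborel" "?T ` H \<in> sets borel" by (auto intro: fmeasurable_compact borel_closed compact_imp_closed)
  have "measure lborel (?T ` H) = measure lebesgue (?T ` H)" using TH by simp
  also have "\<dots> = (1 / m) ^ DIM('a) * measure lebesgue H"
    using measure_lebesgue_affine[of "1 / m" "X j - (1 / m) *\<^sub>R X j" H] m by (simp add: add.commute)
  also have "measure lebesgue H = ?V" using H(3) by simp
  finally have mT: "measure lborel (?T ` H) = (1 / m) ^ DIM('a) * ?V" .
  have T: "exp (- 1) \<le> etent y z" if "z \<in> ?T ` H" for z
  proof -
    from that obtain x where x: "x \<in> H" "z = (1 - 1 / m) *\<^sub>R X j + (1 / m) *\<^sub>R x" by (auto simp: algebra_simps)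
    have m1: "0 \<le> 1 / m" "1 / m \<le> 1" using m by auto
    have zH: "z \<in> H" unfolding x(2) using x jH m1 by (intro convexD_alt[OF H(2)]) auto
    have "- m \<le> tent y x" by (rule hypo_bounds(3)[OF tent_max(1)[OF x(1)]]) (rule y(1))
    hence "(1 / m) * (- m) \<le> (1 / m) * tent y x" using m1(1) by (rule mult_left_mono)
    moreover have "0 \<le> tent y (X j)" using tent_ge[OF y(3), of y] y(4) by simp
    hence "0 \<le> (1 - 1 / m) * tent y (X j)" using m1 by simp
    ultimately have "- 1 \<le> tent y z" using tent_concave[OF jH x(1) m1, of y] m unfolding x(2) by simp
    thus ?thesis using zH by (simp add: etent_def)
  qed
  have "exp (- 1) * measure lborel (?T ` H) = (\<integral>x. exp (- 1) * indicator (?T ` H) x \<partial>lborel)" using TH by simp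
  also have "\<dots> \<le> Z y" unfolding Z_def
  proof (rule integral_mono[OF _ etent_integrable])
    have "emeasure lborel (?T ` H) < \<infinity>" using TH(1) by (simp add: fmeasurable_def)
    thus "integrable lborel (\<lambda>x. exp (- 1) * indicator (?T ` H) x :: real)"
      using TH(2) by (intro integrable_mult_right integrable_real_indicator) auto
    show "exp (- 1) * indicator (?T ` H) x \<le> etent y x" for x
      using T[of x] etent_nonneg[of y x] by (auto simp: indicator_def)
  qed
  finally have "exp (- 1) * ((1 / m) ^ DIM('a) * ?V) \<le> Z y" by (simp add: mT)
  hence "ln (exp (- 1) * ((1 / m) ^ DIM('a) * ?V)) \<le> ln (Z y)"
    using m H_measure(2) Z_pos[of y] by (subst ln_le_cancel_iff) auto
  hence 1: "- 1 - real DIM('a) * ln m + ln ?V \<le> ln (Z y)"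
    using m H_measure(2) by (simp add: ln_mult ln_realpow ln_div)
  have "(\<Sum>i<n. y i) = y k + (\<Sum>i\<in>{..<n} - {k}. y i)" using y(5) by (intro sum.remove) auto
  also have "\<dots> \<le> - m + 0" using y(2,6) by (intro add_mono sum_nonpos) auto
  finally have "(\<Sum>i<n. y i) / real n \<le> - m / real n" by (intro divide_right_mono) auto
  thus ?thesis using 1 by (simp add: \<sigma>_def)
qed

lemma \<sigma>_zero: "- ln (measure lborel H) \<le> \<sigma> (\<lambda>_. 0)"
proof -
  have "Z (\<lambda>_. 0) \<le> (\<integral>x. indicator H x \<partial>lborel)" unfolding Z_def
  proof (rule integral_mono[OF etent_integrable])
    show "integrable lborel (indicator H :: 'a \<Rightarrow> real)" using H_measure by (auto simp: fmeasurable_def)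
    have "tent (\<lambda>_. 0) x \<le> 0" if "x \<in> H" for x by (rule hypo_bounds(2)[OF tent_max(1)[OF that]]) simp
    thus "etent (\<lambda>_. 0) x \<le> indicator H x" for x by (auto simp: etent_def indicator_def)
  qed
  hence "ln (Z (\<lambda>_. 0)) \<le> ln (measure lborel H)"
    using Z_pos H_measure by (subst ln_le_cancel_iff) auto
  thus ?thesis by (simp add: \<sigma>_def)
qed

lemma \<sigma>_attains_max: "\<exists>y0. \<forall>y. \<sigma> y \<le> \<sigma> y0"
proof -
  define D where "D = 2 * real DIM('a) + 1"
  \<comment> \<open>For \<open>m\<close> beyond \<open>m0\<close> one has
    \<open>n * D < sqrt m\<close>, and with \<open>ln m \<le> 2 * sqrt m\<close> the logarithmic
    gain is at most \<open>D * sqrt m \<le> m / n\<close>.\<close>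
  define m0 where "m0 = (real n * D)\<^sup>2 + 1"
  have D: "1 \<le> D" by (simp add: D_def)
  \<comment> \<open>Heights are functions on all of \<open>nat\<close>; pinning the indices outside
    the sample to 0 makes this set compact in the product topology.\<close>
  define K :: "(nat \<Rightarrow> real) set" where "K = (\<Pi>\<^sub>E i\<in>UNIV. if i < n then {-m0..0} else {0})"
  have "compactin (product_topology (\<lambda>_. euclidean) UNIV) K"
    unfolding K_def by (subst compactin_PiE) auto
  hence K: "compact K" by (simp add: euclidean_product_topology)
  have zK: "(\<lambda>_. 0) \<in> K" by (auto simp: K_def m0_def PiE_def Pi_def intro: order_trans[OF _ zero_le_power2])
  then obtain y0 where y0: "y0 \<in> K" "\<And>y. y \<in> K \<Longrightarrow> \<sigma> y \<le> \<sigma> y0"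
    using continuous_attains_sup[OF K _ \<sigma>_continuous] by (metis empty_iff)
  have "\<sigma> y \<le> \<sigma> y0" for y
  proof -
    define u where "u = Max (y ` {..<n})"
    \<comment> \<open>By shift invariance the largest height may be taken to be 0.\<close>
    define y' where "y' i = (if i < n then y i - u else 0)" for i
    have ne: "{..<n} \<noteq> {}" using n by auto
    have eq: "\<sigma> y' = \<sigma> y" by (rule \<sigma>_shift[of _ _ "- u"]) (simp add: y'_def)
    have le: "y' i \<le> 0" if "i < n" for i using that by (simp add: y'_def u_def)
    have "u \<in> y ` {..<n}" unfolding u_def using ne by (intro Max_in) auto
    then obtain j where j: "j < n" "y' j = 0" by (auto simp: y'_def)
    have "Min (y' ` {..<n}) \<in> y' ` {..<n}" using ne by (intro Min_in) auto
    then obtain k where k: "k < n" "y' k = Min (y' ` {..<n})" by auto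
    define m where "m = - y' k"
    have mi: "- m \<le> y' i" if "i < n" for i using that k by (simp add: m_def)
    show ?thesis
    proof (cases "m \<le> m0")
      case True
      have "y' i \<in> (if i < n then {-m0..0} else {0})" for i
        using mi[of i] le[of i] True by (auto simp: y'_def)
      hence "y' \<in> K" by (auto simp: K_def)
      thus ?thesis using y0 eq by metis
    next
      case False
      hence m: "m0 < m" by simp
      have m1: "1 \<le> m" using m zero_le_power2[of "real n * D"] unfolding m0_def by linarith
      have "(real n * D)\<^sup>2 < m" using m by (simp add: m0_def)
      hence "sqrt ((real n * D)\<^sup>2) < sqrt m" by (rule real_sqrt_less_mono)
      hence sm: "real n * D < sqrt m" using D by simp
      have "ln m \<le> 2 * sqrt m" using ln_le_two_sqrt[OF m1] .
      hence "real DIM('a) * ln m \<le> real DIM('a) * (2 * sqrt m)" by (intro mult_left_mono) auto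
      moreover have "1 \<le> sqrt m" using m1 by simp
      moreover have "D * sqrt m = real DIM('a) * (2 * sqrt m) + sqrt m" by (simp add: D_def algebra_simps)
      ultimately have "1 + real DIM('a) * ln m \<le> D * sqrt m" by linarith
      also have "\<dots> \<le> (sqrt m / real n) * sqrt m"
        using sm n m1 by (intro mult_right_mono) (auto simp: field_simps)
      also have "\<dots> = m / real n" using m1 by simp
      finally have "- m / real n + 1 + real DIM('a) * ln m - ln (measure lborel H) \<le> - ln (measure lborel H)" by simp
      moreover have "\<sigma> y' \<le> - m / real n + 1 + real DIM('a) * ln m - ln (measure lborel H)"
        using mi le j k m1 by (intro \<sigma>_coercive[of m y' j k]) (auto simp: m_def)
      ultimately show ?thesis using \<sigma>_zero y0(2)[OF zK] eq by linarith
    qed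
  qed
  thus ?thesis by blast
qed

end

section \<open>Likelihoods with values in the extended reals\<close>

lemma ereal_sum_MInfty:
  fixes f :: "'b \<Rightarrow> ereal"
  assumes "finite A" "x \<in> A" "f x = -\<infinity>" "\<And>y. y \<in> A \<Longrightarrow> f y \<noteq> \<infinity>"
  shows "sum f A = -\<infinity>"
proof -
  have "sum f (A - {x}) \<noteq> \<infinity>" using assms by (simp add: sum_Pinfty)
  thus ?thesis using assms by (simp add: sum.remove[OF assms(1,2)])
qed

lemma avg_log_lik_real:
  assumes "\<And>i. i < n \<Longrightarrow> 0 < f (X i)"
  shows "avg_log_lik n X f = ereal ((\<Sum>i<n. ln (f (X i))) / real n)"
proof -
  have "(\<Sum>i<n. ln_ext (f (X i))) = (\<Sum>i<n. ereal (ln (f (X i))))"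
    using less_imp_neq[OF assms] by (intro sum.cong) (simp_all add: ln_ext_def)
  thus ?thesis by (simp add: avg_log_lik_def)
qed

lemma avg_log_lik_MInfty:
  assumes "i < n" "f (X i) = 0"
  shows "avg_log_lik n X f = -\<infinity>"
proof -
  have "(\<Sum>i<n. ln_ext (f (X i))) = -\<infinity>"
    using assms by (intro ereal_sum_MInfty[of _ i]) (auto simp: ln_ext_def)
  thus ?thesis using assms by (simp add: avg_log_lik_def)
qed

lemma mle_exists:
  fixes X :: "nat \<Rightarrow> 'a::euclidean_space"
  assumes "0 < n" "interior (convex hull (X ` {..<n})) \<noteq> {}"
  shows "\<exists>f. is_log_concave_mle n X f"
proof -
  interpret tent_heights X n using assms by unfold_locales
  obtain y0 where y0: "\<And>y. \<sigma> y \<le> \<sigma> y0" using \<sigma>_attains_max by blast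
  let ?f = "\<lambda>x. etent y0 x / Z y0"
  have pos: "0 < ?f (X i)" if "i < n" for i using that H(4)[of i] Z_pos[of y0] by (simp add: etent_def)
  have "is_log_concave_mle n X ?f"
    unfolding is_log_concave_mle_def
  proof (intro conjI ballI normalised_etent)
    fix g :: "'a \<Rightarrow> real" assume g: "g \<in> log_concave_densities"
    show "avg_log_lik n X g \<le> avg_log_lik n X ?f"
    proof (cases "\<forall>i<n. 0 < g (X i)")
      case False
      then obtain i where "i < n" "\<not> 0 < g (X i)" by auto
      hence "i < n" "g (X i) = 0" using log_concave_densitiesD(3)[OF g, of "X i"] by auto
      hence "avg_log_lik n X g = -\<infinity>" by (rule avg_log_lik_MInfty)
      thus ?thesis by simp
    next
      case True
      let ?y = "\<lambda>i. ln (g (X i))"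
      \<comment> \<open>The competitor is replaced by its own tent and then by the optimal heights;
        the last inequality holds because a tent may exceed its heights.\<close>
      have "ln (Z ?y) \<le> 0" using Z_le_1[OF g] True Z_pos[of ?y] by simp
      hence "(\<Sum>i<n. ?y i) / real n \<le> \<sigma> ?y" by (simp add: \<sigma>_def)
      also have "\<dots> \<le> \<sigma> y0" by (rule y0)
      also have "\<dots> = (\<Sum>i<n. y0 i - ln (Z y0)) / real n"
        using n by (simp add: \<sigma>_def sum_subtractf diff_divide_distrib)
      also have "\<dots> \<le> (\<Sum>i<n. ln (?f (X i))) / real n"
      proof (intro divide_right_mono sum_mono)
        fix i assume "i \<in> {..<n}"
        thus "y0 i - ln (Z y0) \<le> ln (?f (X i))"
          using tent_ge[of i y0] H(4)[of i] Z_pos[of y0] by (simp add: etent_def ln_div)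
      qed simp
      finally show ?thesis
        using avg_log_lik_real[of n g X] avg_log_lik_real[of n ?f X] True pos by simp
    qed
  qed
  thus ?thesis by blast
qed

section \<open>Hellinger distance of the estimator\<close>

lemma ln_squared_le_sqrt: "1 \<le> u \<Longrightarrow> (ln u)\<^sup>2 \<le> 16 * sqrt u" for u :: real
proof -
  assume u: "1 \<le> u"
  have "ln (sqrt u) \<le> 2 * sqrt (sqrt u)" using u by (intro ln_le_two_sqrt) simp
  hence "ln u \<le> 4 * sqrt (sqrt u)" using u by (simp add: ln_sqrt)
  hence "(ln u)\<^sup>2 \<le> (4 * sqrt (sqrt u))\<^sup>2" using u by (intro power_mono) auto
  thus "(ln u)\<^sup>2 \<le> 16 * sqrt u" using u by (simp add: power_mult_distrib)
qed

text \<open>Where \<open>f x = 0\<close>, the value of \<open>ln (M / f x)\<close> is the junk value \<open>0\<close>; this set is null for the density.\<close>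

lemma log_deficit_moments:
  fixes f :: "'a::euclidean_space \<Rightarrow> real"
  assumes f: "f \<in> log_concave_densities" and M: "0 < M" "f x0 = M" "\<And>x. f x \<le> M"
  defines "P \<equiv> density lborel (\<lambda>x. ennreal (f x))"
  shows "integrable P (\<lambda>x. (ln (M / f x))\<^sup>2)" "(\<integral>x. (ln (M / f x))\<^sup>2 \<partial>P) \<le> 16 * sqrt_bound DIM('a)"
    "integrable lborel (\<lambda>x. f x * ln (M / f x))" "(\<integral>x. ln (M / f x) \<partial>P) = (\<integral>x. f x * ln (M / f x) \<partial>lborel)"
    "(\<integral>x. ln (M / f x) \<partial>P) \<le> 2 * sqrt_bound DIM('a)"
proof -
  note f' = log_concave_densitiesD[OF f]
  note [measurable] = f'(4)
  have "0 < f x0" using M by simp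
  note sq = sqrt_density_integral[OF f this, unfolded M(2), OF M(3)]
  \<comment> \<open>Both powers of the logarithm are bounded by multiples of
    \<open>sqrt (M / f x)\<close>, and \<open>f x * sqrt (M / f x)\<close> is
    \<open>sqrt M * sqrt (f x)\<close>, whose integral is controlled.\<close>
  have pt: "f x * ln (M / f x) \<le> 2 * sqrt M * sqrt (f x) \<and> f x * (ln (M / f x))\<^sup>2 \<le> 16 * sqrt M * sqrt (f x) \<and> 0 \<le> f x * ln (M / f x)" for x
  proof (cases "f x = 0")
    case False
    hence fx: "0 < f x" using f'(3)[of x] by simp
    hence u: "1 \<le> M / f x" using M by simp
    have e: "f x * sqrt (M / f x) = sqrt M * sqrt (f x)"
    proof -
      define s where "s = sqrt (f x)"
      have s: "0 < s" "f x = s * s" using fx by (auto simp: s_def)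
      have "sqrt (M / f x) = sqrt M / s" by (simp add: real_sqrt_divide s_def)
      thus ?thesis unfolding s_def[symmetric] using s by simp
    qed
    have "f x * ln (M / f x) \<le> f x * (2 * sqrt (M / f x))"
      using less_imp_le[OF fx] ln_le_two_sqrt[OF u] by (rule mult_left_mono[rotated])
    hence 1: "f x * ln (M / f x) \<le> 2 * (f x * sqrt (M / f x))" by (simp only: mult.left_commute)
    have "f x * (ln (M / f x))\<^sup>2 \<le> f x * (16 * sqrt (M / f x))"
      using less_imp_le[OF fx] ln_squared_le_sqrt[OF u] by (rule mult_left_mono[rotated])
    hence 2: "f x * (ln (M / f x))\<^sup>2 \<le> 16 * (f x * sqrt (M / f x))" by (simp only: mult.left_commute)
    have "0 \<le> ln (M / f x)" using u by simp
    hence "0 \<le> f x * ln (M / f x)" using fx by simp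
    thus ?thesis using 1 2 unfolding e by (simp add: mult.assoc)
  qed simp
  have i2: "integrable lborel (\<lambda>x. f x * (ln (M / f x))\<^sup>2)"
    by (rule Bochner_Integration.integrable_bound[where f="\<lambda>x. 16 * sqrt M * sqrt (f x)"])
       (use sq pt f'(3) M in \<open>auto simp: abs_mult\<close>)
  show i1: "integrable lborel (\<lambda>x. f x * ln (M / f x))"
  proof (rule Bochner_Integration.integrable_bound[where f="\<lambda>x. 2 * sqrt M * sqrt (f x)"])
    have "norm (f x * ln (M / f x)) \<le> norm (2 * sqrt M * sqrt (f x))" for x
      using pt[of x] f'(3)[of x] M unfolding real_norm_def by (subst abs_of_nonneg) auto
    thus "AE x in lborel. norm (f x * ln (M / f x)) \<le> norm (2 * sqrt M * sqrt (f x))" by simp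
  qed (use sq in auto)
  show "integrable P (\<lambda>x. (ln (M / f x))\<^sup>2)" unfolding P_def using i2 f'(3) by (subst integrable_density) auto
  have "(\<integral>x. (ln (M / f x))\<^sup>2 \<partial>P) = (\<integral>x. f x * (ln (M / f x))\<^sup>2 \<partial>lborel)"
    unfolding P_def using f'(3) by (subst integral_density) auto
  also have "\<dots> \<le> (\<integral>x. 16 * sqrt M * sqrt (f x) \<partial>lborel)" using i2 sq pt by (intro integral_mono) auto
  also have "\<dots> \<le> 16 * sqrt_bound DIM('a)" using sq(2) by simp
  finally show "(\<integral>x. (ln (M / f x))\<^sup>2 \<partial>P) \<le> 16 * sqrt_bound DIM('a)" .
  show eq: "(\<integral>x. ln (M / f x) \<partial>P) = (\<integral>x. f x * ln (M / f x) \<partial>lborel)"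
    unfolding P_def using f'(3) by (subst integral_density) auto
  also have "\<dots> \<le> (\<integral>x. 2 * sqrt M * sqrt (f x) \<partial>lborel)" using i1 sq pt by (intro integral_mono) auto
  also have "\<dots> \<le> 2 * sqrt_bound DIM('a)" using sq(2) by simp
  finally show "(\<integral>x. ln (M / f x) \<partial>P) \<le> 2 * sqrt_bound DIM('a)" .
qed

text \<open>\<open>c\<close> is \<open>v\<close> rounded down to a multiple of \<open>h\<close>,
  written as a sum over levels. For a logarithm this turns empirical means and expectations into
  sums of frequencies and probabilities of superlevel sets.\<close>

lemma layer_sum:
  fixes v h \<Lambda> :: real
  assumes "0 \<le> v" "v \<le> \<Lambda>" "0 < h"
  defines "c \<equiv> (\<Sum>k\<in>{1..nat \<lceil>\<Lambda> / h\<rceil>}. h * of_bool (real k * h \<le> v))"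
  shows "c \<le> v" "v \<le> c + h"
proof -
  define m where "m = nat \<lfloor>v / h\<rfloor>"
  have v0: "0 \<le> v / h" using assms by simp
  have m: "real m \<le> v / h" "v / h < real m + 1" unfolding m_def using v0 by linarith+
  have "v / h \<le> \<Lambda> / h" using assms by (simp add: divide_right_mono)
  hence mN: "m \<le> nat \<lceil>\<Lambda> / h\<rceil>" unfolding m_def by linarith
  have iff: "real k * h \<le> v \<longleftrightarrow> k \<le> m" for k
  proof -
    have "real k * h \<le> v \<longleftrightarrow> real k \<le> v / h" using assms by (simp add: pos_le_divide_eq)
    also have "\<dots> \<longleftrightarrow> k \<le> m" using m by linarith
    finally show ?thesis .
  qed
  have "c = (\<Sum>k\<in>{1..nat \<lceil>\<Lambda> / h\<rceil>}. if k \<le> m then h else 0)"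
    unfolding c_def iff by (intro sum.cong) auto
  also have "\<dots> = (\<Sum>k\<in>{1..nat \<lceil>\<Lambda> / h\<rceil>} \<inter> {k. k \<le> m}. h)" by (subst sum.inter_restrict) auto
  also have "{1..nat \<lceil>\<Lambda> / h\<rceil>} \<inter> {k. k \<le> m} = {1..m}" using mN by auto
  finally have "c = real m * h" by simp
  thus "c \<le> v" "v \<le> c + h" using m assms by (auto simp: field_simps)
qed

text \<open>The first term makes \<open>(4 * K) ^ d * exp (1 - K) \<le> 1 / 4\<close> for every
  larger \<open>K\<close>; the second is at least the expectation of \<open>ln (M / f)\<close> plus
  1.\<close>

definition sup_bound :: "nat \<Rightarrow> real" where
  "sup_bound d = max (2 * ln (4 * exp 1 * 8 ^ d * fact d)) (2 * sqrt_bound d + 1)"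

lemma sup_bound_pos: "1 \<le> sup_bound d"
  using sqrt_bound_ge_1[of d] by (simp add: sup_bound_def)

text \<open>Half of the exponential pays for the polynomial, by
  \<open>(K / 2) ^ d \<le> fact d * exp (K / 2)\<close>; the other half is small by the choice of
  \<open>K\<close>.\<close>

lemma power_times_exp_small:
  fixes K :: real
  assumes "2 * ln (4 * exp 1 * 8 ^ d * fact d) \<le> K" "0 \<le> K"
  shows "(4 * K) ^ d * exp (1 - K) \<le> 1 / 4"
proof -
  let ?q = "4 * exp 1 * 8 ^ d * fact d :: real"
  have q: "0 < ?q" by simp
  have "4 * K = 8 * (K / 2)" by simp
  hence "(4 * K) ^ d = 8 ^ d * (K / 2) ^ d" by (simp only: power_mult_distrib[of 8 "K / 2"])
  also have "\<dots> \<le> 8 ^ d * (fact d * exp (K / 2))" using assms by (intro mult_left_mono power_le_fact_exp) auto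
  finally have "(4 * K) ^ d * exp (1 - K) \<le> 8 ^ d * (fact d * exp (K / 2)) * exp (1 - K)"
    by (intro mult_right_mono) auto
  also have "\<dots> = 8 ^ d * fact d * exp 1 * exp (- K / 2)"
  proof -
    have "K / 2 + (1 - K) = 1 + - K / 2" by simp
    hence "exp (K / 2) * exp (1 - K) = exp 1 * exp (- K / 2)" by (simp only: exp_add[symmetric])
    thus ?thesis by (simp add: mult_ac)
  qed
  also have "\<dots> \<le> 8 ^ d * fact d * exp 1 * (1 / ?q)"
  proof (intro mult_left_mono)
    have "ln ?q \<le> K / 2" using assms by simp
    hence "?q \<le> exp (K / 2)" using ln_le_iff[OF q] by blast
    hence "1 / exp (K / 2) \<le> 1 / ?q" using q by (intro divide_left_mono) auto
    moreover have "exp (- K / 2) = 1 / exp (K / 2)" by (simp add: exp_minus inverse_eq_divide)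
    ultimately show "exp (- K / 2) \<le> 1 / ?q" by simp
  qed auto
  also have "\<dots> = 1 / 4" by simp
  finally show ?thesis .
qed

text \<open>Everything derived here is deterministic. Apart from positivity, the sample enters
  through \<open>dev\<close> and \<open>conc\<close>, and the estimator \<open>g\<close> only
  through \<open>lik\<close>: its likelihood is compared with that of \<open>f\<close> and no other
  density.\<close>

locale good_sample =
  fixes f g :: "'a::euclidean_space \<Rightarrow> real" and x0 z0 :: 'a and M Mg :: real and X :: "nat \<Rightarrow> 'a" and n :: nat
    and \<eta> \<epsilon> :: real
  assumes f: "f \<in> log_concave_densities" and g: "g \<in> log_concave_densities"
    and M: "0 < M" "f x0 = M" "\<And>x. f x \<le> M" and Mg: "0 < Mg" "g z0 = Mg" "\<And>x. g x \<le> Mg"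
    and n: "0 < n"
    and dev: "\<And>C. closed C \<Longrightarrow> convex C \<Longrightarrow>
      (\<Sum>i<n. indicator C (X i)) \<le> real n * (measure (density lborel (\<lambda>x. ennreal (f x))) C + \<eta>)"
    and f_pos: "\<And>i. i < n \<Longrightarrow> 0 < f (X i)" and g_pos: "\<And>i. i < n \<Longrightarrow> 0 < g (X i)"
    and conc: "(\<Sum>i<n. ln (M / f (X i))) \<le> real n * ((\<integral>x. ln (M / f x) \<partial>density lborel (\<lambda>x. ennreal (f x))) + \<epsilon>)"
    and lik: "(\<Sum>i<n. ln (f (X i))) \<le> (\<Sum>i<n. ln (g (X i)))"
    and \<eta>: "0 < \<eta>" "\<eta> \<le> 1 / 4" and \<epsilon>: "\<epsilon> \<le> 1"
begin

abbreviation "P \<equiv> density lborel (\<lambda>x. ennreal (f x))"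
abbreviation "G \<equiv> (\<integral>x. ln (M / f x) \<partial>P)"

lemma ln_lik_lower: "real n * (ln M - G - \<epsilon>) \<le> (\<Sum>i<n. ln (g (X i)))"
proof -
  have "(\<Sum>i<n. ln (M / f (X i))) = (\<Sum>i<n. ln M - ln (f (X i)))"
  proof (intro sum.cong refl)
    fix i assume "i \<in> {..<n}"
    hence "0 < f (X i)" using f_pos by simp
    thus "ln (M / f (X i)) = ln M - ln (f (X i))" using M(1) by (simp add: ln_div)
  qed
  also have "\<dots> = real n * ln M - (\<Sum>i<n. ln (f (X i)))" by (simp add: sum_subtractf)
  finally show ?thesis using conc lik by (simp add: algebra_simps)
qed

text \<open>A very peaked \<open>g\<close> is large only on a set \<open>L\<close> of small volume,
  hence of small \<open>f\<close>-probability. By \<open>dev\<close> at least half of the sample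
  misses \<open>L\<close>, and the loss there outweighs the gain in height, against
  \<open>ln_lik_lower\<close>.\<close>

lemma mle_sup_bound: "ln (Mg / M) \<le> sup_bound DIM('a)"
proof (rule ccontr)
  define K where "K = ln (Mg / M)"
  assume "\<not> ?thesis"
  hence K: "sup_bound DIM('a) < K" by (simp add: K_def)
  have K1: "1 \<le> K" using K sup_bound_pos[of "DIM('a)"] by linarith
  \<comment> \<open>With half of the sample outside \<open>L\<close>, depth \<open>4 * K\<close>
    loses \<open>2 * K\<close> on average; the height \<open>ln Mg = ln M + K\<close> wins back only
    \<open>K\<close>.\<close>
  define L where "L = {x. Mg * exp (- (4 * K)) \<le> g x}"
  have pos: "0 < Mg * exp (- (4 * K))" using Mg by simp
  note g' = log_concave_densitiesD[OF g]
  have L: "closed L" "convex L" unfolding L_def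
    using log_concave_closed_superlevel[OF g'(2) pos] log_concave_convex_superlevel[OF g'(2) pos] by auto
  have "L \<in> fmeasurable lborel" unfolding L_def by (rule fmeasurable_compact[OF density_superlevel_compact[OF g pos]])
  hence "measure P L \<le> M * measure lborel L" using density_prob_le[OF f M(3)] by blast
  also have "measure lborel L \<le> (4 * K) ^ DIM('a) * exp 1 / Mg"
  proof -
    have "0 < g z0" using Mg by simp
    from superlevel_measure_growth[OF g this, unfolded Mg(2), OF Mg(3), of "4 * K"] K1 show ?thesis
      unfolding L_def by simp
  qed
  hence "M * measure lborel L \<le> M * ((4 * K) ^ DIM('a) * exp 1 / Mg)" using M by (intro mult_left_mono) auto
  also have "\<dots> = (4 * K) ^ DIM('a) * exp (1 - K)"
    using M Mg by (simp add: K_def exp_diff)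
  also have "\<dots> \<le> 1 / 4" using K K1 by (intro power_times_exp_small) (auto simp: sup_bound_def)
  finally have "measure P L + \<eta> \<le> 1 / 2" using \<eta> by linarith
  hence "real n * (measure P L + \<eta>) \<le> real n * (1 / 2)" by (intro mult_left_mono) auto
  hence cnt: "(\<Sum>i<n. indicator L (X i)) \<le> real n / 2" using dev[OF L] by linarith
  have "(\<Sum>i<n. ln (g (X i))) \<le> (\<Sum>i<n. ln Mg - 4 * K + 4 * K * indicator L (X i))"
  proof (intro sum_mono)
    fix i assume "i \<in> {..<n}"
    hence gi: "0 < g (X i)" using g_pos by simp
    show "ln (g (X i)) \<le> ln Mg - 4 * K + 4 * K * indicator L (X i)"
    proof (cases "X i \<in> L")
      case True thus ?thesis using gi Mg by simp
    next
      case False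
      hence "ln (g (X i)) \<le> ln (Mg * exp (- (4 * K)))" using gi pos by (subst ln_le_cancel_iff) (auto simp: L_def)
      thus ?thesis using False Mg by (simp add: ln_mult)
    qed
  qed
  also have "\<dots> = real n * (ln Mg - 4 * K) + 4 * K * (\<Sum>i<n. indicator L (X i))"
    by (simp add: sum.distrib sum_distrib_left)
  also have "\<dots> \<le> real n * (ln Mg - 4 * K) + 4 * K * (real n / 2)" using cnt K1 by (intro add_left_mono mult_left_mono) auto
  also have "\<dots> = real n * (ln Mg - 2 * K)" by (simp add: algebra_simps)
  finally have "real n * (ln M - G - \<epsilon>) \<le> real n * (ln Mg - 2 * K)" using ln_lik_lower by linarith
  hence "ln M - G - \<epsilon> \<le> ln Mg - 2 * K" using n by simp
  moreover have "ln Mg = ln M + K" using M Mg by (simp add: K_def ln_div)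
  moreover have "G \<le> 2 * sqrt_bound DIM('a)" using log_deficit_moments(5)[OF f M] .
  ultimately show False using K \<epsilon> by (simp add: sup_bound_def)
qed

text \<open>\<open>ln r \<le> 2 * (sqrt r - 1)\<close> with \<open>r = p x / f x\<close> turns the
  expectation of \<open>ln (f / p)\<close> into a Hellinger affinity. The truncation
  \<open>p = max g a\<close> is not a density, but \<open>sqrt p \<le> sqrt g + sqrt a\<close>, so
  it costs only a multiple of \<open>sqrt a\<close> times the integral of
  \<open>sqrt f\<close>.\<close>

lemma mle_hellinger:
  assumes \<alpha>: "0 < \<alpha>" "\<alpha> \<le> 1"
  shows "hellinger_sq g f \<le> (\<epsilon> + \<eta> * (2 + sup_bound DIM('a) + ln (1 / \<alpha>))) / 2 + sqrt \<alpha> * sqrt_bound DIM('a)"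
proof -
  note f' = log_concave_densitiesD[OF f] and g' = log_concave_densitiesD[OF g]
  note [measurable] = f'(4) g'(4)
  interpret P: prob_space P using density_prob_space[OF f] .
  \<comment> \<open>Taking the cut-off relative to \<open>M\<close> makes the range of
    \<open>v\<close> and the cost of truncation independent of scale.\<close>
  define a where "a = M * \<alpha>"
  have a: "0 < a" using M \<alpha> by (simp add: a_def)
  define \<Lambda> where "\<Lambda> = sup_bound DIM('a) + ln (1 / \<alpha>)"
  define p where "p x = max (g x) a" for x
  define v where "v x = ln (p x / a)" for x
  have p: "0 < p x" "a \<le> p x" for x using a by (auto simp: p_def)
  have l\<alpha>: "0 \<le> ln (1 / \<alpha>)" using \<alpha> by simp
  have \<Lambda>0: "0 \<le> \<Lambda>" unfolding \<Lambda>_def using l\<alpha> sup_bound_pos[of "DIM('a)"] by linarith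
  have v0: "0 \<le> v x" for x unfolding v_def using p[of x] a by simp
  have v\<Lambda>: "v x \<le> \<Lambda>" for x
  proof (cases "g x \<le> a")
    case True thus ?thesis using a \<Lambda>0 by (simp add: v_def p_def)
  next
    case False
    hence gx: "0 < g x" "p x = g x" using a by (auto simp: p_def)
    have "v x = ln (g x) - ln M - ln \<alpha>" unfolding v_def gx(2) a_def using gx M \<alpha> by (simp add: ln_div ln_mult)
    also have "ln (g x) \<le> ln Mg" using gx(1) Mg by simp
    also have "ln Mg - ln M - ln \<alpha> = ln (Mg / M) + ln (1 / \<alpha>)" using M Mg \<alpha> by (simp add: ln_div)
    also have "\<dots> \<le> \<Lambda>" unfolding \<Lambda>_def using mle_sup_bound by simp
    finally show ?thesis by simp
  qed
  define N where "N = nat \<lceil>\<Lambda> / \<eta>\<rceil>"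
  define C where "C k = {x. a * exp (real k * \<eta>) \<le> g x}" for k :: nat
  have Cpos: "0 < a * exp (real k * \<eta>)" for k using a by simp
  have C: "closed (C k)" "convex (C k)" "C k \<in> sets borel" for k unfolding C_def
    using log_concave_closed_superlevel[OF g'(2) Cpos] log_concave_convex_superlevel[OF g'(2) Cpos] by auto
  \<comment> \<open>For \<open>k \<ge> 1\<close> the level exceeds \<open>a\<close>, so the
    superlevel set of the truncated function is that of \<open>g\<close>, which is convex. At
    \<open>k = 0\<close> this can fail: \<open>p \<ge> a\<close> everywhere, while
    \<open>C 0\<close> may be smaller.\<close>
  have Cv: "indicator (C k) x = (of_bool (real k * \<eta> \<le> v x) :: real)" if "k \<in> {1..N}" for k x
  proof -
    have k: "0 < real k * \<eta>" using that \<eta> by simp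
    have "real k * \<eta> \<le> v x \<longleftrightarrow> exp (real k * \<eta>) \<le> p x / a" unfolding v_def using p[of x] a by (subst ln_ge_iff) auto
    also have "\<dots> \<longleftrightarrow> a * exp (real k * \<eta>) \<le> p x" using a by (simp add: field_simps)
    also have "\<dots> \<longleftrightarrow> x \<in> C k"
    proof -
      have "a * 1 < a * exp (real k * \<eta>)" using a k by (intro mult_strict_left_mono) auto
      thus ?thesis by (auto simp: p_def C_def)
    qed
    finally show ?thesis by (simp add: indicator_def of_bool_def)
  qed
  define V where "V x = (\<Sum>k\<in>{1..N}. \<eta> * indicator (C k) x)" for x
  have V: "V x \<le> v x" "v x \<le> V x + \<eta>" for x
  proof -
    have "V x = (\<Sum>k\<in>{1..N}. \<eta> * of_bool (real k * \<eta> \<le> v x))" unfolding V_def by (intro sum.cong) (auto simp: Cv)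
    thus "V x \<le> v x" "v x \<le> V x + \<eta>" using layer_sum[OF v0[of x] v\<Lambda>[of x] \<eta>(1)] by (simp_all add: N_def)
  qed
  have vm: "v \<in> borel_measurable borel" unfolding v_def p_def by measurable
  have vP: "integrable P v"
    by (rule P.integrable_const_bound[where B=\<Lambda>]) (use v0 v\<Lambda> vm in auto)
  have VP: "integrable P V" "(\<integral>x. V x \<partial>P) = (\<Sum>k\<in>{1..N}. \<eta> * measure P (C k))"
  proof -
    have i: "integrable P (\<lambda>x. \<eta> * indicator (C k) x)" for k
      using C P.emeasure_finite[of "C k"] top.not_eq_extremum[of "emeasure P (C k)"]
      by (intro integrable_mult_right integrable_real_indicator) simp_all
    show "integrable P V" unfolding V_def by (intro Bochner_Integration.integrable_sum i)
    have "(\<integral>x. V x \<partial>P) = (\<Sum>k\<in>{1..N}. \<integral>x. \<eta> * indicator (C k) x \<partial>P)"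
      unfolding V_def by (intro Bochner_Integration.integral_sum i)
    also have "\<dots> = (\<Sum>k\<in>{1..N}. \<eta> * measure P (C k))" using C by simp
    finally show "(\<integral>x. V x \<partial>P) = (\<Sum>k\<in>{1..N}. \<eta> * measure P (C k))" .
  qed
  \<comment> \<open>There are \<open>N\<close> levels of weight \<open>\<eta>\<close>, each with a
    frequency error \<open>\<eta>\<close>: in total
    \<open>N * \<eta> * \<eta> \<le> (\<Lambda> + 1) * \<eta>\<close>. With the rounding error
    \<open>\<eta>\<close> of \<open>V\<close> this becomes
    \<open>\<eta> * (2 + \<Lambda>)\<close>.\<close>
  have "real N \<le> \<Lambda> / \<eta> + 1" unfolding N_def using \<Lambda>0 \<eta> by (simp add: of_nat_ceiling)
  hence "real N * \<eta> \<le> (\<Lambda> / \<eta> + 1) * \<eta>" using \<eta> by (intro mult_right_mono) auto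
  moreover have "(\<Lambda> / \<eta> + 1) * \<eta> = \<Lambda> + \<eta>" using \<eta> by (simp add: distrib_right)
  ultimately have N\<eta>: "real N * \<eta> \<le> \<Lambda> + 1" using \<eta> by linarith
  have "(\<Sum>i<n. ln (g (X i))) \<le> (\<Sum>i<n. ln a + \<eta> + V (X i))"
  proof (intro sum_mono)
    fix i assume "i \<in> {..<n}"
    hence "ln (g (X i)) \<le> ln (p (X i))" using g_pos p by (subst ln_le_cancel_iff) (auto simp: p_def)
    also have "\<dots> = ln a + v (X i)" unfolding v_def using p[of "X i"] a by (simp add: ln_div)
    finally show "ln (g (X i)) \<le> ln a + \<eta> + V (X i)" using V(2)[of "X i"] by linarith
  qed
  also have "\<dots> = real n * (ln a + \<eta>) + (\<Sum>i<n. V (X i))" by (simp add: sum.distrib distrib_left)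
  also have "(\<Sum>i<n. V (X i)) = (\<Sum>k\<in>{1..N}. \<Sum>i<n. \<eta> * indicator (C k) (X i))" unfolding V_def by (rule sum.swap)
  also have "\<dots> = (\<Sum>k\<in>{1..N}. \<eta> * (\<Sum>i<n. indicator (C k) (X i)))" by (simp only: sum_distrib_left)
  also have "real n * (ln a + \<eta>) + (\<Sum>k\<in>{1..N}. \<eta> * (\<Sum>i<n. indicator (C k) (X i)))
      \<le> real n * (ln a + \<eta>) + (\<Sum>k\<in>{1..N}. \<eta> * (real n * (measure P (C k) + \<eta>)))"
    using \<eta> dev[OF C(1,2)] by (intro add_left_mono sum_mono mult_left_mono) auto
  also have "\<dots> = real n * (ln a + \<eta> + (\<integral>x. V x \<partial>P) + real N * \<eta> * \<eta>)"
    unfolding VP(2) by (simp add: sum_distrib_left sum.distrib distrib_left mult_ac)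
  also have "\<dots> \<le> real n * (ln a + \<eta> + (\<integral>x. v x \<partial>P) + (\<Lambda> + 1) * \<eta>)"
    using V(1) VP vP N\<eta> \<eta> by (intro mult_left_mono add_mono integral_mono mult_right_mono) auto
  finally have "real n * (ln M - G - \<epsilon>) \<le> real n * (ln a + \<eta> + (\<integral>x. v x \<partial>P) + (\<Lambda> + 1) * \<eta>)"
    using ln_lik_lower by linarith
  hence "ln M - G - \<epsilon> \<le> ln a + \<eta> + (\<integral>x. v x \<partial>P) + (\<Lambda> + 1) * \<eta>" using n by simp
  hence key: "ln M - ln a - G - (\<integral>x. v x \<partial>P) \<le> \<epsilon> + \<eta> * (2 + \<Lambda>)" by (simp add: algebra_simps)
  have fv: "integrable lborel (\<lambda>x. f x * v x)" "(\<integral>x. v x \<partial>P) = (\<integral>x. f x * v x \<partial>lborel)"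
    using vP vm f'(3) by (simp_all add: integrable_density integral_density)
  have fG: "integrable lborel (\<lambda>x. f x * ln (M / f x))" "G = (\<integral>x. f x * ln (M / f x) \<partial>lborel)"
    using log_deficit_moments(3,4)[OF f M] by auto
  have "0 < f x0" using M by simp
  note sqf = sqrt_density_integral[OF f this, unfolded M(2), OF M(3)]
  have isq: "integrable lborel (\<lambda>x. sqrt (g x) * sqrt (f x))"
  proof (rule Bochner_Integration.integrable_bound[where f="\<lambda>x. g x + f x"])
    have "norm (sqrt (g x) * sqrt (f x)) \<le> norm (g x + f x)" for x
    proof -
      have "0 \<le> (sqrt (g x) - sqrt (f x))\<^sup>2" by simp
      hence "2 * (sqrt (g x) * sqrt (f x)) \<le> g x + f x"
        unfolding power2_diff using f'(3)[of x] g'(3)[of x] by simp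
      moreover have "0 \<le> sqrt (g x) * sqrt (f x)" using f'(3)[of x] g'(3)[of x] by simp
      ultimately show ?thesis unfolding real_norm_def by linarith
    qed
    thus "AE x in lborel. norm (sqrt (g x) * sqrt (f x)) \<le> norm (g x + f x)" by simp
  qed (use f' g' in auto)
  \<comment> \<open>For \<open>f x > 0\<close> the right side is
    \<open>f x * ln (f x / p x)\<close>, since \<open>M\<close> and \<open>a\<close> cancel.\<close>
  have pt: "2 * f x - 2 * (sqrt (g x) * sqrt (f x)) - 2 * sqrt a * sqrt (f x)
      \<le> (ln M - ln a) * f x - f x * ln (M / f x) - f x * v x" for x
  proof (cases "f x = 0")
    case False
    hence fx: "0 < f x" using f'(3)[of x] by simp
    let ?r = "p x / f x"
    have r: "0 < ?r" using p fx by simp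
    have "ln (sqrt ?r) \<le> sqrt ?r - 1" using r by (intro ln_le_minus_one) auto
    hence "ln ?r \<le> 2 * (sqrt ?r - 1)" using r by (simp add: ln_sqrt)
    hence "f x * ln ?r \<le> f x * (2 * (sqrt ?r - 1))" using fx by (intro mult_left_mono) auto
    also have "\<dots> = 2 * (f x * sqrt ?r) - 2 * f x" by (simp add: algebra_simps)
    also have "f x * sqrt ?r = sqrt (p x) * sqrt (f x)"
    proof -
      define s where "s = sqrt (f x)"
      have s: "0 < s" "f x = s * s" using fx by (auto simp: s_def)
      have "sqrt ?r = sqrt (p x) / s" by (simp add: real_sqrt_divide s_def)
      thus ?thesis unfolding s_def[symmetric] using s by simp
    qed
    also have "sqrt (p x) * sqrt (f x) \<le> (sqrt (g x) + sqrt a) * sqrt (f x)"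
    proof (intro mult_right_mono)
      show "sqrt (p x) \<le> sqrt (g x) + sqrt a" using g'(3)[of x] a by (auto simp: p_def max_def)
    qed (use fx in auto)
    finally have "f x * ln ?r \<le> 2 * ((sqrt (g x) + sqrt a) * sqrt (f x)) - 2 * f x" by simp
    moreover have "(ln M - ln a) * f x - f x * ln (M / f x) - f x * v x = - (f x * ln ?r)"
      unfolding v_def using fx p[of x] a M by (simp add: ln_div algebra_simps)
    ultimately show ?thesis by (simp add: algebra_simps)
  qed simp
  have aux: "1 - I \<le> e / 2 + q" if "2 - 2 * I - 2 * q \<le> e" for I e q :: real using that by linarith
  have "(\<integral>x. 2 * f x - 2 * (sqrt (g x) * sqrt (f x)) - 2 * sqrt a * sqrt (f x) \<partial>lborel)
      \<le> (\<integral>x. (ln M - ln a) * f x - f x * ln (M / f x) - f x * v x \<partial>lborel)"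
    using f' isq sqf fG fv by (intro integral_mono pt Bochner_Integration.integrable_diff integrable_mult_right) auto
  also have "\<dots> = ln M - ln a - G - (\<integral>x. v x \<partial>P)" using f' fG fv by simp
  also note key
  also have "(\<integral>x. 2 * f x - 2 * (sqrt (g x) * sqrt (f x)) - 2 * sqrt a * sqrt (f x) \<partial>lborel)
     = 2 - 2 * (\<integral>x. sqrt (g x) * sqrt (f x) \<partial>lborel) - 2 * sqrt a * (\<integral>x. sqrt (f x) \<partial>lborel)"
    using f' isq sqf by simp
  finally have 1: "1 - (\<integral>x. sqrt (g x) * sqrt (f x) \<partial>lborel) \<le> (\<epsilon> + \<eta> * (2 + \<Lambda>)) / 2 + sqrt a * (\<integral>x. sqrt (f x) \<partial>lborel)"
    by (intro aux) (simp only: mult.assoc)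
  have "sqrt a * (\<integral>x. sqrt (f x) \<partial>lborel) = sqrt \<alpha> * (sqrt M * (\<integral>x. sqrt (f x) \<partial>lborel))"
    by (simp add: a_def real_sqrt_mult)
  also have "\<dots> \<le> sqrt \<alpha> * sqrt_bound DIM('a)" using sqf(2) \<alpha> by (intro mult_left_mono) auto
  finally have 2: "sqrt a * (\<integral>x. sqrt (f x) \<partial>lborel) \<le> sqrt \<alpha> * sqrt_bound DIM('a)" .
  have "(\<lambda>x. (sqrt (g x) - sqrt (f x))\<^sup>2) = (\<lambda>x. g x + f x - 2 * (sqrt (g x) * sqrt (f x)))"
    using f'(3) g'(3) by (auto simp: power2_diff)
  hence "hellinger_sq g f = 1 - (\<integral>x. sqrt (g x) * sqrt (f x) \<partial>lborel)"
    unfolding hellinger_sq_def using f' g' isq by simp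
  also note order_trans[OF 1 add_left_mono[OF 2]]
  finally show ?thesis by (simp only: \<Lambda>_def add.assoc)
qed

end

section \<open>Sample size\<close>

text \<open>The constant is such that \<open>2 * dev_level d \<epsilon>\<close> times the logarithmic range of the truncated
  estimator in \<open>mle_hellinger\<close>, for the truncation \<open>\<alpha> = (\<epsilon> / (4 * sqrt_bound d))^2\<close>, is at most \<open>\<epsilon> / 2\<close>.\<close>

definition dev_const :: "nat \<Rightarrow> real" where
  "dev_const d = 4 + sup_bound d + 2 * ln (4 * sqrt_bound d)"

lemma dev_const_ge: "5 \<le> dev_const d"
proof -
  have "0 \<le> ln (4 * sqrt_bound d)" using sqrt_bound_ge_1[of d] by simp
  thus ?thesis using sup_bound_pos[of d] unfolding dev_const_def by linarith
qed

lemma ln_exp1_div: "0 < \<epsilon> \<Longrightarrow> ln (exp 1 / \<epsilon>) = 1 + ln (1 / \<epsilon>)" for \<epsilon> :: real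
  by (simp add: ln_div)

definition dev_level :: "nat \<Rightarrow> real \<Rightarrow> real" where
  "dev_level d \<epsilon> = \<epsilon> / (4 * dev_const d * ln (exp 1 / \<epsilon>))"

text \<open>With \<open>L = ln (exp 1 / \<epsilon>)\<close>, the radius \<open>R\<close> is of order
  \<open>L\<close> and \<open>R / t\<close> of order \<open>L ^ (d + 2) / \<epsilon>\<close>. Its
  root to the power \<open>d - 1\<close> yields the power of \<open>1 / \<epsilon>\<close>, and the
  logarithm in \<open>net_entropy\<close> one more \<open>L\<close>. Nonnegativity is recorded for
  the later step from \<open>1 + exp S\<close> to \<open>2 * exp S\<close>.\<close>

lemma cover_entropy_bound:
  fixes d :: nat
  assumes d: "1 \<le> d"
  obtains c where "0 \<le> c"
    "\<And>\<epsilon>. 0 < \<epsilon> \<Longrightarrow> \<epsilon> < 1 \<Longrightarrow> 0 \<le> cover_entropy d (dev_level d \<epsilon>) \<and> cover_entropy d (dev_level d \<epsilon>)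
      \<le> c * ln (exp 1 / \<epsilon>) ^ ((d + 2) * (d - 1) + 1) * (1 / \<epsilon>) powr ((real d - 1) / 2)"
proof -
  define B c1 where "B = sqrt_bound d" and "c1 = dev_const d"
  have B: "1 \<le> B" unfolding B_def by (rule sqrt_bound_ge_1)
  have c1: "5 \<le> c1" unfolding c1_def by (rule dev_const_ge)
  have dr: "1 \<le> real d" using d by simp
  have Bc: "1 \<le> B * c1" using mult_mono[of 1 B 1 c1] B c1 by simp
  define c2 where "c2 = ln (8 * B * c1) + 2"
  have c2: "2 \<le> c2" unfolding c2_def using Bc by simp
  define A where "A = 16 * exp 1 * real d ^ 2 * (6 * real d) ^ d"
  have A: "1 \<le> A"
  proof -
    have "16 * 1 * 1 * 1 \<le> A" unfolding A_def using dr by (intro mult_mono one_le_power) auto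
    thus ?thesis by simp
  qed
  define c3 where "c3 = A * (6 * c2) ^ (d + 1) * (4 * c1)"
  have c3: "1 \<le> c3"
  proof -
    have "1 * 1 * 1 \<le> c3" unfolding c3_def using A c1 c2 by (intro mult_mono one_le_power) auto
    thus ?thesis by simp
  qed
  define c4 where "c4 = ln (74 * real d ^ 2 * c3) + real d + 3"
  have d2: "1 \<le> real d ^ 2" using dr by simp
  have c3d: "1 \<le> 74 * real d ^ 2 * c3" using mult_mono[OF d2 c3] by simp
  have c4: "0 \<le> c4" unfolding c4_def using c3d by simp
  define c where "c = 2 * real d ^ 2 * (18 * real d) ^ (d - 1) * sqrt c3 ^ (d - 1) * c4"
  show ?thesis
  proof (rule that[of c])
    show "0 \<le> c" unfolding c_def using c4 c3 by simp
    fix \<epsilon> :: real assume \<epsilon>: "0 < \<epsilon>" "\<epsilon> < 1"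
    define L \<delta> where L: "L = ln (exp 1 / \<epsilon>)" and "\<delta> = dev_level d \<epsilon>"
    define R t where "R = box_radius d \<delta>" and "t = net_scale d \<delta>"
    have \<delta>: "\<delta> = \<epsilon> / (4 * dev_const d * L)" by (simp add: \<delta>_def dev_level_def L)
    have R: "R = 6 * ln (2 * sqrt_bound d / \<delta>)" by (simp add: R_def box_radius_def)
    have t: "t = \<delta> / (16 * exp 1 * real d ^ 2 * (6 * R * real d) ^ d)" by (simp add: t_def net_scale_def R_def)
    have le: "0 \<le> ln (1 / \<epsilon>)" using \<epsilon> by simp
    have L1: "1 \<le> L" "ln (1 / \<epsilon>) = L - 1" using L ln_exp1_div[OF \<epsilon>(1)] le by auto
    have lL: "ln L \<le> L" "0 \<le> ln L" using L1 by (auto intro: ln_bound)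
    have c1L: "0 < 4 * c1 * L" using c1 L1 by simp
    have \<delta>0: "0 < \<delta>" using \<delta> \<epsilon> c1L by (simp add: c1_def)
    have id: "1 / \<delta> = 4 * c1 * L * (1 / \<epsilon>)" unfolding \<delta> c1_def by simp
    have "2 * sqrt_bound d / \<delta> = 2 * B * (1 / \<delta>)" by (simp add: B_def)
    also have "\<dots> = (8 * B * c1) * L * (1 / \<epsilon>)" unfolding id by simp
    finally have q: "2 * sqrt_bound d / \<delta> = (8 * B * c1) * L * (1 / \<epsilon>)" .
    have Bc0: "0 < 8 * B * c1" using B c1 by simp
    have "ln ((8 * B * c1) * L * (1 / \<epsilon>)) = ln (8 * B * c1) + ln L + ln (1 / \<epsilon>)"
      using ln_mult_pos[of "8 * B * c1 * L" "1 / \<epsilon>"] ln_mult_pos[OF Bc0, of L] Bc0 L1(1) \<epsilon> by simp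
    hence R': "R = 6 * (ln (8 * B * c1) + ln L + (L - 1))" unfolding R q L1(2)[symmetric] by simp
    have "ln (8 * B * c1) + ln L + (L - 1) \<le> ln (8 * B * c1) * L + 2 * L"
    proof -
      have "ln (8 * B * c1) * 1 \<le> ln (8 * B * c1) * L" using L1 Bc by (intro mult_left_mono) auto
      thus ?thesis using lL by linarith
    qed
    hence Rle: "R \<le> 6 * c2 * L" unfolding R' c2_def by (simp add: algebra_simps)
    have lc1: "1 \<le> ln (8 * B * c1)"
    proof -
      have "exp 1 \<le> (3::real)" by (rule exp_le)
      also have "\<dots> \<le> 8 * (B * c1)" using Bc by linarith
      finally have "exp 1 \<le> 8 * B * c1" by (simp add: mult.assoc)
      thus ?thesis using Bc0 by (simp add: ln_ge_iff)
    qed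
    have aux: "1 \<le> 6 * (u + v + w)" if "1 \<le> u" "0 \<le> v" "0 \<le> w" for u v w :: real
      using that by (simp add: distrib_left)
    have R1: "1 \<le> R" unfolding R' using lc1 lL(2) L1(1) by (intro aux) auto
    have Rt: "R / t = A * R ^ (d + 1) * (1 / \<delta>)"
      unfolding t A_def using \<delta>0 R1 by (simp add: power_mult_distrib)
    have Rt0: "0 < R / t" unfolding Rt using A R1 \<delta>0 by simp
    have "R ^ (d + 1) \<le> (6 * c2 * L) ^ (d + 1)" using Rle R1 by (intro power_mono) auto
    hence "A * R ^ (d + 1) * (1 / \<delta>) \<le> A * (6 * c2 * L) ^ (d + 1) * (1 / \<delta>)"
      using A \<delta>0 by (intro mult_right_mono mult_left_mono) auto
    also have "\<dots> = c3 * L ^ (d + 2) * (1 / \<epsilon>)" unfolding id c3_def by (simp add: power_mult_distrib)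
    finally have Rtle: "R / t \<le> c3 * L ^ (d + 2) * (1 / \<epsilon>)" unfolding Rt .
    have 1: "sqrt (R / t) ^ (d - 1) \<le> sqrt c3 ^ (d - 1) * L ^ ((d + 2) * (d - 1)) * (1 / \<epsilon>) powr ((real d - 1) / 2)"
    proof -
      \<comment> \<open>Crude, but only the power of the logarithm suffers, and its exponent stays
        an integer.\<close>
      have "sqrt (L ^ (d + 2)) \<le> L ^ (d + 2)"
      proof -
        define y where "y = L ^ (d + 2)"
        have "1 \<le> y" unfolding y_def using L1(1) by (rule one_le_power)
        hence "sqrt y \<le> y" by (intro real_le_lsqrt) (auto simp: power2_eq_square)
        thus ?thesis by (simp add: y_def)
      qed
      have "sqrt (R / t) \<le> sqrt (c3 * L ^ (d + 2) * (1 / \<epsilon>))" using Rtle by (rule real_sqrt_le_mono)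
      also have "\<dots> = sqrt c3 * sqrt (L ^ (d + 2)) * sqrt (1 / \<epsilon>)" by (simp only: real_sqrt_mult)
      also have "\<dots> \<le> sqrt c3 * L ^ (d + 2) * sqrt (1 / \<epsilon>)"
        using \<open>sqrt (L ^ (d + 2)) \<le> L ^ (d + 2)\<close> c3 \<epsilon> by (intro mult_right_mono mult_left_mono) auto
      finally have "sqrt (R / t) ^ (d - 1) \<le> (sqrt c3 * L ^ (d + 2) * sqrt (1 / \<epsilon>)) ^ (d - 1)"
        using Rt0 by (intro power_mono) auto
      also have "\<dots> = sqrt c3 ^ (d - 1) * L ^ ((d + 2) * (d - 1)) * sqrt (1 / \<epsilon>) ^ (d - 1)"
        by (simp only: power_mult_distrib power_mult)
      also have "sqrt (1 / \<epsilon>) ^ (d - 1) = (1 / \<epsilon>) powr ((real d - 1) / 2)"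
      proof -
        have "sqrt (1 / \<epsilon>) ^ (d - 1) = ((1 / \<epsilon>) powr (1 / 2)) powr real (d - 1)"
          using \<epsilon> by (subst powr_realpow) (auto simp: powr_half_sqrt)
        also have "\<dots> = (1 / \<epsilon>) powr ((1 / 2) * real (d - 1))" by (rule powr_powr)
        also have "(1 / 2) * real (d - 1) = (real d - 1) / 2" using d by (simp add: of_nat_diff)
        finally show ?thesis .
      qed
      finally show ?thesis .
    qed
    have tR: "1 \<le> R / t"
    proof -
      have "\<delta> \<le> 1"
      proof -
        have "1 \<le> 4 * c1 * L" using mult_mono[of 1 "4 * c1" 1 L] c1 L1 by simp
        hence "\<epsilon> \<le> 1 * (4 * c1 * L)" using \<epsilon> by linarith
        thus ?thesis unfolding \<delta> c1_def[symmetric] using c1L by (subst pos_divide_le_eq) auto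
      qed
      hence "1 * 1 * 1 \<le> A * R ^ (d + 1) * (1 / \<delta>)" using A R1 \<delta>0 by (intro mult_mono one_le_power) auto
      thus ?thesis unfolding Rt by simp
    qed
    have arg: "1 \<le> 74 * real d ^ 2 * R / t" using mult_mono[OF d2 tR] by simp
    have 2: "ln (74 * real d ^ 2 * R / t) \<le> c4 * L"
    proof -
      have "74 * real d ^ 2 * R / t = 74 * real d ^ 2 * (R / t)" by simp
      also have "\<dots> \<le> 74 * real d ^ 2 * (c3 * L ^ (d + 2) * (1 / \<epsilon>))" using Rtle by (intro mult_left_mono) auto
      also have "\<dots> = (74 * real d ^ 2 * c3) * L ^ (d + 2) * (1 / \<epsilon>)" by simp
      finally have "ln (74 * real d ^ 2 * R / t) \<le> ln ((74 * real d ^ 2 * c3) * L ^ (d + 2) * (1 / \<epsilon>))"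
        using arg by (intro ln_mono) auto
      also have "\<dots> = ln (74 * real d ^ 2 * c3) + real (d + 2) * ln L + ln (1 / \<epsilon>)"
      proof -
        have a: "0 < 74 * real d ^ 2 * c3" using c3d by linarith
        have b: "0 < L ^ (d + 2)" using L1 by simp
        have e: "0 < 1 / \<epsilon>" using \<epsilon> by simp
        have "ln ((74 * real d ^ 2 * c3) * L ^ (d + 2) * (1 / \<epsilon>)) = ln (74 * real d ^ 2 * c3) + ln (L ^ (d + 2)) + ln (1 / \<epsilon>)"
          using ln_mult_pos[OF mult_pos_pos[OF a b] e] ln_mult_pos[OF a b] by simp
        thus ?thesis using L1 by (simp only: ln_realpow)
      qed
      also have "\<dots> \<le> ln (74 * real d ^ 2 * c3) * L + real (d + 2) * L + L"
      proof (intro add_mono mult_left_mono)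
        show "ln (74 * real d ^ 2 * c3) \<le> ln (74 * real d ^ 2 * c3) * L"
          using mult_left_mono[OF L1(1), of "ln (74 * real d ^ 2 * c3)"] c3d by simp
      qed (use lL L1 in auto)
      also have "\<dots> = c4 * L" by (simp add: c4_def algebra_simps)
      finally show ?thesis .
    qed
    have l0: "0 \<le> ln (74 * real d ^ 2 * R / t)" using arg by simp
    have pre: "0 \<le> 2 * real d ^ 2 * (18 * real d) ^ (d - 1)" by simp
    have ne0: "0 \<le> net_entropy d R t" unfolding net_entropy_def using l0 Rt0 pre by (intro mult_nonneg_nonneg) auto
    have "net_entropy d R t \<le> 2 * real d ^ 2 * (18 * real d) ^ (d - 1) *
        (sqrt c3 ^ (d - 1) * L ^ ((d + 2) * (d - 1)) * (1 / \<epsilon>) powr ((real d - 1) / 2)) * (c4 * L)"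
      unfolding net_entropy_def using 1 2 l0 Rt0 pre c3 L1
      by (intro mult_mono mult_left_mono mult_nonneg_nonneg) auto
    also have "\<dots> = c * L ^ ((d + 2) * (d - 1) + 1) * (1 / \<epsilon>) powr ((real d - 1) / 2)"
      unfolding c_def power_add power_one_right by (simp only: mult_ac)
    finally show "0 \<le> cover_entropy d (dev_level d \<epsilon>) \<and> cover_entropy d (dev_level d \<epsilon>)
      \<le> c * ln (exp 1 / \<epsilon>) ^ ((d + 2) * (d - 1) + 1) * (1 / \<epsilon>) powr ((real d - 1) / 2)"
      using ne0 by (simp only: cover_entropy_def \<delta>_def R_def t_def L)
  qed
qed

lemma sample_size_suffices:
  fixes d :: nat
  assumes d: "1 \<le> d"
  obtains C c where "0 < C" "0 < c"
    "\<And>\<epsilon> n. 0 < \<epsilon> \<Longrightarrow> \<epsilon> < 1 \<Longrightarrow>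
      C * (1 / \<epsilon>) powr ((real d + 3) / 2) * ln (exp 1 / \<epsilon>) powr c \<le> real n \<Longrightarrow>
      0 < n \<and> (1 + exp (cover_entropy d (dev_level d \<epsilon>))) * exp (- 2 * real n * (dev_level d \<epsilon>)\<^sup>2) \<le> 1 / 20 \<and>
      16 * sqrt_bound d / (real n * (\<epsilon> / 2)\<^sup>2) \<le> 1 / 20"
proof -
  obtain c5 where c5: "0 \<le> c5"
    "\<And>\<epsilon>. 0 < \<epsilon> \<Longrightarrow> \<epsilon> < 1 \<Longrightarrow> 0 \<le> cover_entropy d (dev_level d \<epsilon>) \<and> cover_entropy d (dev_level d \<epsilon>)
      \<le> c5 * ln (exp 1 / \<epsilon>) ^ ((d + 2) * (d - 1) + 1) * (1 / \<epsilon>) powr ((real d - 1) / 2)"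
    by (rule cover_entropy_bound[OF d]) (rule that)
  define B c1 where "B = sqrt_bound d" and "c1 = dev_const d"
  have B: "1 \<le> B" unfolding B_def by (rule sqrt_bound_ge_1)
  have c1: "5 \<le> c1" unfolding c1_def by (rule dev_const_ge)
  define m where "m = (d + 2) * (d - 1) + 1"
  \<comment> \<open>The first summand serves Hoeffding's bound, where \<open>1 / \<delta>^2\<close>
    is \<open>16 * c1^2 * L^2 / \<epsilon>^2\<close>; the second serves Chebyshev's, with
    \<open>1280 = 16 * 20 * 4\<close>. The 40 leaves a factor \<open>exp (- 40)\<close> once the
    entropy is paid for.\<close>
  define C where "C = 8 * c1\<^sup>2 * (c5 + 40) + 1280 * B"
  have c1sq: "0 \<le> 8 * c1\<^sup>2 * (c5 + 40)" using c5(1) by simp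
  have C0: "0 < C" unfolding C_def using B c1sq by linarith
  show ?thesis
  \<comment> \<open>\<open>m\<close> logarithms come from the entropy and two more from
    \<open>1 / \<delta>^2\<close>.\<close>
  proof (rule that[of C "real (m + 2)"])
    show "0 < C" "0 < real (m + 2)" using C0 by auto
    fix \<epsilon> :: real and n :: nat
    assume \<epsilon>: "0 < \<epsilon>" "\<epsilon> < 1"
      and n: "C * (1 / \<epsilon>) powr ((real d + 3) / 2) * ln (exp 1 / \<epsilon>) powr real (m + 2) \<le> real n"
    define L \<delta> S where L: "L = ln (exp 1 / \<epsilon>)" and "\<delta> = dev_level d \<epsilon>" and "S = cover_entropy d \<delta>"
    have \<delta>: "\<delta> = \<epsilon> / (4 * dev_const d * L)" by (simp add: \<delta>_def dev_level_def L)
    note E = c5(2)[OF \<epsilon>, folded m_def \<delta>_def L, folded S_def] and n = n[folded L]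
    have L1: "1 \<le> L" using L ln_exp1_div[OF \<epsilon>(1)] \<epsilon> by simp
    have Lp: "L powr real (m + 2) = L ^ (m + 2)" using L1 by (intro powr_realpow) auto
    have e1: "1 \<le> 1 / \<epsilon>" using \<epsilon> by simp
    define w where "w = (1 / \<epsilon>) powr ((real d - 1) / 2)"
    have w: "1 \<le> w" unfolding w_def using e1 d by (intro ge_one_powr_ge_zero) auto
    have pw: "(1 / \<epsilon>) powr ((real d + 3) / 2) = w * (1 / \<epsilon>)\<^sup>2"
    proof -
      have "(real d + 3) / 2 = (real d - 1) / 2 + 2" by (simp add: field_simps)
      hence "(1 / \<epsilon>) powr ((real d + 3) / 2) = w * (1 / \<epsilon>) powr 2"
        unfolding w_def by (simp only: powr_add)
      also have "(1 / \<epsilon>) powr 2 = (1 / \<epsilon>)\<^sup>2" using \<epsilon> by (simp add: powr_numeral)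
      finally show ?thesis .
    qed
    have wL: "1 \<le> w * L ^ (m + 2)" using mult_mono[OF w one_le_power[OF L1, of "m + 2"]] w by simp
    have n': "C * (w * L ^ (m + 2)) * (1 / \<epsilon>)\<^sup>2 \<le> real n" using n unfolding pw Lp by (simp add: mult_ac)
    have i2: "1 \<le> (1 / \<epsilon>)\<^sup>2" using e1 by (rule one_le_power)
    have "0 < w * L ^ (m + 2)" "0 < (1 / \<epsilon>)\<^sup>2" using wL i2 by linarith+
    hence pos: "0 < C * (w * L ^ (m + 2)) * (1 / \<epsilon>)\<^sup>2" using C0 by (simp only: mult_pos_pos)
    have n0: "0 < n" using pos n' by linarith
    have c2: "16 * sqrt_bound d / (real n * (\<epsilon> / 2)\<^sup>2) \<le> 1 / 20"
    proof -
      have "1280 * B * 1 * (1 / \<epsilon>)\<^sup>2 \<le> C * (w * L ^ (m + 2)) * (1 / \<epsilon>)\<^sup>2"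
        using wL B c1sq C0 by (intro mult_right_mono mult_mono) (auto simp: C_def)
      hence "1280 * B * (1 / \<epsilon>)\<^sup>2 \<le> real n" using n' by simp
      hence "1280 * B * (1 / \<epsilon>)\<^sup>2 * \<epsilon>\<^sup>2 \<le> real n * \<epsilon>\<^sup>2" by (rule mult_right_mono) simp
      hence b: "1280 * B \<le> real n * \<epsilon>\<^sup>2" using \<epsilon> by (simp add: power_divide)
      have "0 < real n * (\<epsilon> / 2)\<^sup>2" using n0 \<epsilon> by simp
      moreover have "16 * B * 20 \<le> real n * (\<epsilon> / 2)\<^sup>2" using b by (simp add: power_divide)
      ultimately show ?thesis unfolding B_def[symmetric] by (simp add: pos_divide_le_eq)
    qed
    have "8 * c1\<^sup>2 * (c5 + 40) * (w * L ^ (m + 2)) * (1 / \<epsilon>)\<^sup>2 \<le> C * (w * L ^ (m + 2)) * (1 / \<epsilon>)\<^sup>2"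
      using wL B by (intro mult_right_mono) (auto simp: C_def)
    hence n1: "8 * c1\<^sup>2 * (c5 + 40) * (w * L ^ (m + 2)) * (1 / \<epsilon>)\<^sup>2 \<le> real n" using n' by linarith
    have \<delta>2: "\<delta>\<^sup>2 * (16 * c1\<^sup>2 * L\<^sup>2 * (1 / \<epsilon>)\<^sup>2) = 1"
      unfolding \<delta> c1_def[symmetric] using \<epsilon> c1 L1 by (simp add: power_divide power_mult_distrib)
    have "S + 40 \<le> c5 * L ^ m * w + 40 * (w * L ^ m)"
    proof -
      have "1 \<le> w * L ^ m" using mult_mono[OF w one_le_power[OF L1, of m]] w by simp
      thus ?thesis using E unfolding w_def by linarith
    qed
    also have "\<dots> = (c5 + 40) * (w * L ^ m)" by (simp add: algebra_simps)
    also have "\<dots> = (c5 + 40) * (w * L ^ m) * (\<delta>\<^sup>2 * (16 * c1\<^sup>2 * L\<^sup>2 * (1 / \<epsilon>)\<^sup>2))" unfolding \<delta>2 by simp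
    also have "\<dots> = 2 * (8 * c1\<^sup>2 * (c5 + 40) * (w * L ^ (m + 2)) * (1 / \<epsilon>)\<^sup>2) * \<delta>\<^sup>2" by (simp add: power_add power2_eq_square mult_ac)
    also have "\<dots> \<le> 2 * real n * \<delta>\<^sup>2" by (intro mult_right_mono mult_left_mono n1) auto
    finally have key: "S + 40 \<le> 2 * real n * \<delta>\<^sup>2" .
    have "(1 + exp (S)) * exp (- 2 * real n * \<delta>\<^sup>2) \<le> (2 * exp (S)) * exp (- (S + 40))"
      using E key by (intro mult_mono) auto
    also have "\<dots> = 2 * exp (- 40)"
    proof -
      have "exp (S) * exp (- (S + 40)) = exp (- 40)" by (simp only: exp_add[symmetric]) simp
      thus ?thesis by simp
    qed
    also have "\<dots> \<le> 1 / 20"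
    proof -
      have "41 \<le> exp (40::real)" using exp_ge_add_one_self[of 40] by simp
      thus ?thesis by (simp add: exp_minus field_simps)
    qed
    finally show "0 < n \<and> (1 + exp (cover_entropy d (dev_level d \<epsilon>))) * exp (- 2 * real n * (dev_level d \<epsilon>)\<^sup>2) \<le> 1 / 20 \<and>
      16 * sqrt_bound d / (real n * (\<epsilon> / 2)\<^sup>2) \<le> 1 / 20" using n0 c2 by (simp add: S_def \<delta>_def)
  qed
qed

section \<open>From the random event to the estimator\<close>

lemma mle_lik_ge:
  assumes "is_log_concave_mle n X g" "f \<in> log_concave_densities" "\<And>i. i < n \<Longrightarrow> 0 < f (X i)" "0 < n"
  shows "\<And>i. i < n \<Longrightarrow> 0 < g (X i)" "(\<Sum>i<n. ln (f (X i))) \<le> (\<Sum>i<n. ln (g (X i)))"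
proof -
  have g: "g \<in> log_concave_densities" and le: "avg_log_lik n X f \<le> avg_log_lik n X g"
    using assms by (auto simp: is_log_concave_mle_def)
  note lf = avg_log_lik_real[of n f X, OF assms(3)]
  show pos: "0 < g (X i)" if i: "i < n" for i
  proof (rule ccontr)
    assume "\<not> 0 < g (X i)"
    hence "g (X i) = 0" using log_concave_densitiesD(3)[OF g, of "X i"] by simp
    hence "avg_log_lik n X g = -\<infinity>" using avg_log_lik_MInfty[of i n g X] i by simp
    thus False using le lf by simp
  qed
  show "(\<Sum>i<n. ln (f (X i))) \<le> (\<Sum>i<n. ln (g (X i)))"
    using le lf avg_log_lik_real[of n g X, OF pos] assms(4) by (simp add: divide_le_cancel)
qed

theorem theorem3:
  shows "\<exists>C>0::real. \<exists>c>0::real.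
    \<forall>\<epsilon>::real. 0 < \<epsilon> \<longrightarrow> \<epsilon> < 1 \<longrightarrow>
    (\<forall>n::nat. real n \<ge> C * (1 / \<epsilon>) powr ((real CARD('d::finite) + 3) / 2) * (ln (exp 1 / \<epsilon>)) powr c \<longrightarrow>
    (\<forall>f0 \<in> (log_concave_densities :: (real^'d \<Rightarrow> real) set).
       prob_at_least (iid_sample n f0) (9/10)
         (\<lambda>X. (\<exists>fhat. is_log_concave_mle n X fhat) \<and>
              (\<forall>fhat. is_log_concave_mle n X fhat \<longrightarrow> hellinger_sq fhat f0 \<le> \<epsilon>))))"
proof -
  define d where "d = CARD('d)"
  have d: "1 \<le> d" unfolding d_def by (simp add: Suc_leI)
  obtain C c where Cc: "0 < C" "0 < c"
    "\<And>\<epsilon> n. 0 < \<epsilon> \<Longrightarrow> \<epsilon> < 1 \<Longrightarrow>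
      C * (1 / \<epsilon>) powr ((real d + 3) / 2) * ln (exp 1 / \<epsilon>) powr c \<le> real n \<Longrightarrow>
      0 < n \<and> (1 + exp (cover_entropy d (dev_level d \<epsilon>))) * exp (- 2 * real n * (dev_level d \<epsilon>)\<^sup>2) \<le> 1 / 20 \<and>
      16 * sqrt_bound d / (real n * (\<epsilon> / 2)\<^sup>2) \<le> 1 / 20"
    by (rule sample_size_suffices[OF d]) (rule that)
  have "prob_at_least (iid_sample n f) (9/10) (\<lambda>X. (\<exists>fhat. is_log_concave_mle n X fhat) \<and>
              (\<forall>fhat. is_log_concave_mle n X fhat \<longrightarrow> hellinger_sq fhat f \<le> \<epsilon>))"
    if \<epsilon>: "0 < \<epsilon>" "\<epsilon> < 1" and n: "C * (1 / \<epsilon>) powr ((real d + 3) / 2) * (ln (exp 1 / \<epsilon>)) powr c \<le> real n"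
      and f: "f \<in> log_concave_densities" for \<epsilon> n and f :: "real^'d \<Rightarrow> real"
  proof -
    define P where "P = density lborel (\<lambda>x. ennreal (f x))"
    obtain x0 v0 A M where nd: "normalised_density f x0 v0 A M" by (rule normalised_density_exists[OF f])
    interpret nd: normalised_density f x0 v0 A M by (rule nd)
    note M = nd.M
    define B where "B = sqrt_bound d"
    have B: "1 \<le> B" unfolding B_def by (rule sqrt_bound_ge_1)
    define L where "L = ln (exp 1 / \<epsilon>)"
    have L1: "1 \<le> L" "ln (1 / \<epsilon>) = L - 1" unfolding L_def using ln_exp1_div[OF \<epsilon>(1)] \<epsilon> by auto
    define c1 where "c1 = dev_const d"
    have c1: "5 \<le> c1" unfolding c1_def by (rule dev_const_ge)
    define \<delta> where "\<delta> = dev_level d \<epsilon>"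
    have c1L: "5 \<le> c1 * L" using mult_mono[of 5 c1 1 L] c1 L1 by simp
    have \<delta>e: "\<delta> = \<epsilon> / (4 * (c1 * L))" by (simp add: \<delta>_def dev_level_def L_def c1_def mult.assoc)
    have \<delta>0: "0 < \<delta>" unfolding \<delta>e using \<epsilon> c1L by simp
    have "\<epsilon> \<le> 1 / 8 * (4 * (c1 * L))" using \<epsilon> c1L by linarith
    \<comment> \<open>\<open>good_sample\<close> is entered with \<open>2 * \<delta>\<close>, which
      has to be at most 1/4.\<close>
    hence \<delta>1: "\<delta> \<le> 1 / 8" unfolding \<delta>e using c1L by (subst pos_divide_le_eq) auto
    from Cc(3)[OF \<epsilon> n, folded \<delta>_def]
    have size: "0 < n" "(1 + exp (cover_entropy d \<delta>)) * exp (- 2 * real n * \<delta>\<^sup>2) \<le> 1 / 20"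
      "16 * B / (real n * (\<epsilon> / 2)\<^sup>2) \<le> 1 / 20" by (auto simp: B_def)
    have \<delta>le1: "\<delta> \<le> 1" using \<delta>1 by linarith
    obtain \<A> where \<A>: "finite \<A>" "\<A> \<subseteq> sets borel" "real (card \<A>) \<le> 1 + exp (cover_entropy d \<delta>)"
      "\<And>C. closed C \<Longrightarrow> convex C \<Longrightarrow> \<exists>S\<in>\<A>. C \<subseteq> S \<and> measure P S \<le> measure P C + \<delta>"
      by (rule nd.convex_upper_cover[OF \<delta>0 \<delta>le1, folded d_def P_def]) (rule that)
    have card\<A>: "real (card \<A>) * exp (- 2 * real n * \<delta>\<^sup>2) \<le> 1 / 20"
    proof -
      have "real (card \<A>) * exp (- 2 * real n * \<delta>\<^sup>2) \<le> (1 + exp (cover_entropy d \<delta>)) * exp (- 2 * real n * \<delta>\<^sup>2)"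
        using \<A>(3) by (intro mult_right_mono) auto
      thus ?thesis using size(2) by linarith
    qed
    note f' = log_concave_densitiesD[OF f]
    note [measurable] = f'(4)
    interpret P: prob_space P unfolding P_def by (rule density_prob_space[OF f])
    interpret S: iid P n by unfold_locales (simp add: P_def)
    have Ssam: "S.S = iid_sample n f" unfolding iid_sample_def P_def[symmetric] by (rule S.S_def)
    let ?g = "\<lambda>x. ln (M / f x)"
    have gm: "?g \<in> borel_measurable borel" by measurable
    note mom = log_deficit_moments[OF f M, folded P_def]
    have N: "{x. f x = 0} \<in> sets borel" by measurable
    have N0: "measure P {x. f x = 0} = 0"
    proof -
      have "measure P {x. f x = 0} = (\<integral>x. f x * indicator {x. f x = 0} x \<partial>lborel)"
        unfolding P_def by (rule density_measure_integral[OF f N])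
      also have "\<dots> = (\<integral>x. 0 \<partial>(lborel :: (real^'d) measure))"
        by (intro Bochner_Integration.integral_cong) (auto simp: indicator_def)
      finally show ?thesis by simp
    qed
    have mom2: "(\<integral>x. (?g x)\<^sup>2 \<partial>P) \<le> 16 * B" using mom(2) by (simp add: B_def d_def)
    have \<epsilon>2: "0 < \<epsilon> / 2" using \<epsilon> by simp
    obtain E where E: "E \<in> sets S.S" "9 / 10 \<le> measure S.S E"
      "\<And>X A. X \<in> E \<Longrightarrow> A \<in> \<A> \<Longrightarrow> (\<Sum>i<n. indicator A (X i)) \<le> real n * (measure P A + \<delta>)"
      "\<And>X. X \<in> E \<Longrightarrow> (\<Sum>i<n. ?g (X i)) \<le> real n * ((\<integral>x. ?g x \<partial>P) + \<epsilon> / 2)"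
      "\<And>X i. X \<in> E \<Longrightarrow> i < n \<Longrightarrow> X i \<notin> {x. f x = 0}"
      by (rule S.sample_event[OF size(1) \<A>(1,2) card\<A> less_imp_le[OF \<delta>0] gm mom(1) mom2 \<epsilon>2 size(3) N N0]) (rule that)
    have "(\<exists>fhat. is_log_concave_mle n X fhat) \<and> (\<forall>fhat. is_log_concave_mle n X fhat \<longrightarrow> hellinger_sq fhat f \<le> \<epsilon>)"
      if X: "X \<in> E" for X
    proof -
      \<comment> \<open>One \<open>\<delta>\<close> is the excess of the covering set, the other the
        deviation of its frequency.\<close>
      have dev: "(\<Sum>i<n. indicator C (X i)) \<le> real n * (measure P C + 2 * \<delta>)" if C: "closed C" "convex C" for C
      proof -
        obtain S where S: "S \<in> \<A>" "C \<subseteq> S" "measure P S \<le> measure P C + \<delta>" using \<A>(4)[OF C] by blast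
        have "(\<Sum>i<n. indicator C (X i) :: real) \<le> (\<Sum>i<n. indicator S (X i))"
          using S(2) by (intro sum_mono) (auto simp: indicator_def)
        also have "\<dots> \<le> real n * (measure P S + \<delta>)" by (rule E(3)[OF X S(1)])
        also have "\<dots> \<le> real n * (measure P C + 2 * \<delta>)" using S(3) by (intro mult_left_mono) auto
        finally show ?thesis .
      qed
      have fpos: "0 < f (X i)" if "i < n" for i using E(5)[OF X that] f'(3)[of "X i"] by simp
      \<comment> \<open>A hull without interior would be null for \<open>f\<close> and yet contain
        the whole sample: frequency 1 against the allowed 1/4.\<close>
      have "interior (convex hull (X ` {..<n})) \<noteq> {}"
      proof
        let ?H = "convex hull (X ` {..<n})"
        assume e: "interior ?H = {}"
        have H: "compact ?H" "convex ?H" by (auto intro: finite_imp_compact_convex_hull)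
        have "emeasure lborel ?H = 0" using e H by (intro convex_closed_empty_interior_null compact_imp_closed)
        hence "measure lborel ?H = 0" by (simp add: measure_def)
        moreover have "measure P ?H \<le> M * measure lborel ?H" unfolding P_def
          by (rule density_prob_le[OF f M(3) fmeasurable_compact[OF H(1)]])
        ultimately have "measure P ?H \<le> 0" by simp
        hence "real n * (measure P ?H + 2 * \<delta>) \<le> real n * (1 / 4)" using \<delta>1 by (intro mult_left_mono) auto
        hence "(\<Sum>i<n. indicator ?H (X i)) \<le> real n * (1 / 4)"
          using dev[OF compact_imp_closed[OF H(1)] H(2)] by linarith
        moreover have "(\<Sum>i<n. indicator ?H (X i)) = (\<Sum>i<n. 1::real)"
          by (intro sum.cong) (auto simp: indicator_def hull_inc)
        ultimately show False using size(1) by simp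
      qed
      hence "\<exists>fhat. is_log_concave_mle n X fhat" by (rule mle_exists[OF size(1)])
      moreover have "hellinger_sq g f \<le> \<epsilon>" if g: "is_log_concave_mle n X g" for g
      proof -
        note eps = \<epsilon>
        have gF: "g \<in> log_concave_densities" using g by (simp add: is_log_concave_mle_def)
        obtain z0 where z0: "0 < g z0" "\<And>x. g x \<le> g z0" using density_attains_max[OF gF] by blast
        interpret good_sample f g x0 z0 M "g z0" X n "2 * \<delta>" "\<epsilon> / 2"
        proof unfold_locales
          show "(\<Sum>i<n. ln (M / f (X i))) \<le> real n * ((\<integral>x. ln (M / f x) \<partial>density lborel (\<lambda>x. ennreal (f x))) + \<epsilon> / 2)"
            using E(4)[OF X] by (simp add: P_def)
          show "0 < g (X i)" if "i < n" for i using mle_lik_ge(1)[OF g f fpos size(1)] that by blast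
          show "(\<Sum>i<n. ln (f (X i))) \<le> (\<Sum>i<n. ln (g (X i)))" using mle_lik_ge(2)[OF g f fpos size(1)] .
        qed (use f gF M z0 size(1) dev[unfolded P_def] fpos \<delta>0 \<delta>1 \<epsilon> in auto)
        \<comment> \<open>The cost of truncation \<open>sqrt \<alpha> * B\<close> becomes
          \<open>\<epsilon> / 4\<close>, while \<open>ln (1 / \<alpha>)\<close> stays of order
          \<open>ln (exp 1 / \<epsilon>)\<close>.\<close>
        define \<alpha> where "\<alpha> = (\<epsilon> / (4 * B))\<^sup>2"
        have q: "0 < \<epsilon> / (4 * B)" "\<epsilon> / (4 * B) \<le> 1" using eps B by (auto simp: field_simps)
        have \<alpha>: "0 < \<alpha>" "\<alpha> \<le> 1" unfolding \<alpha>_def using q by (auto intro: power_le_one)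
        have s\<alpha>: "sqrt \<alpha> * B = \<epsilon> / 4" unfolding \<alpha>_def using eps B by simp
        have "1 / \<alpha> = (4 * B * (1 / \<epsilon>))\<^sup>2" unfolding \<alpha>_def by (simp add: power_divide)
        hence "ln (1 / \<alpha>) = 2 * ln (4 * B * (1 / \<epsilon>))" using B eps by (simp add: ln_realpow)
        also have "ln (4 * B * (1 / \<epsilon>)) = ln (4 * B) + (L - 1)"
          using ln_mult_pos[of "4 * B" "1 / \<epsilon>"] B eps L1(2) by simp
        finally have l: "2 + sup_bound d + ln (1 / \<alpha>) = sup_bound d + 2 * ln (4 * B) + 2 * L" by simp
        have "sup_bound d + 2 * ln (4 * B) \<le> (sup_bound d + 2 * ln (4 * B)) * L"
        proof -
          have "0 \<le> sup_bound d + 2 * ln (4 * B)" using sup_bound_pos[of d] B by simp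
          from mult_left_mono[OF L1(1) this] show ?thesis by simp
        qed
        hence "2 + sup_bound d + ln (1 / \<alpha>) \<le> (sup_bound d + 2 * ln (4 * B)) * L + 2 * L" unfolding l by simp
        also have "\<dots> \<le> c1 * L" using L1 by (simp add: c1_def dev_const_def B_def algebra_simps)
        finally have "2 * \<delta> * (2 + sup_bound d + ln (1 / \<alpha>)) \<le> 2 * \<delta> * (c1 * L)" using \<delta>0 by (intro mult_left_mono) auto
        also have "\<dots> = \<epsilon> / 2" 
        proof -
          have "c1 * L \<noteq> 0" using c1L by linarith
          thus ?thesis unfolding \<delta>e by simp
        qed
        finally have W: "2 * \<delta> * (2 + sup_bound d + ln (1 / \<alpha>)) \<le> \<epsilon> / 2" .
        \<comment> \<open>The budget is \<open>(\<epsilon> / 2 + \<epsilon> / 2) / 2 + \<epsilon> /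
          4 = 3 * \<epsilon> / 4\<close>.\<close>
        have sum: "h \<le> \<epsilon>" if "h \<le> (\<epsilon> / 2 + w) / 2 + q" "w \<le> \<epsilon> / 2" "q = \<epsilon> / 4" for h w q :: real
          using that eps by (simp add: add_divide_distrib)
        have "hellinger_sq g f \<le> (\<epsilon> / 2 + 2 * \<delta> * (2 + sup_bound d + ln (1 / \<alpha>))) / 2 + sqrt \<alpha> * B"
          using mle_hellinger[OF \<alpha>] by (simp add: d_def B_def)
        thus ?thesis using W s\<alpha> by (rule sum)
      qed
      ultimately show ?thesis by blast
    qed
    thus ?thesis unfolding prob_at_least_def using E(1,2) unfolding Ssam by blast
  qed
  thus ?thesis using Cc(1,2) unfolding d_def by blast
qed

end
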